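(* The determinant of the Gram matrix $G=(\langle b_p|b_{p'}\rangle)_{p,p'}$ of $W^{(N)}(b)$ in the basis $\mathbf B_1$ is, for $N$ even, $$\det G=\alpha_N\prod_{n=0}^{(N-2)/2}\Big(\prod_{\epsilon_1,\epsilon_2,\epsilon_3=\pm1}[(1+2n+\epsilon_1\omega_1+\epsilon_2\omega_2+\epsilon_3\theta)/2]\Big)^{M_N(2n+1)},$$ and for $N$ odd, $$\det G=\alpha_N\Big(\prod_{\epsilon_2,\epsilon_3=\pm1}[(\omega_1+\epsilon_2\omega_2+\epsilon_3\theta)/2]\Big)^{2^{N-1}}\prod_{n=1}^{(N-1)/2}\Big(\prod_{\epsilon_1,\epsilon_2,\epsilon_3=\pm1}[(2n+\epsilon_1\omega_1+\epsilon_2\omega_2+\epsilon_3\theta)/2]\Big)^{M_N(2n)},$$ where in both cases $$\alpha_N=\big([\omega_1][\omega_2+1]\big)^{-2\sum_{m=0}^{N-1}M_N(N-1-2m)}.$$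
   Context: Let $N$ be a positive integer. Let $\eta,\omega_1,\omega_2,\theta$ be generic complex parameters (in particular every denominator below is nonzero); write $q^x=e^{\eta x}$ and $[x]=\frac{q^x-q^{-x}}{q-q^{-1}}$. Put $\delta=[2]$, $s_1=\frac{[\omega_1]}{[\omega_1+1]}$, $s_2=\frac{[\omega_2]}{[\omega_2+1]}$. $M_m(n)=\sum_{i=1}^{(m+1-|n|)/2}B_{m,|n|+2i-1}$, where $B_{m,n}=\binom{m}{(m-n)/2}$. The 2BTL algebra is the unital complex algebra with generators $e_0,\dots,e_N$ and relations $e_i^2=\delta e_i$, $e_ie_{i\pm1}e_i=e_i$ for $1\le i\le N-1$ (with $i\pm1\in\{0,\dots,N\}$), $e_0^2=s_1e_0$, $e_N^2=s_2e_N$, $e_ie_j=e_je_i$ for $|i-j|>1$. For $N$ even set $I_1=e_1e_3\cdots e_{N-1}$, $I_2=e_0e_2\cdots e_N$ and $b=\frac{[(\omega_1+\omega_2+1+\theta)/2][(\omega_1+\omega_2+1-\theta)/2]}{[\omega_1+1][\omega_2+1]}$; for $N$ odd set $I_1=e_1e_3\cdots e_N$, $I_2=e_0e_2\cdots e_{N-1}$ and $b=-\frac{[(\omega_1-\omega_2+\theta)/2][(\omega_1-\omega_2-\theta)/2]}{[\omega_1+1][\omega_2+1]}$. The double quotient $\mathcal A_b$ is the quotient of 2BTL by $I_1I_2I_1=bI_1$, $I_2I_1I_2=bI_2$. Define $E_0=1$ and $E_i=s_1^{(-1)^i}E_{i-1}e_{i-1}E_{i-1}$ for $1\le i\le N$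 (idempotents). The $2^N$-dimensional module $W^{(N)}(b)$ is realised as the left ideal $\mathcal A_bE_N$. Bilinear form: let $a\mapsto a^T$ be the anti-automorphism of $\mathcal A_b$ fixing every $e_i$ (in diagrams: reflection in the horizontal axis). For $x,y\in W^{(N)}(b)$ write $|x\rangle\langle y|=xy^T\in\mathcal A_b$, so that $E_N=|E_N\rangle\langle E_N|$. The symmetric bilinear form $\langle\cdot|\cdot\rangle$ on $W^{(N)}(b)$ is defined by $|x_1\rangle\langle x_2|\,|x_3\rangle\langle x_4|=\langle x_2|x_3\rangle\,|x_1\rangle\langle x_4|$ (this makes sense because $E_N^T=E_N$ and $E_N\mathcal A_bE_N=\mathbb C E_N$). In particular $\langle E_N|E_N\rangle=1$. Put $r(u)=\frac{[u+1]}{[u]}$, $k(u)=-\frac{[(u-\omega_2+\theta)/2][(u-\omega_2-\theta)/2]}{[u][\omega_2+1]}$, $R_i(u)=e_i-r(u)$, $K_N(u)=e_N-k(u)$. A path is $p=(h_0,\dots,h_N)$ with $h_0=0$, $h_{i+1}-h_i=\pm1$. The fundamental path is $p_0=(0,-1,0,-1,0,\dots)$. A path $p'$ is obtained from $p$ by adding a tile at point $i$ ($1\le i\le N-1$) if they agree except at $i$, $h_{i-1}=h_{i+1}$, and: either $h_{i-1}\ge0$, $h_i=h_{i-1}-1$, $h_i'=h_{i-1}+1$ (tile added from above), or $h_{i-1}<0$, $h_i=h_{i-1}+1$, $h'_i=h_{i-1}-1$ (tile added from below). It is obtained by adding a right boundary half-tile if they agree except at $N$ and the same conditions hold with $i=N$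 (omitting the condition on $h_{i+1}$). Every path is obtained from $p_0$ by successive additions. The basis $\mathbf B_1=\{b_p\}$ of $W^{(N)}(b)$ is defined by $b_{p_0}=E_N$ and $b_{p'}=X_ib_p$ when $p'$ is obtained from $p$ by adding a tile or half-tile at $i$, where: from above, $X_i=R_i(\omega_1-h_{i-1})$ for $i<N$, and $X_N=K_N(\omega_1-h_{N-1})$; from below, $X_i=R_i(-\omega_1+h_{i-1})$ for $i<N$, and $X_N=K_N(-\omega_1+h_{N-1})$. (This is independent of the order of additions.)
   Formalization: For N=1 the right-hand side carries an extra factor −1: there G=diag(1, k(ω_1)k(−ω_1)), so det G is minus the printed value; for every N≥2 the formulas are as printed. *)

theory Defs
  imports
    Complex_Main
    "HOL-Library.Poly_Mapping"
    "HOL-Algebra.QuotRing"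
    "Jordan_Normal_Form.Determinant"
begin

section \<open>q-numbers and multiplicities\<close>

definition qpow :: "complex \<Rightarrow> complex \<Rightarrow> complex" where
  "qpow \<eta> x = exp (\<eta> * x)"

definition qnum :: "complex \<Rightarrow> complex \<Rightarrow> complex" where
  "qnum \<eta> x = (qpow \<eta> x - qpow \<eta> (- x)) / (qpow \<eta> 1 - qpow \<eta> (- 1))"

text \<open>In both definitions, \<open>n\<close> has the parity that makes the halves integral:
  \<open>n \<equiv> m\<close> modulo 2 in \<open>Bnum\<close> and \<open>n \<equiv> m + 1\<close> modulo 2 in \<open>Mnum\<close>.\<close>

definition Bnum :: "nat \<Rightarrow> int \<Rightarrow> nat" where
  "Bnum m n = m choose nat ((int m - n) div 2)"

definition Mnum :: "nat \<Rightarrow> int \<Rightarrow> nat" where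
  "Mnum m n = (\<Sum>i = 1..(int m + 1 - \<bar>n\<bar>) div 2. Bnum m (\<bar>n\<bar> + 2 * i - 1))"

section \<open>The free algebra\<close>

text \<open>Finitely supported functions on the additively written free monoid carry the convolution
  product of \<open>Poly_Mapping\<close>; this is the free unital algebra. A separate type of words is used
  in order not to instantiate \<open>list\<close> itself.\<close>

datatype gword = GWord (letters: "nat list")

instantiation gword :: monoid_add
begin

definition zero_gword :: gword where
  "zero_gword = GWord []"

definition plus_gword :: "gword \<Rightarrow> gword \<Rightarrow> gword" where
  "plus_gword v w = GWord (letters v @ letters w)"

instance
  by standard (simp_all add: zero_gword_def plus_gword_def)

end

type_synonym fralg = "gword \<Rightarrow>\<^sub>0 complex"

definition fgen :: "nat \<Rightarrow> fralg" where
  "fgen i = Poly_Mapping.single (GWord [i]) 1"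

definition fconst :: "complex \<Rightarrow> fralg" where
  "fconst c = Poly_Mapping.single 0 c"

definition free_alg :: "nat \<Rightarrow> fralg ring" where
  "free_alg N =
    \<lparr> carrier = {f. \<forall>w \<in> Poly_Mapping.keys f. set (letters w) \<subseteq> {0..N}},
      monoid.mult = (*), one = 1, zero = 0, add = (+) \<rparr>"

definition word_rev :: "gword \<Rightarrow> gword" where
  "word_rev w = GWord (rev (letters w))"

definition frev :: "fralg \<Rightarrow> fralg" where
  "frev f = Poly_Mapping.map_key word_rev f"

lemma lookup_frev: "Poly_Mapping.lookup (frev f) w = Poly_Mapping.lookup f (word_rev w)"
proof -
  have "inj word_rev"
    by (auto intro!: injI simp: word_rev_def intro: gword.expand)
  then show ?thesis
    by (simp add: frev_def map_key.rep_eq)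
qed

lemma ring_free_alg: "ring (free_alg N)"
proof (rule ringI)
  show "abelian_group (free_alg N)"
  proof (rule abelian_groupI)
    fix x y assume xy: "x \<in> carrier (free_alg N)" "y \<in> carrier (free_alg N)"
    have "Poly_Mapping.keys (x + y) \<subseteq> Poly_Mapping.keys x \<union> Poly_Mapping.keys y"
      by (rule Poly_Mapping.keys_add)
    with xy show "x \<oplus>\<^bsub>free_alg N\<^esub> y \<in> carrier (free_alg N)"
      by (fastforce simp: free_alg_def)
  next
    fix x assume "x \<in> carrier (free_alg N)"
    then show "\<exists>y\<in>carrier (free_alg N). y \<oplus>\<^bsub>free_alg N\<^esub> x = \<zero>\<^bsub>free_alg N\<^esub>"
      by (intro bexI[of _ "- x"]) (auto simp: free_alg_def)
  qed (auto simp: free_alg_def algebra_simps)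
next
  show "Group.monoid (free_alg N)"
  proof (rule monoidI)
    fix x y assume xy: "x \<in> carrier (free_alg N)" "y \<in> carrier (free_alg N)"
    have "Poly_Mapping.keys (x * y) \<subseteq>
        {a + b | a b. a \<in> Poly_Mapping.keys x \<and> b \<in> Poly_Mapping.keys y}"
      by (rule Poly_Mapping.keys_mult)
    with xy show "x \<otimes>\<^bsub>free_alg N\<^esub> y \<in> carrier (free_alg N)"
      by (fastforce simp: free_alg_def plus_gword_def)
  next
    show "\<one>\<^bsub>free_alg N\<^esub> \<in> carrier (free_alg N)"
      by (auto simp: free_alg_def zero_gword_def)
  qed (auto simp: free_alg_def mult.assoc)
qed (auto simp: free_alg_def algebra_simps)

section \<open>Paths\<close>

definition paths :: "nat \<Rightarrow> int list set" where
  "paths N = {h. length h = N + 1 \<and> h ! 0 = 0 \<and>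
                 (\<forall>i<N. h ! (i + 1) - h ! i = 1 \<or> h ! (i + 1) - h ! i = - 1)}"

definition fund_path :: "nat \<Rightarrow> int list" where
  "fund_path N = map (\<lambda>i. if even i then 0 else - 1) [0..<N + 1]"

text \<open>The case \<open>i = N\<close> is the right boundary half-tile.\<close>

definition adds_above :: "nat \<Rightarrow> nat \<Rightarrow> int list \<Rightarrow> int list \<Rightarrow> bool" where
  "adds_above N i p p' \<longleftrightarrow> p \<in> paths N \<and> p' \<in> paths N \<and> 1 \<le> i \<and> i \<le> N \<and>
     (\<forall>j\<le>N. j \<noteq> i \<longrightarrow> p' ! j = p ! j) \<and>
     (i < N \<longrightarrow> p ! (i - 1) = p ! (i + 1)) \<and>
     p ! (i - 1) \<ge> 0 \<and> p ! i = p ! (i - 1) - 1 \<and> p' ! i = p ! (i - 1) + 1"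

definition adds_below :: "nat \<Rightarrow> nat \<Rightarrow> int list \<Rightarrow> int list \<Rightarrow> bool" where
  "adds_below N i p p' \<longleftrightarrow> p \<in> paths N \<and> p' \<in> paths N \<and> 1 \<le> i \<and> i \<le> N \<and>
     (\<forall>j\<le>N. j \<noteq> i \<longrightarrow> p' ! j = p ! j) \<and>
     (i < N \<longrightarrow> p ! (i - 1) = p ! (i + 1)) \<and>
     p ! (i - 1) < 0 \<and> p ! i = p ! (i - 1) + 1 \<and> p' ! i = p ! (i - 1) - 1"

section \<open>The algebra, its module, and the Gram matrix\<close>

locale two_boundary_TL =
  fixes N :: nat and \<eta> \<omega>1 \<omega>2 \<theta> :: complex
begin

definition loop :: complex where
  "loop = qnum \<eta> 2"

definition s1 :: complex where
  "s1 = qnum \<eta> \<omega>1 / qnum \<eta> (\<omega>1 + 1)"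

definition s2 :: complex where
  "s2 = qnum \<eta> \<omega>2 / qnum \<eta> (\<omega>2 + 1)"

definition b :: complex where
  "b = (if even N
        then qnum \<eta> ((\<omega>1 + \<omega>2 + 1 + \<theta>) / 2) * qnum \<eta> ((\<omega>1 + \<omega>2 + 1 - \<theta>) / 2)
               / (qnum \<eta> (\<omega>1 + 1) * qnum \<eta> (\<omega>2 + 1))
        else - (qnum \<eta> ((\<omega>1 - \<omega>2 + \<theta>) / 2) * qnum \<eta> ((\<omega>1 - \<omega>2 - \<theta>) / 2)
               / (qnum \<eta> (\<omega>1 + 1) * qnum \<eta> (\<omega>2 + 1))))"

text \<open>For both parities of \<open>N\<close>, \<open>I1\<close> is the product of all odd and \<open>I2\<close> of all even generators.\<close>

definition I1 :: fralg where
  "I1 = prod_list (map fgen (filter odd [0..<N + 1]))"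

definition I2 :: fralg where
  "I2 = prod_list (map fgen (filter even [0..<N + 1]))"

definition relators_2BTL :: "fralg set" where
  "relators_2BTL =
     {fgen i * fgen i - fconst loop * fgen i | i. 1 \<le> i \<and> i < N}
   \<union> {fgen i * fgen j * fgen i - fgen i | i j. 1 \<le> i \<and> i < N \<and> (j = i + 1 \<or> i = j + 1)}
   \<union> {fgen 0 * fgen 0 - fconst s1 * fgen 0, fgen N * fgen N - fconst s2 * fgen N}
   \<union> {fgen i * fgen j - fgen j * fgen i | i j. i \<le> N \<and> j \<le> N \<and> \<bar>int i - int j\<bar> > 1}"

definition relators :: "fralg set" where
  "relators = relators_2BTL \<union> {I1 * I2 * I1 - fconst b * I1, I2 * I1 * I2 - fconst b * I2}"

definition relideal :: "fralg set" where
  "relideal = genideal (free_alg N) relators"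

text \<open>The elements of the algebra are cosets of the ideal of relations.\<close>

definition Ab :: "fralg set ring" where
  "Ab = free_alg N Quot relideal"

definition cls :: "fralg \<Rightarrow> fralg set" where
  "cls f = relideal +>\<^bsub>free_alg N\<^esub> f"

definition e :: "nat \<Rightarrow> fralg set" where
  "e i = cls (fgen i)"

definition smul :: "complex \<Rightarrow> fralg set \<Rightarrow> fralg set" where
  "smul c x = cls (fconst c) \<otimes>\<^bsub>Ab\<^esub> x"

primrec E :: "nat \<Rightarrow> fralg set" where
  "E 0 = \<one>\<^bsub>Ab\<^esub>"
| "E (Suc i) = smul (s1 powi ((- 1) ^ Suc i)) (E i \<otimes>\<^bsub>Ab\<^esub> e i \<otimes>\<^bsub>Ab\<^esub> E i)"

definition W :: "fralg set set" where
  "W = {a \<otimes>\<^bsub>Ab\<^esub> E N | a. a \<in> carrier Ab}"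

text \<open>Word reversal fixes each generator and preserves the ideal of relations, so the image of a
  coset is again a coset.\<close>

definition transp :: "fralg set \<Rightarrow> fralg set" where
  "transp x = frev ` x"

definition ketbra :: "fralg set \<Rightarrow> fralg set \<Rightarrow> fralg set" where
  "ketbra x y = x \<otimes>\<^bsub>Ab\<^esub> transp y"

definition form :: "fralg set \<Rightarrow> fralg set \<Rightarrow> complex" where
  "form x2 x3 = (THE c. \<forall>x1\<in>W. \<forall>x4\<in>W.
      ketbra x1 x2 \<otimes>\<^bsub>Ab\<^esub> ketbra x3 x4 = smul c (ketbra x1 x4))"

definition r :: "complex \<Rightarrow> complex" where
  "r u = qnum \<eta> (u + 1) / qnum \<eta> u"

definition k :: "complex \<Rightarrow> complex" where
  "k u = - (qnum \<eta> ((u - \<omega>2 + \<theta>) / 2) * qnum \<eta> ((u - \<omega>2 - \<theta>) / 2)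
              / (qnum \<eta> u * qnum \<eta> (\<omega>2 + 1)))"

definition R :: "nat \<Rightarrow> complex \<Rightarrow> fralg set" where
  "R i u = e i \<ominus>\<^bsub>Ab\<^esub> smul (r u) \<one>\<^bsub>Ab\<^esub>"

definition K :: "complex \<Rightarrow> fralg set" where
  "K u = e N \<ominus>\<^bsub>Ab\<^esub> smul (k u) \<one>\<^bsub>Ab\<^esub>"

definition X :: "nat \<Rightarrow> complex \<Rightarrow> fralg set" where
  "X i u = (if i < N then R i u else K u)"

text \<open>\<open>basis_rel p x\<close>: some sequence of additions leading from the fundamental path to \<open>p\<close>
  produces the vector \<open>x\<close>. Since \<open>x\<close> does not depend on the sequence, \<open>bvec\<close> is well defined.\<close>

inductive basis_rel :: "int list \<Rightarrow> fralg set \<Rightarrow> bool" where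
  fund: "basis_rel (fund_path N) (E N)"
| above: "basis_rel p x \<Longrightarrow> adds_above N i p p' \<Longrightarrow>
    basis_rel p' (X i (\<omega>1 - of_int (p ! (i - 1))) \<otimes>\<^bsub>Ab\<^esub> x)"
| below: "basis_rel p x \<Longrightarrow> adds_below N i p p' \<Longrightarrow>
    basis_rel p' (X i (- \<omega>1 + of_int (p ! (i - 1))) \<otimes>\<^bsub>Ab\<^esub> x)"

definition bvec :: "int list \<Rightarrow> fralg set" where
  "bvec p = (THE x. basis_rel p x)"

text \<open>Gram matrix with respect to an enumeration \<open>ps\<close> of the paths.\<close>

definition gram :: "int list list \<Rightarrow> complex mat" where
  "gram ps = mat (length ps) (length ps) (\<lambda>(i, j). form (bvec (ps ! i)) (bvec (ps ! j)))"

definition alpha :: complex where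
  "alpha = (qnum \<eta> \<omega>1 * qnum \<eta> (\<omega>2 + 1))
     powi (- 2 * int (\<Sum>m = 0..N - 1. Mnum N (int N - 1 - 2 * int m)))"

end

end

theory Submission
  imports Defs
begin

text \<open>The basis \<open>\<B>\<^sub>1\<close> is a seminormal basis: whenever \<open>h\<^sub>i\<^sub>-\<^sub>1 \<noteq> h\<^sub>i\<^sub>+\<^sub>1\<close>, the generator \<open>e\<^sub>i\<close> kills \<open>b\<^sub>p\<close>.
  This follows by induction on the number of tiles, from the Yang--Baxter and reflection
  computations and from the relations \<open>e\<^sub>i e\<^sub>i\<^sub>\<plusminus>\<^sub>1 E\<^sub>N = c e\<^sub>i E\<^sub>N\<close>. Therefore \<open>E\<^sub>N b\<^sub>p = 0\<close> unless \<open>p = p\<^sub>0\<close>, the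
  basis is orthogonal, and adding a tile with parameter \<open>u\<close> multiplies \<open>\<langle>b\<^sub>p|b\<^sub>p\<rangle>\<close> by \<open>r(u) r(-u)\<close>, or by
  \<open>k(u) k(-u)\<close> for a half-tile. The form is well defined because \<open>E\<^sub>N \<noteq> 0\<close>, which is read off a
  representation of the double quotient on functions of paths. Finally the diagonal
  entries are multiplied by counting paths: the half-tile at height \<open>a\<close> occurs in \<open>M\<^sub>N(a)\<close> of them, and
  the factors \<open>[\<omega>\<^sub>1 - a]\<close> with \<open>a \<noteq> 0\<close> cancel.\<close>

section \<open>Tiles on paths\<close>

text \<open>The algebra is given only by generators and relations, so no element of it is visibly
  nonzero: all computations are identities between products, and the single inequality E_N \<noteq>
  0 is imported from the representation. The weights are abstract because the seminormal computation
  uses q-numbers only through identities such as \<open>psi_rec\<close>, \<open>kappa_sum\<close>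
  and \<open>kappa_psi\<close>; the same identities make slopes vanish in the algebra and make the
  representation satisfy the relations. The delicate place is the right boundary, where a half-tile
  has no second neighbour: there the generator e_N does not kill the vector in question, and the
  argument passes to a reflected path. The scalar b is the product of all weights along p_0. Signs:
  k(u) k(-u) carries a minus sign. Half-tiles at the heights a and -a occur equally often, so the
  signs cancel in pairs, except at height 0, which is present for odd N only and occurs 2^(N-1)
  times. Hence an extra sign remains for N = 1 and for no other N.\<close>

definition corner :: "nat \<Rightarrow> int list \<Rightarrow> nat \<Rightarrow> bool" where
  "corner N p i \<longleftrightarrow> 1 \<le> i \<and> i \<le> N \<and> (i < N \<longrightarrow> p ! (i - 1) = p ! (i + 1))"

text \<open>Adding and removing a tile are the same reflection in the preceding height, so one
  involution serves for tiles and half-tiles, from above and from below.\<close>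

definition flip :: "int list \<Rightarrow> nat \<Rightarrow> int list" where
  "flip p i = p[i := 2 * p ! (i - 1) - p ! i]"

definition removable :: "nat \<Rightarrow> int list \<Rightarrow> nat \<Rightarrow> bool" where
  "removable N p i \<longleftrightarrow> corner N p i \<and>
     p ! i = (if p ! (i - 1) \<ge> 0 then p ! (i - 1) + 1 else p ! (i - 1) - 1)"

definition addable :: "nat \<Rightarrow> int list \<Rightarrow> nat \<Rightarrow> bool" where
  "addable N p i \<longleftrightarrow> corner N p i \<and>
     p ! i = (if p ! (i - 1) \<ge> 0 then p ! (i - 1) - 1 else p ! (i - 1) + 1)"

text \<open>Twice the distance of the heights from -1/2, the level around which p_0 oscillates. It
  is minimal at p_0 and grows with every added tile, so it stands in for the number of tiles in all
  inductions.\<close>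

definition height_sum :: "int list \<Rightarrow> nat" where
  "height_sum p = nat (\<Sum>x\<leftarrow>p. \<bar>2 * x + 1\<bar>)"

lemma paths_length: "p \<in> paths N \<Longrightarrow> length p = N + 1"
  by (simp add: paths_def)

lemma paths_0: "p \<in> paths N \<Longrightarrow> p ! 0 = 0"
  by (simp add: paths_def)

lemma paths_Suc:
  "p \<in> paths N \<Longrightarrow> i < N \<Longrightarrow> p ! Suc i = p ! i + 1 \<or> p ! Suc i = p ! i - 1"
  unfolding paths_def by (force dest: spec[of _ i])

lemma paths_step:
  assumes "p \<in> paths N" "1 \<le> i" "i \<le> N"
  shows "p ! i = p ! (i - 1) + 1 \<or> p ! i = p ! (i - 1) - 1"
  using paths_Suc[OF assms(1), of "i - 1"] assms(2,3) by simp

lemma paths_bound: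
  assumes "p \<in> paths N" "i \<le> N"
  shows "\<bar>p ! i\<bar> \<le> int i"
  using assms(2)
proof (induction i)
  case 0
  then show ?case using paths_0[OF assms(1)] by simp
next
  case (Suc i)
  then show ?case using paths_Suc[OF assms(1), of i] by auto
qed

lemma paths_parity:
  assumes "p \<in> paths N" "i \<le> N"
  shows "even (p ! i) = even i"
  using assms(2)
proof (induction i)
  case 0
  then show ?case using paths_0[OF assms(1)] by simp
next
  case (Suc i)
  then show ?case using paths_Suc[OF assms(1), of i] by auto
qed

lemma pathsI:
  assumes "length p = N + 1" "p ! 0 = 0"
    "\<And>i. i < N \<Longrightarrow> p ! Suc i = p ! i + 1 \<or> p ! Suc i = p ! i - 1"
  shows "p \<in> paths N"
  using assms unfolding paths_def by force

lemma fund_path_nth: "i \<le> N \<Longrightarrow> fund_path N ! i = (if even i then 0 else -1)"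
  unfolding fund_path_def by (subst nth_map) (auto simp del: upt_Suc)

lemma fund_path_in_paths: "fund_path N \<in> paths N"
  by (rule pathsI) (simp_all add: fund_path_nth, simp_all add: fund_path_def)

lemma paths_eqI:
  "p \<in> paths N \<Longrightarrow> q \<in> paths N \<Longrightarrow> (\<And>i. i \<le> N \<Longrightarrow> p ! i = q ! i) \<Longrightarrow> p = q"
  by (rule nth_equalityI) (auto simp: paths_length)

lemma cornerD: "corner N p i \<Longrightarrow> 1 \<le> i \<and> i \<le> N"
  by (simp add: corner_def)

lemma removable_corner: "removable N p i \<Longrightarrow> corner N p i"
  by (simp add: removable_def)

lemma removableD:
  assumes "removable N p i"
  shows "1 \<le> i" "i \<le> N" "i < N \<Longrightarrow> p ! (i - 1) = p ! Suc i"
    "p ! i = (if p ! (i - 1) \<ge> 0 then p ! (i - 1) + 1 else p ! (i - 1) - 1)"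
  using assms unfolding removable_def corner_def Suc_eq_plus1 by blast+

lemma addableD:
  assumes "addable N p i"
  shows "1 \<le> i" "i \<le> N" "i < N \<Longrightarrow> p ! (i - 1) = p ! Suc i"
    "p ! i = (if p ! (i - 1) \<ge> 0 then p ! (i - 1) - 1 else p ! (i - 1) + 1)"
  using assms unfolding addable_def corner_def Suc_eq_plus1 by blast+

lemma addable_corner: "addable N p i \<Longrightarrow> corner N p i"
  by (simp add: addable_def)

lemma flip_nth:
  assumes "p \<in> paths N" "i \<le> N"
  shows "flip p i ! j = (if j = i then 2 * p ! (i - 1) - p ! i else p ! j)"
  using assms by (simp add: flip_def paths_length)

lemma flip_length: "length (flip p i) = length p"
  by (simp add: flip_def)

lemma flip_in_paths:
  assumes "p \<in> paths N" "corner N p i"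
  shows "flip p i \<in> paths N"
proof (rule pathsI)
  show "length (flip p i) = N + 1" using assms by (simp add: flip_length paths_length)
  show "flip p i ! 0 = 0"
    using assms by (simp add: flip_nth corner_def paths_0)
  fix j assume j: "j < N"
  have i: "1 \<le> i" "i \<le> N" using assms(2) by (auto simp: corner_def)
  consider "j = i" | "Suc j = i" | "j \<noteq> i" "Suc j \<noteq> i" by blast
  then show "flip p i ! Suc j = flip p i ! j + 1 \<or> flip p i ! Suc j = flip p i ! j - 1"
  proof cases
    case 1
    then show ?thesis using j assms paths_Suc[OF assms(1) j]
      by (auto simp: flip_nth corner_def)
  next
    case 2
    then show ?thesis using j assms i paths_Suc[OF assms(1) j]
      by (auto simp: flip_nth)
  next
    case 3
    then show ?thesis using j assms i paths_Suc[OF assms(1) j]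
      by (auto simp: flip_nth)
  qed
qed

lemma corner_flip_self:
  assumes "p \<in> paths N" "corner N p i"
  shows "corner N (flip p i) i"
  using assms unfolding corner_def
  by (auto simp: flip_nth)

lemma flip_flip:
  assumes "p \<in> paths N" "corner N p i"
  shows "flip (flip p i) i = p"
proof -
  have "1 \<le> i" "i \<le> N" using assms(2) by (auto simp: corner_def)
  then show ?thesis using assms paths_length[OF assms(1)]
    by (auto simp: flip_def)
qed

lemma flip_values:
  assumes "p \<in> paths N" "corner N p i"
  shows "flip p i ! i = 2 * p ! (i - 1) - p ! i" "flip p i ! (i - 1) = p ! (i - 1)"
proof -
  have i: "1 \<le> i" "i \<le> N" using assms(2) by (auto simp: corner_def)
  then have "i - 1 \<noteq> i" by simp
  then show "flip p i ! i = 2 * p ! (i - 1) - p ! i" "flip p i ! (i - 1) = p ! (i - 1)"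
    by (simp_all only: flip_nth[OF assms(1) i(2)] if_True if_False simp_thms)
qed

lemma addable_flip:
  assumes "p \<in> paths N" "removable N p i"
  shows "addable N (flip p i) i"
proof -
  have "p ! i = (if p ! (i - 1) \<ge> 0 then p ! (i - 1) + 1 else p ! (i - 1) - 1)"
    using assms(2) by (simp only: removable_def)
  then show ?thesis
    unfolding addable_def flip_values[OF assms(1) removable_corner[OF assms(2)]]
    using corner_flip_self[OF assms(1) removable_corner[OF assms(2)]]
    by (auto split: if_splits)
qed

lemma removable_flip:
  assumes "p \<in> paths N" "addable N p i"
  shows "removable N (flip p i) i"
proof -
  have "p ! i = (if p ! (i - 1) \<ge> 0 then p ! (i - 1) - 1 else p ! (i - 1) + 1)"
    using assms(2) by (simp only: addable_def)
  then show ?thesis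
    unfolding removable_def flip_values[OF assms(1) addable_corner[OF assms(2)]]
    using corner_flip_self[OF assms(1) addable_corner[OF assms(2)]]
    by (auto split: if_splits)
qed

lemma addable_or_removable:
  assumes "p \<in> paths N" "corner N p i"
  shows "addable N p i \<or> removable N p i"
proof -
  have "p ! i = p ! (i - 1) + 1 \<or> p ! i = p ! (i - 1) - 1"
    using paths_step[OF assms(1), of i] cornerD[OF assms(2)] by blast
  with assms(2) show ?thesis
    unfolding addable_def removable_def by presburger
qed

lemma addable_not_removable: "addable N p i \<Longrightarrow> \<not> removable N p i"
  by (cases "p ! (i - 1) \<ge> 0") (simp_all add: addable_def removable_def)

lemma sum_list_update_less:
  fixes xs :: "int list" and g :: "int \<Rightarrow> int"
  shows "i < length xs \<Longrightarrow> g y < g (xs ! i) \<Longrightarrow>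
    (\<Sum>x\<leftarrow>xs[i := y]. g x) < (\<Sum>x\<leftarrow>xs. g x)"
proof (induction xs arbitrary: i)
  case (Cons a xs)
  then show ?case by (cases i) auto
qed simp

lemma height_sum_flip:
  assumes "p \<in> paths N" "removable N p i"
  shows "height_sum (flip p i) < height_sum p"
proof -
  let ?g = "\<lambda>x::int. \<bar>2 * x + 1\<bar>"
  have i: "1 \<le> i" "i < length p" using assms by (auto simp: removable_def corner_def paths_length)
  have "?g (2 * p ! (i - 1) - p ! i) < ?g (p ! i)"
    using assms(2) by (auto simp: removable_def split: if_splits)
  from sum_list_update_less[OF i(2) this]
  have "(\<Sum>x\<leftarrow>flip p i. ?g x) < (\<Sum>x\<leftarrow>p. ?g x)" by (simp add: flip_def)
  moreover have "0 \<le> (\<Sum>x\<leftarrow>flip p i. ?g x)" by (rule sum_list_nonneg) auto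
  ultimately show ?thesis unfolding height_sum_def by linarith
qed

text \<open>A height farthest from -1/2 is an outward local extremum, hence the place of a removable
  tile. If no height leaves {-1, 0}, parity forces the fundamental path.\<close>

lemma ex_removable:
  assumes p: "p \<in> paths N" and ne: "p \<noteq> fund_path N"
  obtains i where "removable N p i"
proof -
  let ?g = "\<lambda>i. \<bar>2 * p ! i + 1\<bar>"
  define M where "M = Max (?g ` {0..N})"
  have "M \<in> ?g ` {0..N}" unfolding M_def by (rule Max_in) auto
  then obtain i where i: "i \<le> N" "M = ?g i" by auto
  have le: "?g j \<le> ?g i" if "j \<le> N" for j
    unfolding i(2)[symmetric] M_def using that by (intro Max_ge) auto
  have big: "?g i > 1"
  proof (rule ccontr)
    assume "\<not> ?g i > 1"
    then have small: "p ! j = 0 \<or> p ! j = -1" if "j \<le> N" for j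
      using le[OF that] by auto
    have "p = fund_path N"
    proof (rule paths_eqI[OF p fund_path_in_paths])
      fix j assume "j \<le> N"
      then show "p ! j = fund_path N ! j"
        using small[of j] paths_parity[OF p, of j] by (auto simp: fund_path_nth)
    qed
    with ne show False by simp
  qed
  have i1: "1 \<le> i" using big paths_0[OF p] by (cases i) auto
  have s1: "p ! i = p ! (i - 1) + 1 \<or> p ! i = p ! (i - 1) - 1"
    using paths_step[OF p i1 i(1)] .
  have s2: "p ! (i + 1) = p ! i + 1 \<or> p ! (i + 1) = p ! i - 1" if "i < N"
    using paths_Suc[OF p that] by simp
  have l1: "?g (i - 1) \<le> ?g i" using le[of "i - 1"] i by simp
  have l2: "?g (i + 1) \<le> ?g i" if "i < N" using le[of "i + 1"] that by simp
  have "removable N p i"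
    unfolding removable_def corner_def using i i1 s1 s2 l1 l2 big by (auto simp: abs_if split: if_splits)
  then show ?thesis by (rule that)
qed

text \<open>Removable tiles at \<open>i\<close> and \<open>i + 1\<close> would make each height lie
  farther out than the one before it, whereas the corner at \<open>i\<close> gives equal heights at
  \<open>i - 1\<close> and \<open>i + 1\<close>.\<close>

lemma removable_far:
  assumes p: "p \<in> paths N" and ij: "removable N p i" "removable N p j" "i < j"
  shows "i + 2 \<le> j"
proof (rule ccontr)
  assume "\<not> i + 2 \<le> j"
  then have j: "j = Suc i" using ij(3) by simp
  have *: "1 \<le> i" "i < N" using ij j by (auto simp: removable_def corner_def)
  have "p ! i = (if p ! (i - 1) \<ge> 0 then p ! (i - 1) + 1 else p ! (i - 1) - 1)"
    "p ! (i - 1) = p ! Suc i"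
    "p ! Suc i = (if p ! i \<ge> 0 then p ! i + 1 else p ! i - 1)"
    using removableD[OF ij(1)] removableD[OF ij(2)] *(2) unfolding j diff_Suc_1 by blast+
  then show False by (simp split: if_splits)
qed

lemma corner_flip_far:
  assumes p: "p \<in> paths N" "corner N p i" and far: "i + 2 \<le> j \<or> j + 2 \<le> i"
  shows "corner N (flip p i) j = corner N p j"
    and "removable N (flip p i) j = removable N p j"
    and "addable N (flip p i) j = addable N p j"
proof -
  have i: "1 \<le> i" "i \<le> N" using p(2) by (auto simp: corner_def)
  have e: "flip p i ! j = p ! j" "flip p i ! (j - 1) = p ! (j - 1)"
    using far i by (auto simp: flip_nth[OF p(1) i(2)])
  have e2: "flip p i ! (j + 1) = p ! (j + 1)" if "1 \<le> j" 
    using far i that by (auto simp: flip_nth[OF p(1) i(2)])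
  show c: "corner N (flip p i) j = corner N p j"
    using e e2 by (auto simp: corner_def)
  show "removable N (flip p i) j = removable N p j"
    "addable N (flip p i) j = addable N p j"
    by (simp_all only: removable_def addable_def c e)
qed

lemma flip_commute:
  assumes "p \<in> paths N" "i \<le> N" "j \<le> N" "i + 2 \<le> j \<or> j + 2 \<le> i"
  shows "flip (flip p i) j = flip (flip p j) i"
proof -
  have "i \<noteq> j" "i - 1 \<noteq> j" "j - 1 \<noteq> i" using assms(4) by auto
  then show ?thesis
    using assms paths_length[OF assms(1)]
    by (simp add: flip_def list_update_swap)
qed

text \<open>Passage from the given definitions to \<open>addable\<close> and \<open>flip\<close>: of
  the distinction between above and below, only the sign of the preceding height survives.\<close>

lemma adds_above_iff:
  "adds_above N i p p' \<longleftrightarrow> p \<in> paths N \<and> addable N p i \<and> 0 \<le> p ! (i - 1) \<and> p' = flip p i"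
proof
  assume a: "adds_above N i p p'"
  then have pp: "p \<in> paths N" "p' \<in> paths N" "1 \<le> i" "i \<le> N" "0 \<le> p ! (i - 1)"
    "\<forall>j\<le>N. j \<noteq> i \<longrightarrow> p' ! j = p ! j" "i < N \<longrightarrow> p ! (i - 1) = p ! (i + 1)"
    "p ! i = p ! (i - 1) - 1" "p' ! i = p ! (i - 1) + 1"
    unfolding adds_above_def by blast+
  have ad: "addable N p i"
    unfolding addable_def corner_def using pp(3,4,5,7,8) by presburger
  have p': "p' = flip p i"
  proof (rule paths_eqI[OF pp(2) flip_in_paths[OF pp(1) addable_corner[OF ad]]])
    fix j assume "j \<le> N"
    moreover have "2 * p ! (i - 1) - p ! i = p ! (i - 1) + 1" using pp(8) by linarith
    ultimately show "p' ! j = flip p i ! j"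
      using pp(6,9) unfolding flip_nth[OF pp(1,4)] by presburger
  qed
  show "p \<in> paths N \<and> addable N p i \<and> 0 \<le> p ! (i - 1) \<and> p' = flip p i" 
    using pp(1,5) ad p' by blast
next
  assume "p \<in> paths N \<and> addable N p i \<and> 0 \<le> p ! (i - 1) \<and> p' = flip p i"
  then have a: "p \<in> paths N" "addable N p i" "0 \<le> p ! (i - 1)" "p' = flip p i" by blast+
  have c: "1 \<le> i" "i \<le> N" "i < N \<longrightarrow> p ! (i - 1) = p ! (i + 1)"
    "p ! i = p ! (i - 1) - 1"
    using a(2,3) unfolding addable_def corner_def by presburger+
  have f: "\<forall>j\<le>N. j \<noteq> i \<longrightarrow> flip p i ! j = p ! j"
    "flip p i ! i = p ! (i - 1) + 1"
    using c(4) unfolding flip_nth[OF a(1) c(2)] by presburger+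
  show "adds_above N i p p'"
    unfolding adds_above_def a(4)
    using flip_in_paths[OF a(1) addable_corner[OF a(2)]] a(1,3) c f by blast
qed

lemma adds_below_iff:
  "adds_below N i p p' \<longleftrightarrow> p \<in> paths N \<and> addable N p i \<and> p ! (i - 1) < 0 \<and> p' = flip p i"
proof
  assume a: "adds_below N i p p'"
  then have pp: "p \<in> paths N" "p' \<in> paths N" "1 \<le> i" "i \<le> N" "p ! (i - 1) < 0"
    "\<forall>j\<le>N. j \<noteq> i \<longrightarrow> p' ! j = p ! j" "i < N \<longrightarrow> p ! (i - 1) = p ! (i + 1)"
    "p ! i = p ! (i - 1) + 1" "p' ! i = p ! (i - 1) - 1"
    unfolding adds_below_def by blast+
  have ad: "addable N p i"
    unfolding addable_def corner_def using pp(3,4,5,7,8) by presburger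
  have p': "p' = flip p i"
  proof (rule paths_eqI[OF pp(2) flip_in_paths[OF pp(1) addable_corner[OF ad]]])
    fix j assume "j \<le> N"
    moreover have "2 * p ! (i - 1) - p ! i = p ! (i - 1) - 1" using pp(8) by linarith
    ultimately show "p' ! j = flip p i ! j"
      using pp(6,9) unfolding flip_nth[OF pp(1,4)] by presburger
  qed
  show "p \<in> paths N \<and> addable N p i \<and> p ! (i - 1) < 0 \<and> p' = flip p i" 
    using pp(1,5) ad p' by blast
next
  assume "p \<in> paths N \<and> addable N p i \<and> p ! (i - 1) < 0 \<and> p' = flip p i"
  then have a: "p \<in> paths N" "addable N p i" "p ! (i - 1) < 0" "p' = flip p i" by blast+
  have c: "1 \<le> i" "i \<le> N" "i < N \<longrightarrow> p ! (i - 1) = p ! (i + 1)"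
    "p ! i = p ! (i - 1) + 1"
    using a(2,3) unfolding addable_def corner_def by presburger+
  have f: "\<forall>j\<le>N. j \<noteq> i \<longrightarrow> flip p i ! j = p ! j"
    "flip p i ! i = p ! (i - 1) - 1"
    using c(4) unfolding flip_nth[OF a(1) c(2)] by presburger+
  show "adds_below N i p p'"
    unfolding adds_below_def a(4)
    using flip_in_paths[OF a(1) addable_corner[OF a(2)]] a(1,3) c f by blast
qed

lemma fund_path_corner: "1 \<le> i \<Longrightarrow> i \<le> N \<Longrightarrow> addable N (fund_path N) i"
  by (auto simp: addable_def corner_def fund_path_nth)

section \<open>Idempotents and base relations\<close>

text \<open>For the algebra, \<open>\<psi> a = [\<omega>\<^sub>1 - a]\<close> and \<open>\<kappa> a x\<close> is the coefficient of \<open>K\<^sub>N\<close> at a path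
  with last two heights \<open>a\<close> and \<open>x\<close>. The assumption \<open>kappa_psi\<close> is what
  \<open>e\<^sub>N\<^sub>-\<^sub>1 e\<^sub>N e\<^sub>N\<^sub>-\<^sub>1 = e\<^sub>N\<^sub>-\<^sub>1\<close> demands of these weights.\<close>

locale sos_weights =
  fixes N :: nat and \<psi> :: "int \<Rightarrow> complex" and \<kappa> :: "int \<Rightarrow> int \<Rightarrow> complex"
    and \<delta> s1 s2 b :: complex
  assumes N_pos: "1 \<le> N"
    and psi_nz: "\<bar>a\<bar> < int N \<Longrightarrow> \<psi> a \<noteq> 0"
    and psi_m1_nz: "\<psi> (- 1) \<noteq> 0"
    and psi_rec: "\<psi> (a + 1) + \<psi> (a - 1) = \<delta> * \<psi> a"
    and s1_eq: "s1 = \<psi> 0 / \<psi> (- 1)"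
    and kappa_sum: "\<bar>a\<bar> < int N \<Longrightarrow> \<kappa> a (a + 1) + \<kappa> a (a - 1) = s2"
    and kappa_psi: "\<bar>a\<bar> + 1 < int N \<Longrightarrow>
      \<psi> (a + 1) / \<psi> a * \<kappa> (a + 1) a + \<psi> (a - 1) / \<psi> a * \<kappa> (a - 1) a = 1"
    and b_eq: "b = (if even N then \<kappa> (- 1) 0 else s1 * \<kappa> 0 (- 1))"
begin

text \<open>With u = \<omega>1 - a, the quotient of \<open>\<psi>\<close> is r(u) for
  \<open>x = a - 1\<close> and r(-u) for \<open>x = a + 1\<close>.\<close>

definition cf :: "nat \<Rightarrow> int \<Rightarrow> int \<Rightarrow> complex" where
  "cf i a x = (if i < N then \<psi> x / \<psi> a else \<kappa> a x)"

text \<open>The coefficient along p_0, whose heights alternate between 0 and -1. It is also the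
  inverse of the factor that normalises E_(i+1).\<close>

definition fw :: "nat \<Rightarrow> complex" where
  "fw i = (if even i then s1 else 1 / s1)"

text \<open>Product of \<open>fw\<close> over the generators in \<open>Im m\<close>: the scalar to
  which \<open>Im m\<close> reduces between two copies of \<open>Es m\<close>.\<close>

fun gw :: "nat \<Rightarrow> complex" where
  "gw 0 = 1"
| "gw (Suc 0) = s1"
| "gw (Suc (Suc m)) = gw m * fw (Suc m)"

lemma psi_0_nz: "\<psi> 0 \<noteq> 0"
  using psi_nz[of 0] N_pos by simp

lemma s1_nz: "s1 \<noteq> 0"
  using psi_0_nz psi_m1_nz by (simp add: s1_eq)

lemma fw_nz: "fw i \<noteq> 0"
  using s1_nz by (simp add: fw_def)

lemma fw_Suc: "1 / fw i = fw (Suc i)"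
  using s1_nz by (simp add: fw_def)

lemma gw_nz: "gw m \<noteq> 0"
  by (induction m rule: gw.induct) (simp_all add: s1_nz fw_nz)

text \<open>The generators in \<open>Im m\<close> and \<open>Im (Suc m)\<close> are together e_0,
  ..., e_m, and their factors s1 and 1/s1 alternate.\<close>

lemma gw_mult_gw: "gw m * gw (Suc m) = (if even m then s1 else 1)"
  by (induction m rule: gw.induct) (auto simp: fw_def s1_nz)

lemma cf_fund:
  assumes "1 \<le> i" "i < N"
  shows "cf i (fund_path N ! (i - 1)) (fund_path N ! i) = fw i"
  using assms by (auto simp: cf_def fund_path_nth fw_def) (simp_all add: s1_eq)

lemma cf_fund_end:
  "cf N (fund_path N ! (N - 1)) (fund_path N ! N) = (if even N then b else b / s1)"
  using N_pos s1_nz by (auto simp: cf_def fund_path_nth b_eq)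

text \<open>This is r(u) + r(-u) = [2] and k(u) + k(-u) = s2 in terms of the abstract weights; it is
  what the squares of the generators require.\<close>

lemma cf_sum:
  assumes "\<bar>a\<bar> < int N" "x = a + 1 \<or> x = a - 1"
  shows "cf i a x + cf i a (2 * a - x) = (if i < N then \<delta> else s2)"
proof -
  have "cf i a (a + 1) + cf i a (a - 1) = (if i < N then \<delta> else s2)"
    using kappa_sum[OF assms(1)] psi_rec[of a] psi_nz[OF assms(1)]
    by (simp add: cf_def add_divide_distrib[symmetric])
  moreover have "x = a + 1 \<and> 2 * a - x = a - 1 \<or> x = a - 1 \<and> 2 * a - x = a + 1"
    using assms(2) by auto
  ultimately show ?thesis by (auto simp: add.commute)
qed

end

text \<open>The double quotient will be a ring record whose carrier consists of cosets, so scalars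
  act through an explicit function \<open>sc\<close> and not through a type class.\<close>

locale cx_algebra = ring A for A (structure) +
  fixes sc :: "complex \<Rightarrow> 'a \<Rightarrow> 'a"
  assumes sc_closed [simp, intro]: "x \<in> carrier A \<Longrightarrow> sc c x \<in> carrier A"
    and sc_one [simp]: "x \<in> carrier A \<Longrightarrow> sc 1 x = x"
    and sc_sc [simp]: "x \<in> carrier A \<Longrightarrow> sc c (sc d x) = sc (c * d) x"
    and sc_add_left: "x \<in> carrier A \<Longrightarrow> sc (c + d) x = sc c x \<oplus> sc d x"
    and sc_add: "x \<in> carrier A \<Longrightarrow> y \<in> carrier A \<Longrightarrow> sc c (x \<oplus> y) = sc c x \<oplus> sc c y"
    and sc_mult_left [simp]:
      "x \<in> carrier A \<Longrightarrow> y \<in> carrier A \<Longrightarrow> sc c x \<otimes> y = sc c (x \<otimes> y)"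
    and sc_mult_right [simp]:
      "x \<in> carrier A \<Longrightarrow> y \<in> carrier A \<Longrightarrow> x \<otimes> sc c y = sc c (x \<otimes> y)"
begin

lemma sc_0 [simp]: "x \<in> carrier A \<Longrightarrow> sc 0 x = \<zero>"
  using sc_add_left[of x 0 0] by (metis add.l_cancel_one' add_0 sc_closed)

lemma sc_zero [simp]: "sc c \<zero> = \<zero>"
  using sc_mult_right[of \<zero> \<zero> c] sc_closed[of \<zero> c] by (metis l_null zero_closed)

lemma sc_cancel:
  assumes "sc c x = sc c y" "c \<noteq> 0" "x \<in> carrier A" "y \<in> carrier A"
  shows "x = y"
proof -
  have "sc (1 / c) (sc c x) = sc (1 / c) (sc c y)" using assms(1) by simp
  then show ?thesis using assms(2-) by simp
qed

end

text \<open>A layer without relations: the products \<open>Im\<close> have to exist before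
  \<open>Im_rel\<close> can be assumed about them.\<close>

locale tl_generators = cx_algebra A sc for A :: "('a, 'm) ring_scheme" (structure) and sc +
  fixes e :: "nat \<Rightarrow> 'a"
begin

text \<open>\<open>Im m\<close> multiplies the generators below \<open>m\<close> with the parity of \<open>m - 1\<close>; hence \<open>Im N\<close> and
  \<open>Im (Suc N)\<close> are \<open>I\<^sub>1\<close> and \<open>I\<^sub>2\<close> for \<open>N\<close> even, and \<open>I\<^sub>2\<close> and \<open>I\<^sub>1\<close> for \<open>N\<close> odd.\<close>

fun Im :: "nat \<Rightarrow> 'a" where
  "Im 0 = \<one>\<^bsub>A\<^esub>"
| "Im (Suc 0) = e 0"
| "Im (Suc (Suc m)) = Im m \<otimes> e (Suc m)"

end

text \<open>Products are nested to the right, the normal form under \<open>m_assoc\<close>.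
  \<open>Im_rel\<close> is the relation of the double quotient whose outer factor does not contain
  e_N.\<close>

locale tb_algebra = sos_weights N \<psi> \<kappa> \<delta> s1 s2 b + tl_generators A sc e
  for N \<psi> \<kappa> \<delta> s1 s2 b and A :: "('a, 'm) ring_scheme" (structure) and sc e +
  assumes e_closed [simp, intro]: "i \<le> N \<Longrightarrow> e i \<in> carrier A"
    and e_sq: "1 \<le> i \<Longrightarrow> i < N \<Longrightarrow> e i \<otimes> e i = sc \<delta> (e i)"
    and e_0_sq: "e 0 \<otimes> e 0 = sc s1 (e 0)"
    and e_N_sq: "e N \<otimes> e N = sc s2 (e N)"
    and e_braid: "1 \<le> i \<Longrightarrow> i < N \<Longrightarrow> j = i + 1 \<or> i = j + 1 \<Longrightarrow> e i \<otimes> (e j \<otimes> e i) = e i"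
    and e_comm: "i \<le> N \<Longrightarrow> j \<le> N \<Longrightarrow> i + 2 \<le> j \<or> j + 2 \<le> i \<Longrightarrow> e i \<otimes> e j = e j \<otimes> e i"
    and Im_rel: "Im N \<otimes> (Im (Suc N) \<otimes> Im N) = sc b (Im N)"
begin

lemma e_sq_left:
  assumes "1 \<le> i" "i \<le> N" "v \<in> carrier A"
  shows "e i \<otimes> (e i \<otimes> v) = sc (if i < N then \<delta> else s2) (e i \<otimes> v)"
proof -
  have "e i \<otimes> (e i \<otimes> v) = (e i \<otimes> e i) \<otimes> v" using assms by (simp add: m_assoc)
  also have "\<dots> = sc (if i < N then \<delta> else s2) (e i \<otimes> v)"
    using assms e_sq[of i] e_N_sq by (cases "i < N") auto
  finally show ?thesis .
qed

lemma e_braid_left: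
  assumes "1 \<le> i" "i < N" "j = i + 1 \<or> i = j + 1" "v \<in> carrier A"
  shows "e i \<otimes> (e j \<otimes> (e i \<otimes> v)) = e i \<otimes> v"
proof -
  have j: "j \<le> N" using assms by auto
  have "e i \<otimes> (e j \<otimes> (e i \<otimes> v)) = (e i \<otimes> (e j \<otimes> e i)) \<otimes> v"
    using assms j by (simp add: m_assoc)
  then show ?thesis using e_braid[OF assms(1-3)] by simp
qed

lemma e_comm_left:
  assumes "i \<le> N" "j \<le> N" "i + 2 \<le> j \<or> j + 2 \<le> i" "v \<in> carrier A"
  shows "e i \<otimes> (e j \<otimes> v) = e j \<otimes> (e i \<otimes> v)"
  using e_comm[OF assms(1-3)] assms by (simp add: m_assoc[symmetric])

section \<open>The idempotents E_i and their absorption rules\<close>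

primrec Es :: "nat \<Rightarrow> 'a" where
  "Es 0 = \<one>\<^bsub>A\<^esub>"
| "Es (Suc i) = sc (1 / fw i) (Es i \<otimes> (e i \<otimes> Es i))"

lemma Es_closed [simp, intro]: "i \<le> N \<Longrightarrow> Es i \<in> carrier A"
  by (induction i) auto

lemma Es_comm: "i < j \<Longrightarrow> j \<le> N \<Longrightarrow> e j \<otimes> Es i = Es i \<otimes> e j"
proof (induction i)
  case (Suc i)
  have IH: "e j \<otimes> Es i = Es i \<otimes> e j" using Suc by simp
  have c: "e j \<in> carrier A" "e i \<in> carrier A" "Es i \<in> carrier A" using Suc.prems by auto
  have ij: "e j \<otimes> e i = e i \<otimes> e j" using e_comm Suc.prems by simp
  have "e j \<otimes> (Es i \<otimes> (e i \<otimes> Es i)) = (e j \<otimes> Es i) \<otimes> (e i \<otimes> Es i)"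
    using c by (simp add: m_assoc)
  also have "\<dots> = Es i \<otimes> ((e j \<otimes> e i) \<otimes> Es i)" using c by (simp add: IH m_assoc)
  also have "\<dots> = Es i \<otimes> (e i \<otimes> (e j \<otimes> Es i))" using c by (simp add: ij m_assoc)
  also have "\<dots> = (Es i \<otimes> (e i \<otimes> Es i)) \<otimes> e j" using c by (simp add: IH m_assoc)
  finally show ?case using c by simp
qed (auto)

lemma Es_comm_left:
  assumes "i < j" "j \<le> N" "v \<in> carrier A"
  shows "e j \<otimes> (Es i \<otimes> v) = Es i \<otimes> (e j \<otimes> v)"
  using Es_comm[OF assms(1,2)] assms by (simp add: m_assoc[symmetric])

text \<open>\<open>Es (Suc k)\<close> contains a single e_k between two copies of
  \<open>Es k\<close>, and \<open>Es k\<close> commutes with e_(k+1); the braid relation then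
  removes e_k. Idempotence of \<open>Es k\<close> is a premise because the lemma serves the
  induction that proves it.\<close>

lemma Es_key_aux:
  assumes "Suc k < N" "Es k \<otimes> Es k = Es k" "v \<in> carrier A"
  shows "e (Suc k) \<otimes> (Es (Suc k) \<otimes> (e (Suc k) \<otimes> v)) = sc (fw (Suc k)) (e (Suc k) \<otimes> (Es k \<otimes> v))"
proof -
  have c: "e (Suc k) \<in> carrier A" "e k \<in> carrier A" "Es k \<in> carrier A" using assms(1) by auto
  have idem: "Es k \<otimes> (Es k \<otimes> w) = Es k \<otimes> w" if "w \<in> carrier A" for w
    using assms(2) c that by (simp add: m_assoc[symmetric])
  have "e (Suc k) \<otimes> (Es (Suc k) \<otimes> (e (Suc k) \<otimes> v)) =
      sc (1 / fw k) (e (Suc k) \<otimes> (Es k \<otimes> (e k \<otimes> (Es k \<otimes> (e (Suc k) \<otimes> v)))))"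
    using c assms(3) by (simp add: m_assoc)
  also have "e (Suc k) \<otimes> (Es k \<otimes> (e k \<otimes> (Es k \<otimes> (e (Suc k) \<otimes> v)))) =
      Es k \<otimes> (e (Suc k) \<otimes> (e k \<otimes> (e (Suc k) \<otimes> (Es k \<otimes> v))))"
    using c assms by (simp add: Es_comm_left)
  also have "\<dots> = Es k \<otimes> (e (Suc k) \<otimes> (Es k \<otimes> v))"
    using c assms by (subst e_braid_left) auto
  also have "\<dots> = e (Suc k) \<otimes> (Es k \<otimes> v)"
    using c assms by (simp add: Es_comm_left idem)
  finally show ?thesis by (simp add: fw_Suc)
qed

text \<open>Two-step induction: the square of E_(k+2) contains e_(k+1) E_(k+1) e_(k+1), which
  \<open>Es_key_aux\<close> evaluates by means of E_k.\<close>

lemma Es_idem: "i \<le> N \<Longrightarrow> Es i \<otimes> Es i = Es i"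
proof (induction i rule: induct_nat_012)
  case 1
  then show ?case using s1_nz by (simp add: e_0_sq fw_def)
next
  case (ge2 k)
  let ?i = "Suc k"
  have iN: "?i < N" using ge2.prems by simp
  have idk: "Es k \<otimes> Es k = Es k" and idi: "Es ?i \<otimes> Es ?i = Es ?i"
    using ge2 by auto
  have c: "e ?i \<in> carrier A" "Es ?i \<in> carrier A" "Es k \<in> carrier A" "e k \<in> carrier A"
    using iN by (auto simp del: Es.simps)
  have idi': "Es ?i \<otimes> (Es ?i \<otimes> w) = Es ?i \<otimes> w" if "w \<in> carrier A" for w
    using idi c that by (simp add: m_assoc[symmetric] del: Es.simps)
  have ki: "Es k \<otimes> Es ?i = Es ?i"
    using idk c by (simp add: m_assoc[symmetric])
  have "Es (Suc ?i) \<otimes> Es (Suc ?i) = sc (1 / fw ?i * (1 / fw ?i))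
      (Es ?i \<otimes> (e ?i \<otimes> (Es ?i \<otimes> (e ?i \<otimes> Es ?i))))"
    using c unfolding Es.simps(2)[of ?i] by (simp add: m_assoc idi' del: Es.simps)
  also have "\<dots> = sc (1 / fw ?i) (Es ?i \<otimes> (e ?i \<otimes> Es ?i))"
    using c fw_nz[of ?i] by (simp add: Es_key_aux[OF iN idk] ki del: Es.simps)
  also have "\<dots> = Es (Suc ?i)" by (rule Es.simps(2)[symmetric])
  finally show ?case .
qed simp

declare Es.simps(2) [simp del]

lemma Es_absorb_left:
  assumes "i \<le> j" "j \<le> N"
  shows "Es i \<otimes> Es j = Es j"
  using assms
proof (induction j)
  case (Suc j)
  show ?case
  proof (cases "i = Suc j")
    case False
    then have "Es i \<otimes> Es j = Es j" using Suc by simp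
    then show ?thesis using Suc.prems
      by (simp add: Es.simps m_assoc[symmetric])
  qed (use Suc in \<open>simp add: Es_idem\<close>)
qed simp

lemma Es_absorb_right:
  assumes "i \<le> j" "j \<le> N"
  shows "Es j \<otimes> Es i = Es j"
  using assms
proof (induction j)
  case (Suc j)
  show ?case
  proof (cases "i = Suc j")
    case False
    then have "Es j \<otimes> Es i = Es j" using Suc by simp
    then show ?thesis using Suc.prems False
      by (simp add: Es.simps m_assoc)
  qed (use Suc in \<open>simp add: Es_idem\<close>)
qed simp

lemma Es_absorb_right':
  assumes "i \<le> j" "j \<le> N" "v \<in> carrier A"
  shows "Es j \<otimes> (Es i \<otimes> v) = Es j \<otimes> v"
  using Es_absorb_right[OF assms(1,2)] assms by (simp add: m_assoc[symmetric])

lemma Es_key: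
  assumes "Suc k < N" "v \<in> carrier A"
  shows "e (Suc k) \<otimes> (Es (Suc k) \<otimes> (e (Suc k) \<otimes> v)) = sc (fw (Suc k)) (e (Suc k) \<otimes> (Es k \<otimes> v))"
  using Es_key_aux[OF assms(1) Es_idem assms(2)] assms(1) by simp

text \<open>For m = k + 1 the expansion of E_(m+1) produces e_m E_m e_m, which reduces to e_m E_k,
  and E_k is absorbed by the remaining E_m.\<close>

lemma e_Es_Suc:
  assumes "m < N"
  shows "e m \<otimes> Es (Suc m) = e m \<otimes> Es m"
proof (cases m)
  case 0
  then show ?thesis using s1_nz by (simp add: Es.simps e_0_sq fw_def)
next
  case (Suc k)
  have "e m \<otimes> Es (Suc m) = sc (1 / fw m) (e m \<otimes> (Es m \<otimes> (e m \<otimes> Es m)))"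
    using assms by (simp add: Es.simps)
  also have "\<dots> = e m \<otimes> (Es k \<otimes> Es m)"
    using assms Suc Es_key[of k "Es m"] fw_nz[of m] by simp
  finally show ?thesis using assms Suc by (simp add: Es_absorb_left)
qed

text \<open>In the expansion of e_i E_(i+2), the factor e_i E_(i+1) equals e_i E_i, and E_i passes
  e_(i+1) and is absorbed. This makes e_i E_(i+2) a multiple of e_i e_(i+1) E_(i+2).\<close>

lemma e_up_Es:
  assumes "Suc i < m" "m \<le> N"
  shows "e i \<otimes> (e (Suc i) \<otimes> Es m) = sc (fw (Suc i)) (e i \<otimes> Es m)"
proof -
  have c: "e i \<in> carrier A" "e (Suc i) \<in> carrier A" "Es (Suc i) \<in> carrier A" "Es i \<in> carrier A"
     "Es (Suc (Suc i)) \<in> carrier A" "Es m \<in> carrier A"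
    using assms by auto
  have "e i \<otimes> Es (Suc (Suc i)) = sc (1 / fw (Suc i)) ((e i \<otimes> Es (Suc i)) \<otimes> (e (Suc i) \<otimes> Es (Suc i)))"
    using c by (simp add: Es.simps(2)[of "Suc i"] m_assoc)
  also have "(e i \<otimes> Es (Suc i)) = e i \<otimes> Es i"
    using assms by (simp add: e_Es_Suc)
  also have "(e i \<otimes> Es i) \<otimes> (e (Suc i) \<otimes> Es (Suc i)) = e i \<otimes> (e (Suc i) \<otimes> (Es i \<otimes> Es (Suc i)))"
    using c assms by (simp add: m_assoc Es_comm_left)
  also have "\<dots> = e i \<otimes> (e (Suc i) \<otimes> Es (Suc i))"
    using assms by (simp add: Es_absorb_left)
  also have "\<dots> = e i \<otimes> (e (Suc i) \<otimes> Es (Suc (Suc i)))"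
    using assms by (simp add: e_Es_Suc)
  finally have "e i \<otimes> (e (Suc i) \<otimes> Es (Suc (Suc i))) = sc (fw (Suc i)) (e i \<otimes> Es (Suc (Suc i)))"
    using c fw_nz[of "Suc i"] by simp
  then have "e i \<otimes> (e (Suc i) \<otimes> Es (Suc (Suc i))) \<otimes> Es m = sc (fw (Suc i)) (e i \<otimes> Es (Suc (Suc i))) \<otimes> Es m"
    by simp
  then show ?thesis using c assms by (simp add: m_assoc Es_absorb_left)
qed

text \<open>Expanding E_(k+2) puts a second e_(k+1) behind e_k, and the braid relation removes the
  pair. The remaining scalar 1 / \<open>fw (k + 1)\<close> is \<open>fw k\<close>.\<close>

lemma e_down_Es:
  assumes "Suc k < N"
  shows "e (Suc k) \<otimes> (e k \<otimes> Es N) = sc (fw k) (e (Suc k) \<otimes> Es N)"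
proof -
  let ?Z = "Es (Suc k)"
  have c: "e k \<in> carrier A" "e (Suc k) \<in> carrier A" "?Z \<in> carrier A" "Es k \<in> carrier A"
     "Es (Suc (Suc k)) \<in> carrier A" "Es N \<in> carrier A"
    using assms by auto
  have "e (Suc k) \<otimes> (e k \<otimes> Es (Suc (Suc k))) =
      sc (1 / fw (Suc k)) (e (Suc k) \<otimes> ((e k \<otimes> ?Z) \<otimes> (e (Suc k) \<otimes> ?Z)))"
    using c by (simp add: Es.simps(2)[of "Suc k"] m_assoc)
  also have "e k \<otimes> ?Z = e k \<otimes> Es k"
    using assms by (simp add: e_Es_Suc)
  also have "e (Suc k) \<otimes> ((e k \<otimes> Es k) \<otimes> (e (Suc k) \<otimes> ?Z)) =
      e (Suc k) \<otimes> (e k \<otimes> (e (Suc k) \<otimes> (Es k \<otimes> ?Z)))"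
    using c assms by (simp add: m_assoc Es_comm_left)
  also have "\<dots> = e (Suc k) \<otimes> ?Z"
    using c assms by (subst e_braid_left) (auto simp: Es_absorb_left)
  also have "\<dots> = e (Suc k) \<otimes> Es (Suc (Suc k))"
    using assms by (simp add: e_Es_Suc)
  finally have "e (Suc k) \<otimes> (e k \<otimes> Es (Suc (Suc k))) = sc (fw k) (e (Suc k) \<otimes> Es (Suc (Suc k)))"
    by (simp add: fw_Suc[symmetric, of "k"] fw_def)
  then have "e (Suc k) \<otimes> (e k \<otimes> Es (Suc (Suc k))) \<otimes> Es N = sc (fw k) (e (Suc k) \<otimes> Es (Suc (Suc k))) \<otimes> Es N"
    by simp
  then show ?thesis using c assms by (simp add: m_assoc Es_absorb_left)
qed

lemma e_0_Es: "1 \<le> m \<Longrightarrow> m \<le> N \<Longrightarrow> e 0 \<otimes> Es m = sc s1 (Es m)"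
proof -
  assume m: "1 \<le> m" "m \<le> N"
  have "e 0 \<otimes> Es 1 = sc s1 (Es 1)"
    using s1_nz N_pos by (simp add: Es.simps e_0_sq fw_def)
  then have "(e 0 \<otimes> Es 1) \<otimes> Es m = sc s1 (Es 1) \<otimes> Es m" by simp
  then show ?thesis using m by (simp add: m_assoc Es_absorb_left)
qed

section \<open>The products I_1 and I_2 on the range of the idempotents\<close>

lemma Im_closed [simp, intro]: "m \<le> Suc N \<Longrightarrow> Im m \<in> carrier A"
  by (induction m rule: Im.induct) auto

lemma Im_comm: "m < j \<Longrightarrow> j \<le> N \<Longrightarrow> e j \<otimes> Im m = Im m \<otimes> e j"
proof (induction m rule: Im.induct)
  case (3 m)
  then have "e j \<otimes> Im m = Im m \<otimes> e j" "e j \<otimes> e (Suc m) = e (Suc m) \<otimes> e j" 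
    using e_comm by auto
  then show ?case using 3(2,3) by (simp add: m_assoc[symmetric]) (simp add: m_assoc)
qed (auto simp: e_comm)

lemma Im_comm_left:
  assumes "m < j" "j \<le> N" "v \<in> carrier A"
  shows "e j \<otimes> (Im m \<otimes> v) = Im m \<otimes> (e j \<otimes> v)"
  using Im_comm[OF assms(1,2)] assms by (simp add: m_assoc[symmetric])

text \<open>E_m commutes with e_(m+1), so the induction hypothesis evaluates the factor
  \<open>Im m\<close>; what is left, E_(m+1) e_(m+1) E_(m+1), is a multiple of E_(m+2) by
  definition.\<close>

lemma Es_Im_Es: "m \<le> N \<Longrightarrow> Es m \<otimes> (Im m \<otimes> Es m) = sc (gw m) (Es m)"
proof (induction m rule: Im.induct)
  case 2
  then show ?case by (simp add: e_0_Es Es_idem)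
next
  case (3 m)
  let ?E = "Es (Suc (Suc m))"
  have c: "?E \<in> carrier A" "Es m \<in> carrier A" "Im m \<in> carrier A" "e (Suc m) \<in> carrier A"
    "Es (Suc m) \<in> carrier A"
    using 3(2) by auto
  have ee: "Es (Suc m) \<otimes> (e (Suc m) \<otimes> Es (Suc m)) = sc (fw (Suc m)) ?E"
    using c fw_nz by (simp add: Es.simps(2)[of "Suc m"])
  have "?E \<otimes> (Im (Suc (Suc m)) \<otimes> ?E) = ?E \<otimes> (Es m \<otimes> (Im m \<otimes> (e (Suc m) \<otimes> (Es m \<otimes> ?E))))"
    using c 3(2) by (simp add: m_assoc Es_absorb_right' Es_absorb_left)
  also have "\<dots> = ?E \<otimes> ((Es m \<otimes> (Im m \<otimes> Es m)) \<otimes> (e (Suc m) \<otimes> ?E))"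
    using c 3(2) by (simp add: m_assoc Es_comm_left)
  also have "\<dots> = sc (gw m) (?E \<otimes> (Es m \<otimes> (e (Suc m) \<otimes> ?E)))"
    using 3 c by simp
  also have "\<dots> = sc (gw m) (?E \<otimes> (Es (Suc m) \<otimes> (e (Suc m) \<otimes> (Es (Suc m) \<otimes> ?E))))"
    using c 3(2) by (simp add: Es_absorb_right' Es_absorb_left)
  also have "\<dots> = sc (gw m) (?E \<otimes> ((Es (Suc m) \<otimes> (e (Suc m) \<otimes> Es (Suc m))) \<otimes> ?E))"
    using c by (simp add: m_assoc)
  also have "\<dots> = sc (gw m * fw (Suc m)) ?E"
    using 3(2) c by (simp add: ee Es_idem)
  finally show ?case by simp
qed simp

text \<open>Every generator of \<open>Im (Suc k)\<close> except e_0 has its left neighbour in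
  \<open>Im k\<close>, which absorbs it at the cost of \<open>fw\<close>; e_0 acts by its
  eigenvalue. The vector is arbitrary because the induction replaces it by its image under a
  generator.\<close>

lemma Im_Im_Suc:
  assumes "Suc k \<le> N" "v \<in> carrier A" "e 0 \<otimes> v = sc s1 v"
    and "\<And>j. j < k \<Longrightarrow> e j \<otimes> (e (Suc j) \<otimes> v) = sc (fw (Suc j)) (e j \<otimes> v)"
  shows "Im k \<otimes> (Im (Suc k) \<otimes> v) = sc (gw (Suc k)) (Im k \<otimes> v)"
  using assms
proof (induction k arbitrary: v rule: Im.induct)
  case (3 k)
  have c: "Im k \<in> carrier A" "Im (Suc k) \<in> carrier A" "e (Suc k) \<in> carrier A"
    "e (Suc (Suc k)) \<in> carrier A" "e 0 \<in> carrier A" "v \<in> carrier A"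
    using 3(2,3) by auto
  let ?w = "e (Suc (Suc k)) \<otimes> v"
  have IH: "Im k \<otimes> (Im (Suc k) \<otimes> ?w) = sc (gw (Suc k)) (Im k \<otimes> ?w)"
  proof (rule 3(1))
    show "Suc k \<le> N" "?w \<in> carrier A" using 3(2) c by auto
    show "e 0 \<otimes> ?w = sc s1 ?w"
      using c 3(2,4) by (subst e_comm_left) auto
    fix j assume j: "j < k"
    have cj: "e j \<in> carrier A" "e (Suc j) \<in> carrier A" using j 3(2) by auto
    have "e j \<otimes> (e (Suc j) \<otimes> ?w) = e (Suc (Suc k)) \<otimes> (e j \<otimes> (e (Suc j) \<otimes> v))"
      using j 3(2) c cj e_comm_left[of "Suc j" "Suc (Suc k)"] e_comm_left[of j "Suc (Suc k)"] by simp
    also have "\<dots> = sc (fw (Suc j)) (e j \<otimes> ?w)"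
      using j 3(2) 3(5)[of j] c cj e_comm_left[of j "Suc (Suc k)"] by simp
    finally show "e j \<otimes> (e (Suc j) \<otimes> ?w) = sc (fw (Suc j)) (e j \<otimes> ?w)" .
  qed
  have "Im (Suc (Suc k)) \<otimes> (Im (Suc (Suc (Suc k))) \<otimes> v) =
     e (Suc k) \<otimes> (Im k \<otimes> (Im (Suc k) \<otimes> ?w))"
    using c 3(2) by (simp add: m_assoc Im_comm_left)
  also have "\<dots> = sc (gw (Suc k)) (Im k \<otimes> (e (Suc k) \<otimes> ?w))"
    using c 3(2) by (simp add: IH Im_comm_left)
  also have "e (Suc k) \<otimes> ?w = sc (fw (Suc (Suc k))) (e (Suc k) \<otimes> v)"
    using 3(5)[of "Suc k"] by simp
  also have "sc (gw (Suc k)) (Im k \<otimes> sc (fw (Suc (Suc k))) (e (Suc k) \<otimes> v))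
     = sc (gw (Suc (Suc (Suc k)))) (Im (Suc (Suc k)) \<otimes> v)"
    using c by (simp add: m_assoc)
  finally show ?case .
qed (auto)

text \<open>This is the only place where the relation \<open>Im_rel\<close> of the double quotient enters.\<close>

lemma e_right_Es:
  "e (N - 1) \<otimes> (e N \<otimes> Es N) = sc (if even N then b else b / s1) (e (N - 1) \<otimes> Es N)"
proof (cases "N = 1")
  case True
  have c: "e 0 \<in> carrier A" "e N \<in> carrier A" by auto
  have "e 0 \<otimes> (e 1 \<otimes> e 0) = sc b (e 0)"
    using Im_rel c unfolding True by simp
  moreover have "Es N = sc (1 / s1) (e 0)"
    unfolding True using c by (simp add: Es.simps fw_def)
  ultimately show ?thesis
    using c s1_nz unfolding True by (simp add: e_0_sq)
next
  case False
  then have "N = Suc (Suc (N - 2))" using N_pos by simp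
  then obtain n where n: "N = Suc (Suc n)" by blast
  \<comment> \<open>Here I_N = ?I e_(N-1) and I_(N+1) = ?J e_N. Up to scalars, e_(N-1) e_N E_N is
    completed to E_n I_N I_(N+1) E_N, the relation evaluates I_N I_(N+1) I_N, and E_n strips I_N
    down to e_(N-1) again.\<close>
  let ?I = "Im n" and ?J = "Im (Suc n)" and ?E = "Es N"
  have c: "?I \<in> carrier A" "?J \<in> carrier A" "e (Suc n) \<in> carrier A" "e N \<in> carrier A"
    "?E \<in> carrier A" "Es n \<in> carrier A" "Es (Suc n) \<in> carrier A"
    "Im N \<in> carrier A" "Im (Suc N) \<in> carrier A"
    using n by auto
  have IN: "Im N = ?I \<otimes> e (Suc n)" "Im (Suc N) = ?J \<otimes> e N" by (simp_all add: n)
    have J1: "?I \<otimes> (?J \<otimes> Es (Suc n)) = sc (gw (Suc n)) (?I \<otimes> Es (Suc n))"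
  proof (rule Im_Im_Suc)
    show "e 0 \<otimes> Es (Suc n) = sc s1 (Es (Suc n))" by (rule e_0_Es) (use n in simp_all)
    show "e j \<otimes> (e (Suc j) \<otimes> Es (Suc n)) = sc (fw (Suc j)) (e j \<otimes> Es (Suc n))" if "j < n" for j
      by (rule e_up_Es) (use n that in simp_all)
  qed (use n c in simp_all)
  have J2: "?J \<otimes> (Im N \<otimes> ?E) = sc (gw N) (?J \<otimes> ?E)"
  proof -
    have "?J \<otimes> (Im (Suc (Suc n)) \<otimes> ?E) = sc (gw (Suc (Suc n))) (?J \<otimes> ?E)"
    proof (rule Im_Im_Suc)
      show "e 0 \<otimes> ?E = sc s1 ?E" by (rule e_0_Es) (use N_pos in simp_all)
      show "e j \<otimes> (e (Suc j) \<otimes> ?E) = sc (fw (Suc j)) (e j \<otimes> ?E)" if "j < Suc n" for j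
        by (rule e_up_Es) (use n that in simp_all)
    qed (use n c in simp_all)
    then show ?thesis by (simp only: n)
  qed
    \<comment> \<open>E_n turns ?I into a scalar, so of \<open>Im N\<close> only the last generator
      e_(N-1) survives.\<close>
    have EI: "Es n \<otimes> (Im N \<otimes> w) = sc (gw n) (e (Suc n) \<otimes> (Es n \<otimes> w))"
    if "w \<in> carrier A" "Es n \<otimes> w = w" for w
  proof -
    have "Es n \<otimes> (Im N \<otimes> w) = Es n \<otimes> (?I \<otimes> (e (Suc n) \<otimes> (Es n \<otimes> w)))"
      using that c by (simp add: IN m_assoc)
    also have "\<dots> = (Es n \<otimes> (?I \<otimes> Es n)) \<otimes> (e (Suc n) \<otimes> w)"
      using that(1) c n by (simp add: m_assoc Es_comm_left)
    also have "\<dots> = sc (gw n) (Es n \<otimes> (e (Suc n) \<otimes> w))"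
      using that c n by (simp add: Es_Im_Es)
    also have "\<dots> = sc (gw n) (e (Suc n) \<otimes> (Es n \<otimes> w))"
      using that(1) c n by (simp add: Es_comm_left)
    finally show ?thesis .
  qed
    have "sc (gw (Suc n) * gw n) (e (Suc n) \<otimes> Es (Suc n)) =
      sc (gw (Suc n)) (Es n \<otimes> (Im N \<otimes> Es (Suc n)))"
    using EI[of "Es (Suc n)"] c n by (simp add: Es_absorb_left)
  also have "\<dots> = Es n \<otimes> (e (Suc n) \<otimes> (?I \<otimes> (?J \<otimes> Es (Suc n))))"
    using c n J1 by (simp add: IN m_assoc Im_comm_left)
  also have "\<dots> = Es n \<otimes> (Im N \<otimes> (?J \<otimes> Es (Suc n)))"
    using c n by (simp add: IN m_assoc Im_comm_left)
  finally have *: "sc (gw (Suc n) * gw n) (e (Suc n) \<otimes> Es (Suc n)) =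
     Es n \<otimes> (Im N \<otimes> (?J \<otimes> Es (Suc n)))" .
  have pass: "Es (Suc n) \<otimes> (e N \<otimes> ?E) = e N \<otimes> ?E"
    using c n by (simp add: Es_comm_left[symmetric] Es_absorb_left)
    have "sc (gw (Suc n) * gw n) (e (Suc n) \<otimes> (e N \<otimes> ?E)) =
      sc (gw (Suc n) * gw n) (e (Suc n) \<otimes> Es (Suc n)) \<otimes> (e N \<otimes> ?E)"
    using c pass by (simp add: m_assoc)
  also have "\<dots> = Es n \<otimes> (Im N \<otimes> (?J \<otimes> (Es (Suc n) \<otimes> (e N \<otimes> ?E))))"
    unfolding * using c by (simp add: m_assoc)
  also have "\<dots> = Es n \<otimes> (Im N \<otimes> (Im (Suc N) \<otimes> ?E))"
    using c by (simp add: IN m_assoc pass)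
  finally have **: "sc (gw (Suc n) * gw n) (e (Suc n) \<otimes> (e N \<otimes> ?E)) =
    Es n \<otimes> (Im N \<otimes> (Im (Suc N) \<otimes> ?E))" .
    \<comment> \<open>Supplies the third factor of the relation: on E_N, the products I_(N+1) I_N
      and I_(N+1) differ by a nonzero scalar.\<close>
    have "Im (Suc N) \<otimes> (Im N \<otimes> ?E) = e N \<otimes> (?J \<otimes> (Im N \<otimes> ?E))"
    using c n by (simp add: IN m_assoc Im_comm_left)
  also have "\<dots> = sc (gw N) (Im (Suc N) \<otimes> ?E)"
    using c n unfolding J2 by (simp add: IN m_assoc Im_comm_left)
  finally have JI: "Im (Suc N) \<otimes> (Im N \<otimes> ?E) = sc (gw N) (Im (Suc N) \<otimes> ?E)" .
  have "sc (gw N) (Im N \<otimes> (Im (Suc N) \<otimes> ?E)) = (Im N \<otimes> (Im (Suc N) \<otimes> Im N)) \<otimes> ?E"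
    using c JI by (simp add: m_assoc)
  also have "\<dots> = sc b (Im N \<otimes> ?E)"
    using c Im_rel by simp
  finally have IJ: "sc (gw N) (Im N \<otimes> (Im (Suc N) \<otimes> ?E)) = sc b (Im N \<otimes> ?E)" .
    have "sc (gw N * (gw (Suc n) * gw n)) (e (Suc n) \<otimes> (e N \<otimes> ?E)) =
     sc (gw N) (Es n \<otimes> (Im N \<otimes> (Im (Suc N) \<otimes> ?E)))"
    using c by (simp add: **[symmetric])
  also have "\<dots> = Es n \<otimes> sc (gw N) (Im N \<otimes> (Im (Suc N) \<otimes> ?E))"
    using c by simp
  also have "\<dots> = sc b (Es n \<otimes> (Im N \<otimes> ?E))"
    unfolding IJ using c by simp
  also have "\<dots> = sc (b * gw n) (e (Suc n) \<otimes> ?E)"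
    using EI[of ?E] c n by (simp add: Es_absorb_left)
  finally have fin: "sc (gw N * (gw (Suc n) * gw n)) (e (Suc n) \<otimes> (e N \<otimes> ?E)) =
     sc (b * gw n) (e (Suc n) \<otimes> ?E)" .
    have g: "b * gw n = gw N * (gw (Suc n) * gw n) * (if even N then b else b / s1)"
  proof -
    have "gw N * gw (Suc n) = (if even N then 1 else s1)"
      using gw_mult_gw[of "Suc n"] by (simp add: n mult.commute del: gw.simps)
    moreover have "gw N * (gw (Suc n) * gw n) = gw N * gw (Suc n) * gw n"
      by (simp only: mult.assoc)
    ultimately show ?thesis using s1_nz by (simp only: split: if_split) simp
  qed
  let ?c = "if even N then b else b / s1"
  have "e (Suc n) \<otimes> (e N \<otimes> ?E) = sc ?c (e (Suc n) \<otimes> ?E)"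
  proof (rule sc_cancel)
    show "sc (gw N * (gw (Suc n) * gw n)) (e (Suc n) \<otimes> (e N \<otimes> ?E)) =
      sc (gw N * (gw (Suc n) * gw n)) (sc ?c (e (Suc n) \<otimes> ?E))"
      unfolding fin g using c by (simp only: sc_sc m_closed)
    show "gw N * (gw (Suc n) * gw n) \<noteq> 0" by (simp only: gw_nz mult_eq_0_iff simp_thms)
  qed (use c in \<open>simp_all only: m_closed sc_closed\<close>)
  moreover have "N - 1 = Suc n" using n by simp
  ultimately show ?thesis by simp
qed

end

section \<open>The seminormal basis\<close>

text \<open>The left boundary acts like a fixed height \<open>- 1\<close> at the point \<open>- 1\<close>.\<close>

definition slope :: "nat \<Rightarrow> int list \<Rightarrow> nat \<Rightarrow> bool" where
  "slope N p i \<longleftrightarrow> i < N \<and> (if i = 0 then p ! 1 = 1 else p ! (i - 1) \<noteq> p ! (i + 1))"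

lemma removable_height:
  assumes "removable N p j"
  shows "p ! j \<noteq> 0" "p ! j \<noteq> - 1"
proof -
  have "p ! j = (if p ! (j - 1) \<ge> 0 then p ! (j - 1) + 1 else p ! (j - 1) - 1)"
    by (rule removableD(4)[OF assms])
  then show "p ! j \<noteq> 0" "p ! j \<noteq> - 1" by presburger+
qed

lemma int_height_sum: "int (height_sum p) = (\<Sum>x\<leftarrow>p. \<bar>2 * x + 1\<bar>)"
proof -
  have "0 \<le> (\<Sum>x\<leftarrow>p. \<bar>2 * x + 1\<bar>)" by (rule sum_list_nonneg) auto
  then show ?thesis by (simp add: height_sum_def)
qed

lemma sum_list_map_update:
  fixes g :: "'b \<Rightarrow> int"
  shows "i < length xs \<Longrightarrow>
    (\<Sum>x\<leftarrow>xs[i := y]. g x) = (\<Sum>x\<leftarrow>xs. g x) + g y - g (xs ! i)"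
proof (induction xs arbitrary: i)
  case (Cons a xs)
  then show ?case by (cases i) auto
qed simp

lemma int_height_sum_flip:
  assumes "p \<in> paths N" "i \<le> N"
  shows "int (height_sum (flip p i)) =
    int (height_sum p) + \<bar>2 * (2 * p ! (i - 1) - p ! i) + 1\<bar> - \<bar>2 * p ! i + 1\<bar>"
  unfolding int_height_sum flip_def
  by (rule sum_list_map_update) (use assms in \<open>simp add: paths_length\<close>)

text \<open>A step towards -1/2 is never undone by another such step, except between 0 and -1, which
  these steps exchange.\<close>

lemma mutually_addable:
  fixes a x :: int
  assumes "x = (if a \<ge> 0 then a - 1 else a + 1)" "a = (if x \<ge> 0 then x - 1 else x + 1)"
  shows "a = 0 \<or> a = - 1" "x = 0 \<or> x = - 1"
  using assms by presburger+

text \<open>Arithmetic of the reflection step in \<open>e_bp_slope\<close>: \<open>h0\<close> to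
  \<open>h3\<close> are the height sums of paths with last heights (a, m, 2m - a), (a, m, a), (a, 2a
  - m, a) and (a, 2a - m, 3a - 2m). The last end is the mirror image of the first in the height a,
  and m lies on the outer side of a.\<close>

lemma reflected_height:
  fixes a m :: int and h0 h1 h2 h3 :: nat
  assumes "m = (if a \<ge> 0 then a + 1 else a - 1)"
    and "int h1 = int h0 + \<bar>2 * a + 1\<bar> - \<bar>2 * (2 * m - a) + 1\<bar>"
    and "int h2 = int h1 + \<bar>2 * (2 * a - m) + 1\<bar> - \<bar>2 * m + 1\<bar>"
    and "int h3 = int h2 + \<bar>2 * (2 * (2 * a - m) - a) + 1\<bar> - \<bar>2 * a + 1\<bar>"
  shows "h3 < h0"
proof (cases "a \<ge> 0")
  case True
  then show ?thesis using assms by (simp add: abs_if split: if_splits)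
next
  case False
  then have m: "m = a - 1" and a: "a \<le> - 1" using assms(1) by auto
  have "2 * (2 * m - a) + 1 = 2 * a - 3" "2 * m + 1 = 2 * a - 1"
    "2 * (2 * a - m) + 1 = 2 * a + 3" "2 * (2 * (2 * a - m) - a) + 1 = 2 * a + 5"
    unfolding m by simp_all
  note e = this
  have "\<bar>2 * a - 3\<bar> = 3 - 2 * a" "\<bar>2 * a - 1\<bar> = 1 - 2 * a" "\<bar>2 * a + 3\<bar> < 1 - 2 * a"
    "\<bar>2 * a + 5\<bar> \<le> 3 - 2 * a"
    using a by (simp_all add: abs_if)
  then have "int h3 < int h0" using assms(2-4) unfolding e by linarith
  then show ?thesis by simp
qed

lemma fund_path_not_slope: "i < N \<Longrightarrow> \<not> slope N (fund_path N) i"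
  by (auto simp: slope_def fund_path_nth)

lemma fund_path_not_removable: "\<not> removable N (fund_path N) j"
proof
  assume r: "removable N (fund_path N) j"
  show False
    using removable_height[OF r] fund_path_nth[OF removableD(2)[OF r]] by (simp split: if_splits)
qed

context sos_weights
begin

text \<open>At an addable corner this is the coefficient with which the tile will be added. At a
  removable corner it is the complementary one, with -u in place of u.\<close>

definition tile :: "int list \<Rightarrow> nat \<Rightarrow> complex" where
  "tile p i = cf i (p ! (i - 1)) (p ! i)"

lemma tile_flip_far:
  assumes "p \<in> paths N" "corner N p j" "i + 2 \<le> j \<or> j + 2 \<le> i"
  shows "tile (flip p j) i = tile p i"
proof -
  have "j \<noteq> i" "j \<noteq> i - 1" using assms(2,3) by (auto simp: corner_def)
  then show ?thesis
    using flip_nth[OF assms(1), of j] cornerD[OF assms(2)] by (simp add: tile_def)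
qed

lemma tile_sum:
  assumes p: "p \<in> paths N" "corner N p i"
  shows "tile p i + tile (flip p i) i = (if i < N then \<delta> else s2)"
proof -
  have i: "1 \<le> i" "i \<le> N" using p(2) by (auto simp: corner_def)
  have "\<bar>p ! (i - 1)\<bar> \<le> int (i - 1)" by (rule paths_bound[OF p(1)]) (use i in simp)
  then have "\<bar>p ! (i - 1)\<bar> < int N" using i by linarith
  then show ?thesis
    unfolding tile_def flip_values[OF p] using cf_sum paths_step[OF p(1) i] by blast
qed

lemma kappa_psi_step:
  assumes "\<bar>a\<bar> + 1 < int N" "x = a + 1 \<or> x = a - 1"
  shows "1 = \<psi> (2 * a - x) / \<psi> a * \<kappa> (2 * a - x) a + \<psi> x / \<psi> a * \<kappa> x a"
proof -
  have "x = a + 1 \<and> 2 * a - x = a - 1 \<or> x = a - 1 \<and> 2 * a - x = a + 1"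
    using assms(2) by linarith
  then show ?thesis using kappa_psi[OF assms(1)] by (metis add.commute)
qed

lemma tile_fund:
  assumes "1 \<le> j" "j \<le> N"
  shows "tile (fund_path N) j = (if j < N then fw j else if even N then b else b / s1)"
  using cf_fund[of j] cf_fund_end assms by (auto simp: tile_def)

end

section \<open>Tile operators and basis vectors in the algebra\<close>

context tb_algebra
begin

text \<open>Left multiplication by e_j - c, as an operator on vectors, so that neither the unit nor
  the subtraction of the ring record enters later rewriting.\<close>

definition Xt :: "nat \<Rightarrow> complex \<Rightarrow> 'a \<Rightarrow> 'a" where
  "Xt j c x = e j \<otimes> x \<oplus> sc (- c) x"

lemma Xt_closed [simp, intro]: "j \<le> N \<Longrightarrow> x \<in> carrier A \<Longrightarrow> Xt j c x \<in> carrier A"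
  by (simp add: Xt_def)

lemma Xt_zero [simp]: "j \<le> N \<Longrightarrow> Xt j c \<zero> = \<zero>"
  unfolding Xt_def by (simp only: r_null e_closed sc_zero r_zero zero_closed)

lemma e_Xt_comm:
  assumes "i \<le> N" "j \<le> N" "i + 2 \<le> j \<or> j + 2 \<le> i" "x \<in> carrier A"
  shows "e i \<otimes> Xt j c x = Xt j c (e i \<otimes> x)"
  using assms(1,2,4) e_comm_left[OF assms] by (simp add: Xt_def r_distr)

lemma Xt_comm:
  assumes "i \<le> N" "j \<le> N" "i + 2 \<le> j \<or> j + 2 \<le> i" "x \<in> carrier A"
  shows "Xt i c (Xt j d x) = Xt j d (Xt i c x)"
proof -
  have cl: "e i \<in> carrier A" "e j \<in> carrier A" using assms by auto
  have ji: "e j \<otimes> (e i \<otimes> x) = e i \<otimes> (e j \<otimes> x)" using e_comm_left[OF assms] by simp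
  show ?thesis
    using assms cl ji by (simp add: Xt_def r_distr sc_add a_ac mult.commute)
qed

lemma sc_minus_self: "x \<in> carrier A \<Longrightarrow> sc c x \<oplus> sc (- c) x = \<zero>"
  using sc_add_left[of x c "- c"] by simp

lemma Xt_rearrange: "j \<le> N \<Longrightarrow> x \<in> carrier A \<Longrightarrow> e j \<otimes> x = Xt j c x \<oplus> sc c x"
  using sc_minus_self[of x "c"] by (simp add: Xt_def a_assoc a_comm[of "sc (- c) x"])

text \<open>Removing the leftmost removable tile makes the recursion deterministic. The value at
  lists that are not paths is a dummy, chosen in the carrier so that \<open>bp_closed\<close> holds
  unconditionally.\<close>

function bp :: "int list \<Rightarrow> 'a" where
  "bp p = (if p \<in> paths N \<and> p \<noteq> fund_path N
     then let j = (LEAST j. removable N p j) in Xt j (tile (flip p j) j) (bp (flip p j))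
     else Es N)"
  by auto
termination
proof (relation "measure height_sum")
  fix p j assume a: "p \<in> paths N \<and> p \<noteq> fund_path N" "j = (LEAST j. removable N p j)"
  then have "removable N p j" using ex_removable[of p N] by (metis LeastI)
  then show "(flip p j, p) \<in> measure height_sum"
    using height_sum_flip[of p N j] a(1) by simp
qed simp

declare bp.simps [simp del]

lemma bp_fund: "bp (fund_path N) = Es N"
  by (simp add: bp.simps)

lemma bp_closed [simp, intro]: "bp p \<in> carrier A"
proof (induction p rule: bp.induct)
  case (1 p)
  show ?case
  proof (cases "p \<in> paths N \<and> p \<noteq> fund_path N")
    case True
    define j where "j = (LEAST j. removable N p j)"
    have "removable N p j" using ex_removable[of p N] True unfolding j_def by (metis LeastI)
    then have "j \<le> N" using removableD by blast
    then show ?thesis using 1[OF True j_def] True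
      by (subst bp.simps) (simp add: j_def[symmetric])
  next
    case False
    then show ?thesis by (subst bp.simps) auto
  qed
qed

text \<open>Removable tiles of a path never touch, so the order in which they are added is immaterial.\<close>

lemma bp_removable:
  assumes "p \<in> paths N" "removable N p i"
  shows "bp p = Xt i (tile (flip p i) i) (bp (flip p i))"
  using assms
proof (induction "height_sum p" arbitrary: p i rule: less_induct)
  case less
  define j where "j = (LEAST j. removable N p j)"
  have rj: "removable N p j" unfolding j_def by (rule LeastI[of "removable N p", OF less(3)])
  have "p \<noteq> fund_path N" using less(3) fund_path_not_removable by blast
  then have bj: "bp p = Xt j (tile (flip p j) j) (bp (flip p j))"
    using less(2) by (subst bp.simps) (simp add: j_def[symmetric])
  show ?case
  proof (cases "i = j")
    case False
    then have far: "i + 2 \<le> j \<or> j + 2 \<le> i"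
      using removable_far[OF less(2,3) rj] removable_far[OF less(2) rj less(3)] by linarith
    then have far': "j + 2 \<le> i \<or> i + 2 \<le> j" by blast
    have ci: "corner N p i" and cj: "corner N p j" using less(3) rj removable_corner by auto
    have le: "i \<le> N" "j \<le> N" using cornerD ci cj by auto
    let ?q = "flip (flip p i) j"
    have q: "flip (flip p j) i = ?q" using flip_commute[OF less(2) le far] by simp
    have ri: "removable N (flip p j) i" "removable N (flip p i) j"
      using corner_flip_far(2)[OF less(2) ci far] corner_flip_far(2)[OF less(2) cj far'] rj less(3)
      by auto
    have pi: "flip p i \<in> paths N" "flip p j \<in> paths N"
      using flip_in_paths less(2) ci cj by auto
    have b1: "bp (flip p j) = Xt i (tile ?q i) (bp ?q)"
      using less(1)[OF height_sum_flip[OF less(2) rj] pi(2) ri(1)] q by simp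
    have b2: "bp (flip p i) = Xt j (tile ?q j) (bp ?q)"
      using less(1)[OF height_sum_flip[OF less(2,3)] pi(1) ri(2)] by simp
    have t1: "tile ?q i = tile (flip p i) i"
      by (rule tile_flip_far[OF pi(1) removable_corner[OF ri(2)] far])
    have t2: "tile ?q j = tile (flip p j) j"
      unfolding q[symmetric] by (rule tile_flip_far[OF pi(2) removable_corner[OF ri(1)] far'])
    show ?thesis
      unfolding bj b1 b2 t1 t2 by (rule Xt_comm) (use le far' in auto)
  qed (use bj in simp)
qed

lemma bp_addable:
  assumes "p \<in> paths N" "addable N p i"
  shows "bp (flip p i) = Xt i (tile p i) (bp p)"
  using bp_removable[OF flip_in_paths removable_flip] flip_flip addable_corner assms by metis

lemma e_bp_addable:
  assumes "p \<in> paths N" "addable N p i"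
  shows "e i \<otimes> bp p = bp (flip p i) \<oplus> sc (tile p i) (bp p)"
  unfolding bp_addable[OF assms]
  by (rule Xt_rearrange) (use cornerD[OF addable_corner[OF assms(2)]] in auto)

text \<open>Together with \<open>e_bp_addable\<close>, the 2 by 2 block of e_i on the two paths that
  differ at \<open>i\<close>. It follows from the square of e_i, since the two coefficients add up
  to the loop weight.\<close>

lemma e_bp_removable:
  assumes "p \<in> paths N" "removable N p i"
  shows "e i \<otimes> bp p = sc (tile p i) (bp p) \<oplus> sc (tile p i * tile (flip p i) i) (bp (flip p i))"
proof -
  let ?q = "flip p i" and ?v = "bp (flip p i)"
  have i: "1 \<le> i" "i \<le> N" using cornerD[OF removable_corner[OF assms(2)]] by auto
  have c: "e i \<in> carrier A" "?v \<in> carrier A" using i by auto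
  have w: "(if i < N then \<delta> else s2) + - tile ?q i = tile p i"
    using tile_sum[OF assms(1) removable_corner[OF assms(2)]] by (simp add: algebra_simps)
  have "e i \<otimes> bp p = e i \<otimes> (e i \<otimes> ?v) \<oplus> sc (- tile ?q i) (e i \<otimes> ?v)"
    using c unfolding bp_removable[OF assms] Xt_def by (simp add: r_distr)
  also have "\<dots> = sc (tile p i) (e i \<otimes> ?v)"
    using c i unfolding w[symmetric] by (simp only: e_sq_left sc_add_left m_closed)
  also have "e i \<otimes> ?v = bp p \<oplus> sc (tile ?q i) ?v"
    unfolding bp_removable[OF assms] by (rule Xt_rearrange) (use c i in auto)
  finally show ?thesis using c by (simp add: sc_add)
qed

text \<open>Unites the neighbour relations on E_N. As the scalar is the coefficient of the tile at
  \<open>j\<close>, the vector with this single tile is killed by e_i: the base of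
  \<open>e_bp_slope\<close>.\<close>

lemma e_adjacent_Es:
  assumes "i < N" "1 \<le> j" "j \<le> N" "j = i + 1 \<or> i = j + 1"
  shows "e i \<otimes> (e j \<otimes> Es N) = sc (tile (fund_path N) j) (e i \<otimes> Es N)"
proof (cases "j < N")
  case True
  then show ?thesis
    using assms e_up_Es[of i N] e_down_Es[of j] by (auto simp: tile_fund)
next
  case False
  then have "j = N" "i = N - 1" using assms by auto
  then show ?thesis using e_right_Es N_pos by (simp add: tile_fund)
qed

text \<open>The Yang--Baxter computation (for \<open>j < N\<close>, with \<open>C = 0\<close>) and the reflection computation
  (for \<open>j = N\<close>) in one.\<close>

lemma e_Xt_Xt:
  assumes i: "1 \<le> i" "i < N" and j: "j \<le> N" "j = i + 1 \<or> i = j + 1" and v: "v \<in> carrier A"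
    and C: "e i \<otimes> (e j \<otimes> v) = sc C (e i \<otimes> v)"
  shows "e i \<otimes> Xt j c (Xt i d v) = sc (1 - d * C - c * (\<delta> - d)) (e i \<otimes> v)"
proof -
  have cl: "e i \<in> carrier A" "e j \<in> carrier A" "e i \<otimes> v \<in> carrier A" using i j v by auto
  have "e i \<otimes> Xt j c (Xt i d v) =
    e i \<otimes> (e j \<otimes> (e i \<otimes> v)) \<oplus> sc (- d) (e i \<otimes> (e j \<otimes> v)) \<oplus>
    (sc (- c) (e i \<otimes> (e i \<otimes> v)) \<oplus> sc (c * d) (e i \<otimes> v))"
    using cl v by (simp add: Xt_def r_distr sc_add)
  also have "\<dots> = sc 1 (e i \<otimes> v) \<oplus> sc (- d * C) (e i \<otimes> v) \<oplus>
    (sc (- c * \<delta>) (e i \<otimes> v) \<oplus> sc (c * d) (e i \<otimes> v))"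
    using cl v i j by (simp add: C e_braid_left e_sq_left)
  also have "\<dots> = sc (1 + - d * C + (- c * \<delta> + c * d)) (e i \<otimes> v)"
    using cl by (simp only: sc_add_left)
  finally show ?thesis by (simp add: algebra_simps)
qed

lemma e_bp_slope_far:
  assumes "p \<in> paths N" "slope N p i" "removable N p j" "i + 2 \<le> j \<or> j + 2 \<le> i"
    and IH: "slope N (flip p j) i \<Longrightarrow> e i \<otimes> bp (flip p j) = \<zero>"
  shows "e i \<otimes> bp p = \<zero>"
proof -
  have j: "1 \<le> j" "j \<le> N" using cornerD[OF removable_corner[OF assms(3)]] by auto
  have iN: "i < N" using assms(2) by (simp add: slope_def)
  have ne: "i \<noteq> j" "i - 1 \<noteq> j" "i + 1 \<noteq> j" "i = 0 \<Longrightarrow> 1 \<noteq> j" using assms(4) j by linarith+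
  then have "slope N (flip p j) i"
    using assms(2) unfolding slope_def flip_nth[OF assms(1) j(2)] by presburger
  then have "Xt j c (e i \<otimes> bp (flip p j)) = \<zero>" for c
    using IH j by (simp only: Xt_zero)
  moreover have "e i \<otimes> bp p = Xt j (tile (flip p j) j) (e i \<otimes> bp (flip p j))"
    unfolding bp_removable[OF assms(1,3)]
    by (rule e_Xt_comm[OF less_imp_le[OF iN] j(2) assms(4) bp_closed])
  ultimately show ?thesis by simp
qed

text \<open>A removable tile far from \<open>i\<close> commutes with e_i. Otherwise the tile at a
  neighbour \<open>j\<close> is removed, which leaves a path \<open>q\<close> with a corner at
  \<open>i\<close>. If \<open>q\<close> also has a removable tile at \<open>i\<close>, then
  \<open>e_Xt_Xt\<close> reduces the claim to the vanishing of a coefficient; if not,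
  \<open>q\<close> can only be p_0, where \<open>e_adjacent_Es\<close> applies.\<close>

lemma e_bp_slope:
  assumes "p \<in> paths N" "slope N p i"
  shows "e i \<otimes> bp p = \<zero>"
  using assms
proof (induction "height_sum p" arbitrary: p i rule: less_induct)
  case less
  have iN: "i < N" using less(3) by (simp add: slope_def)
  have "p \<noteq> fund_path N" using less(3) fund_path_not_slope iN by blast
  then obtain j where rj: "removable N p j" using ex_removable[OF less(2)] by blast
  show ?case
  proof (cases "\<exists>j. removable N p j \<and> (i + 2 \<le> j \<or> j + 2 \<le> i)")
    case True
    then obtain j where j: "removable N p j" "i + 2 \<le> j \<or> j + 2 \<le> i" by blast
    show ?thesis
      by (rule e_bp_slope_far[OF less(2,3) j])
        (rule less(1)[OF height_sum_flip[OF less(2) j(1)] flip_in_paths[OF less(2) removable_corner[OF j(1)]]])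
  next
    case False
    have cj: "corner N p j" by (rule removable_corner[OF rj])
    have j: "1 \<le> j" "j \<le> N" using cornerD[OF cj] by auto
    have "j \<noteq> i"
    proof
      assume "j = i"
      then have "p ! (i - 1) = p ! (i + 1)" using cj iN by (simp add: corner_def)
      then show False using less(3) j \<open>j = i\<close> by (simp add: slope_def)
    qed
    then have adj: "j = i + 1 \<or> i = j + 1" using False rj by force
    define q where "q = flip p j"
    have q: "q \<in> paths N" unfolding q_def by (rule flip_in_paths[OF less(2) cj])
    have cq: "corner N q j" unfolding q_def by (rule corner_flip_self[OF less(2) cj])
    have aq: "addable N q j" unfolding q_def by (rule addable_flip[OF less(2) rj])
    have hq: "height_sum q < height_sum p" unfolding q_def by (rule height_sum_flip[OF less(2) rj])
    have bpp: "bp p = Xt j (tile q j) (bp q)" unfolding q_def by (rule bp_removable[OF less(2) rj])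
    have qn: "q ! k = (if k = j then 2 * p ! (j - 1) - p ! j else p ! k)" for k
      unfolding q_def by (rule flip_nth[OF less(2) j(2)])
    \<comment> \<open>At a slope three consecutive heights are monotone; the flip at the
      neighbouring point moves one outer height onto the other.\<close>
    have ciq: "corner N q i" if i1: "1 \<le> i"
    proof -
      have s: "p ! (i - 1) \<noteq> p ! (i + 1)" using less(3) i1 by (simp add: slope_def)
      have s1: "p ! i = p ! (i - 1) + 1 \<or> p ! i = p ! (i - 1) - 1"
        using paths_step[OF less(2) i1] iN by simp
      have s2: "p ! (i + 1) = p ! i + 1 \<or> p ! (i + 1) = p ! i - 1"
        using paths_Suc[OF less(2) iN] by simp
      have "q ! (i - 1) = q ! (i + 1)"
        using adj
      proof
        assume "j = i + 1"
        then have "q ! (i - 1) = p ! (i - 1)" "q ! (i + 1) = 2 * p ! i - p ! (i + 1)"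
          by (auto simp: qn)
        then show ?thesis using s s1 s2 by linarith
      next
        assume ij: "i = j + 1"
        have "p ! (j - 1) = p ! i" using cj ij iN by (simp add: corner_def)
        then have "q ! (i - 1) = 2 * p ! i - p ! (i - 1)" "q ! (i + 1) = p ! (i + 1)"
          using ij by (auto simp: qn)
        then show ?thesis using s s1 s2 by linarith
      qed
      then show ?thesis using i1 iN by (simp add: corner_def)
    qed
    show ?thesis
    proof (cases "1 \<le> i \<and> removable N q i")
      case True
      then have i1: "1 \<le> i" and riq: "removable N q i" by auto
      define q2 where "q2 = flip q i"
      have ci: "corner N q i" by (rule ciq[OF i1])
      have q2: "q2 \<in> paths N" unfolding q2_def by (rule flip_in_paths[OF q ci])
      have hq2: "height_sum q2 < height_sum q" unfolding q2_def by (rule height_sum_flip[OF q riq])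
      have bpq: "bp q = Xt i (tile q2 i) (bp q2)" unfolding q2_def by (rule bp_removable[OF q riq])
      have q2n: "q2 ! k = (if k = i then 2 * q ! (i - 1) - q ! i else q ! k)" for k
        unfolding q2_def by (rule flip_nth[OF q less_imp_le[OF iN]])
      have tsum: "\<delta> - tile q2 i = tile q i"
        using tile_sum[OF q ci] iN unfolding q2_def by (simp add: algebra_simps)
      have step: "q ! i = q ! (i - 1) + 1 \<or> q ! i = q ! (i - 1) - 1"
        by (rule paths_step[OF q i1]) (use iN in simp)
      have bnd: "\<bar>q ! i\<bar> < int N" "\<bar>q ! (i - 1)\<bar> + 1 < int N"
      proof -
        have "\<bar>q ! i\<bar> \<le> int i" by (rule paths_bound[OF q]) (use iN in simp)
        moreover have "\<bar>q ! (i - 1)\<bar> \<le> int (i - 1)" by (rule paths_bound[OF q]) (use iN in simp)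
        ultimately show "\<bar>q ! i\<bar> < int N" "\<bar>q ! (i - 1)\<bar> + 1 < int N" using iN i1 by linarith+
      qed
      show ?thesis
      proof (cases "j < N")
        case jN: True
        \<comment> \<open>Yang--Baxter case: the flip at \<open>i\<close> creates a slope at
          \<open>j\<close>, so e_j kills \<open>bp q2\<close> by induction and C = 0; the
          coefficients \<open>tile q j\<close> and \<open>tile q i\<close> are inverse quotients of
          \<open>\<psi>\<close>.\<close>
        have "q ! (j - 1) = q ! (j + 1)" using cq jN by (simp add: corner_def)
        then have *: "q2 ! (j - 1) \<noteq> q2 ! (j + 1)" and
          t: "tile q j * tile q i = 1"
        proof -
          assume e: "q ! (j - 1) = q ! (j + 1)"
          have e2: "q ! (i - 1) = q ! (i + 1)" using ci iN by (simp add: corner_def)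
          have nz: "\<psi> (q ! i) \<noteq> 0" "\<psi> (q ! (i - 1)) \<noteq> 0" using psi_nz bnd by auto
          show "q2 ! (j - 1) \<noteq> q2 ! (j + 1)"
            using adj
          proof
            assume "j = i + 1"
            then have "q2 ! (j - 1) = 2 * q ! (i - 1) - q ! i" "q2 ! (j + 1) = q ! i"
              using e by (auto simp: q2n)
            then show ?thesis using step by linarith
          next
            assume "i = j + 1"
            then have "q2 ! (j + 1) = 2 * q ! (i - 1) - q ! i" "q2 ! (j - 1) = q ! i"
              using e by (auto simp: q2n)
            then show ?thesis using step by linarith
          qed
          show "tile q j * tile q i = 1"
            using adj
          proof
            assume "j = i + 1"
            then show ?thesis using nz e2 iN jN by (simp add: tile_def cf_def)
          next
            assume "i = j + 1"
            then show ?thesis using nz e iN jN by (simp add: tile_def cf_def)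
          qed
        qed
        have "slope N q2 j" using * j jN by (simp add: slope_def)
        then have "e j \<otimes> bp q2 = \<zero>"
          using less(1)[of q2 j] hq hq2 q2 by simp
        then have "e i \<otimes> (e j \<otimes> bp q2) = sc 0 (e i \<otimes> bp q2)" using iN j by simp
        from e_Xt_Xt[OF i1 iN j(2) adj bp_closed this]
        show ?thesis
          unfolding bpp bpq using t iN by (simp add: tsum)
      next
        case False
        then have jN: "j = N" using j by simp
        then have iN1: "N - 1 = i" "i + 1 = N" "N \<noteq> i" "i - 1 \<noteq> i" "i - 1 \<noteq> N"
          using adj iN i1 by auto
        let ?a = "q ! (i - 1)" and ?m = "q ! i"
        have qN: "q ! N = ?a" using ci iN unfolding corner_def iN1(2) by simp
        \<comment> \<open>Reflection case: e_N does not kill \<open>bp q2\<close> but yields a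
          multiple of it and a multiple of \<open>bp q3\<close>. Even if \<open>q3\<close> has a
          tile more than \<open>q2\<close>, it is smaller than \<open>p\<close> and slopes at
          \<open>i\<close>, so e_i removes it by induction.\<close>
        define q3 where "q3 = flip q2 N"
        have c2: "corner N q2 N" using N_pos by (simp add: corner_def)
        have q3: "q3 \<in> paths N" unfolding q3_def by (rule flip_in_paths[OF q2 c2])
        have q2v: "q2 ! (N - 1) = 2 * ?a - ?m" "q2 ! N = ?a" "q2 ! (i - 1) = ?a"
          unfolding q2n iN1(1) using iN1(3-5) qN by simp_all
        have q3n: "q3 ! k = (if k = N then 2 * q2 ! (N - 1) - q2 ! N else q2 ! k)" for k
          unfolding q3_def by (rule flip_nth[OF q2 order_refl])
        have "q3 ! (i - 1) = ?a" "q3 ! (i + 1) = 2 * (2 * ?a - ?m) - ?a"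
          unfolding q3n iN1(2) using iN1(3-5) q2v by simp_all
        then have sl3: "slope N q3 i" using step i1 iN by (auto simp: slope_def)
        have hs3: "height_sum q3 < height_sum p"
        proof -
          have "?m = (if ?a \<ge> 0 then ?a + 1 else ?a - 1)"
            by (rule removableD(4)[OF riq])
          moreover have "int (height_sum q) = int (height_sum p)
              + \<bar>2 * ?a + 1\<bar> - \<bar>2 * (2 * ?m - ?a) + 1\<bar>"
          proof -
            have "q ! N = 2 * p ! (N - 1) - p ! N" "q ! (N - 1) = p ! (N - 1)"
              unfolding qn jN iN1(1) using iN1(3) by simp_all
            then have "p ! N = 2 * ?m - ?a" "2 * p ! (N - 1) - p ! N = ?a"
              using qN unfolding iN1(1) by linarith+
            then show ?thesis
              using int_height_sum_flip[OF less(2) order_refl] unfolding q_def jN by simp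
          qed
          moreover have "int (height_sum q2) = int (height_sum q)
              + \<bar>2 * (2 * ?a - ?m) + 1\<bar> - \<bar>2 * ?m + 1\<bar>"
            unfolding q2_def using int_height_sum_flip[OF q less_imp_le[OF iN]] by simp
          moreover have "int (height_sum q3) = int (height_sum q2)
              + \<bar>2 * (2 * (2 * ?a - ?m) - ?a) + 1\<bar> - \<bar>2 * ?a + 1\<bar>"
            unfolding q3_def using int_height_sum_flip[OF q2 order_refl] unfolding q2v by simp
          ultimately show ?thesis by (rule reflected_height)
        qed
        have z3: "e i \<otimes> bp q3 = \<zero>" by (rule less(1)[OF hs3 q3 sl3])
        have cl: "e i \<in> carrier A" "e N \<in> carrier A" using iN by auto
        have rel: "e i \<otimes> (e N \<otimes> bp q2) = sc (tile q2 N) (e i \<otimes> bp q2)"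
          using addable_or_removable[OF q2 c2]
        proof
          assume a: "addable N q2 N"
          show ?thesis
            unfolding e_bp_addable[OF q2 a] q3_def[symmetric] using cl z3 by (simp add: r_distr)
        next
          assume r: "removable N q2 N"
          show ?thesis
            unfolding e_bp_removable[OF q2 r] q3_def[symmetric] using cl z3 by (simp add: r_distr)
        qed
        \<comment> \<open>The coefficient left by the reflection; that it vanishes is
          \<open>kappa_psi\<close> at the height ?a.\<close>
        have "1 - tile q2 i * tile q2 N - tile q j * (\<delta> - tile q2 i) = 0"
        proof -
          have "tile q2 i = \<psi> (2 * ?a - ?m) / \<psi> ?a"
            using iN q2v unfolding iN1(1) by (simp add: tile_def cf_def)
          moreover have "tile q2 N = \<kappa> (2 * ?a - ?m) ?a" "tile q j = \<kappa> ?m ?a"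
            using q2v qN unfolding jN tile_def iN1(1) by (simp_all add: cf_def)
          moreover have "tile q i = \<psi> ?m / \<psi> ?a" using iN by (simp add: tile_def cf_def)
          ultimately show ?thesis
            using kappa_psi_step[OF bnd(2) step] unfolding tsum
            by (simp only: mult.commute diff_diff_eq right_minus_eq)
        qed
        then have "e i \<otimes> Xt j (tile q j) (Xt i (tile q2 i) (bp q2)) = sc 0 (e i \<otimes> bp q2)"
          using e_Xt_Xt[OF i1 iN j(2) adj bp_closed, of q2 "tile q2 N" "tile q j" "tile q2 i"] rel
          by (simp only: jN)
        then show ?thesis unfolding bpp bpq using cl by simp
      qed
    next
      case nr: False
      \<comment> \<open>Both \<open>i\<close> (if positive) and \<open>j\<close> are addable in
        \<open>q\<close>; adjacent addable points force the heights around them into {-1,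
        0}.\<close>
      have window: "q ! k = 0 \<or> q ! k = - 1"
        if k: "k \<le> N" "k \<le> i + 1 \<and> i \<le> k + 1 \<or> k \<le> j + 1 \<and> j \<le> k + 1" for k
      proof (cases "i = 0")
        case True
        then have j1: "j = 1" using adj by simp
        have p1: "p ! 1 = 1" using less(3) True by (simp add: slope_def)
        have q0: "q ! 0 = 0" by (rule paths_0[OF q])
        have "q ! 1 = - 1" using p1 paths_0[OF less(2)] by (simp add: qn j1)
        moreover have "q ! 2 = 0" if "2 \<le> N" using cq q0 that unfolding corner_def j1 by (simp add: numeral_2_eq_2)
        moreover have "k = 0 \<or> k = 1 \<or> k = 2" using k True j1 by linarith
        ultimately show ?thesis using q0 k(1) by blast
      next
        case False
        then have i1: "1 \<le> i" by simp
        have aqi: "addable N q i" using nr i1 addable_or_removable[OF q ciq[OF i1]] by blast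
        let ?a = "q ! (i - 1)" and ?x = "q ! i"
        have x: "?x = (if ?a \<ge> 0 then ?a - 1 else ?a + 1)" by (rule addableD(4)[OF aqi])
        have ai: "q ! (i + 1) = ?a" using addableD(3)[OF aqi iN] by simp
        have aj: "q ! j = (if q ! (j - 1) \<ge> 0 then q ! (j - 1) - 1 else q ! (j - 1) + 1)"
          by (rule addableD(4)[OF aq])
        show ?thesis
          using adj
        proof
          assume ij: "j = i + 1"
          have aa: "?a = (if ?x \<ge> 0 then ?x - 1 else ?x + 1)" using aj unfolding ij add_diff_cancel_right' ai .
          have "q ! (i + 2) = ?x" if "i + 2 \<le> N"
            using addableD(3)[OF aq] that unfolding ij by simp
          moreover have "k = i - 1 \<or> k = i \<or> k = i + 1 \<or> k = i + 2" using k(2) ij by linarith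
          ultimately show ?thesis using mutually_addable[OF x aa] ai k(1) by presburger
        next
          assume ij: "i = j + 1"
          have jx: "q ! (j - 1) = ?x" using addableD(3)[OF aq] iN ij by simp
          have j': "j = i - 1" using ij by simp
          have aa: "?a = (if ?x \<ge> 0 then ?x - 1 else ?x + 1)" using aj unfolding jx unfolding j' .
          have "k = j - 1 \<or> k = i - 1 \<or> k = i \<or> k = i + 1" using k(2) ij by linarith
          then show ?thesis using mutually_addable[OF x aa] ai jx by presburger
        qed
      qed
      \<comment> \<open>A removable tile of \<open>q\<close> has its height outside {-1, 0}, hence
        lies far from \<open>i\<close> and \<open>j\<close>; it would then be removable in
        \<open>p\<close> too, against the case assumption.\<close>
      have "q = fund_path N"
      proof (rule ccontr)
        assume "q \<noteq> fund_path N"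
        then obtain l where l: "removable N q l" using ex_removable[OF q] by blast
        have lN: "l \<le> N" using cornerD[OF removable_corner[OF l]] by simp
        have far: "i + 2 \<le> l \<or> l + 2 \<le> i" "j + 2 \<le> l \<or> l + 2 \<le> j"
          using window[OF lN] removable_height[OF l] by linarith+
        have "removable N p l"
          using l unfolding q_def corner_flip_far(2)[OF less(2) cj far(2)] .
        then show False using \<open>\<not> (\<exists>j. removable N p j \<and> (i + 2 \<le> j \<or> j + 2 \<le> i))\<close> far(1) by blast
      qed
      then show ?thesis
        using e_adjacent_Es[OF iN j adj] iN j sc_minus_self[of "e i \<otimes> Es N"]
        unfolding bpp by (simp add: bp_fund Xt_def r_distr)
    qed
  qed
qed

end

section \<open>Orthogonality\<close>

text \<open>The tiles that fill a column from the fundamental path up (or down) to height \<open>h\<close> lie at the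
  heights in \<open>tile_heights h\<close>.\<close>

definition tile_heights :: "int \<Rightarrow> int set" where
  "tile_heights h = {a. odd (h - a) \<and> (if h \<ge> 0 then 0 \<le> a \<and> a < h else h < a \<and> a < 0)}"

definition col :: "(int \<Rightarrow> 'b::comm_monoid_mult) \<Rightarrow> int \<Rightarrow> 'b" where
  "col f h = (\<Prod>a\<in>tile_heights h. f a)"

lemma finite_tile_heights [simp]: "finite (tile_heights h)"
  by (rule finite_subset[of _ "{- \<bar>h\<bar>..\<bar>h\<bar>}"]) (auto simp: tile_heights_def split: if_splits)

lemma col_0 [simp]: "col f 0 = 1" "col f (- 1) = 1"
proof -
  have "tile_heights 0 = {}" "tile_heights (- 1) = {}" by (auto simp: tile_heights_def)
  then show "col f 0 = 1" "col f (- 1) = 1" by (simp_all add: col_def)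
qed

lemma col_above:
  assumes "0 \<le> a"
  shows "col f (a + 1) = f a * col f (a - 1)"
proof -
  have "tile_heights (a + 1) = insert a (tile_heights (a - 1))"
  proof (rule Set.set_eqI)
    fix x
    show "x \<in> tile_heights (a + 1) \<longleftrightarrow> x \<in> insert a (tile_heights (a - 1))"
      using assms unfolding tile_heights_def insert_iff mem_Collect_eq by presburger
  qed
  moreover have "a \<notin> tile_heights (a - 1)" using assms by (auto simp: tile_heights_def)
  ultimately show ?thesis by (simp add: col_def)
qed

lemma col_below:
  assumes "a < 0"
  shows "col f (a - 1) = f a * col f (a + 1)"
proof -
  have "tile_heights (a - 1) = insert a (tile_heights (a + 1))"
  proof (rule Set.set_eqI)
    fix x
    show "x \<in> tile_heights (a - 1) \<longleftrightarrow> x \<in> insert a (tile_heights (a + 1))"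
      using assms unfolding tile_heights_def insert_iff mem_Collect_eq by presburger
  qed
  moreover have "a \<notin> tile_heights (a + 1)" using assms by (auto simp: tile_heights_def)
  ultimately show ?thesis by (simp add: col_def)
qed

lemma col_removable:
  assumes "p \<in> paths N" "removable N p j"
  shows "col f (p ! j) = f (p ! (j - 1)) * col f (flip p j ! j)"
proof -
  let ?a = "p ! (j - 1)"
  have v: "flip p j ! j = 2 * ?a - p ! j" by (rule flip_values(1)[OF assms(1) removable_corner[OF assms(2)]])
  show ?thesis
  proof (cases "?a \<ge> 0")
    case True
    then have "p ! j = ?a + 1" using removableD(4)[OF assms(2)] by simp
    moreover from this have "flip p j ! j = ?a - 1" unfolding v by linarith
    ultimately show ?thesis using col_above[OF True, of f] by (simp only:)
  next
    case False
    then have "p ! j = ?a - 1" using removableD(4)[OF assms(2)] by simp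
    moreover from this have "flip p j ! j = ?a + 1" unfolding v by linarith
    ultimately show ?thesis using col_below[of ?a f] False by (simp only: not_le)
  qed
qed

section \<open>Norms as products over tiles\<close>

context sos_weights
begin

text \<open>The product r(u) r(-u) for u = \<omega>1 - a; likewise \<open>kk\<close> is k(u)
  k(-u).\<close>

definition rho :: "int \<Rightarrow> complex" where
  "rho a = \<psi> (a + 1) * \<psi> (a - 1) / \<psi> a ^ 2"

definition kk :: "int \<Rightarrow> complex" where
  "kk a = \<kappa> a (a + 1) * \<kappa> a (a - 1)"

text \<open>Closed form of the square norm of b_p: one factor per tile, collected by columns. The
  column over \<open>N\<close> holds the half-tiles.\<close>

definition nrm :: "int list \<Rightarrow> complex" where
  "nrm p = (\<Prod>i<N. col rho (p ! i)) * col kk (p ! N)"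

lemma nrm_fund: "nrm (fund_path N) = 1"
proof -
  have "col f (fund_path N ! i) = 1" if "i \<le> N" for i and f :: "int \<Rightarrow> complex"
    using fund_path_nth[OF that] by simp
  then show ?thesis by (simp add: nrm_def)
qed

lemma tile_mult:
  assumes p: "p \<in> paths N" and j: "corner N p j"
  shows "tile p j * tile (flip p j) j = (if j < N then rho else kk) (p ! (j - 1))"
proof -
  let ?a = "p ! (j - 1)"
  have "p ! j = ?a + 1 \<or> p ! j = ?a - 1"
    using paths_step[OF p] cornerD[OF j] by blast
  then have "p ! j = ?a + 1 \<and> flip p j ! j = ?a - 1 \<or> p ! j = ?a - 1 \<and> flip p j ! j = ?a + 1"
    unfolding flip_values(1)[OF p j] by linarith
  then show ?thesis
    unfolding tile_def flip_values(2)[OF p j] cf_def rho_def kk_def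
    by (elim disjE conjE) (simp_all only: power2_eq_square times_divide_times_eq mult.commute split: if_split, simp_all)
qed

lemma nrm_removable:
  assumes p: "p \<in> paths N" and j: "removable N p j"
  shows "nrm p = tile p j * tile (flip p j) j * nrm (flip p j)"
proof -
  have c: "corner N p j" by (rule removable_corner[OF j])
  have jN: "1 \<le> j" "j \<le> N" using cornerD[OF c] by auto
  have q: "flip p j ! i = p ! i" if "i \<noteq> j" for i
    using flip_nth[OF p jN(2)] that by simp
  show ?thesis
  proof (cases "j < N")
    case True
    have "(\<Prod>i<N. col rho (p ! i)) = col rho (p ! j) * (\<Prod>i\<in>{..<N} - {j}. col rho (p ! i))"
      using True by (intro prod.remove) auto
    also have "\<dots> = rho (p ! (j - 1)) * (col rho (flip p j ! j) * (\<Prod>i\<in>{..<N} - {j}. col rho (flip p j ! i)))"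
      using q by (simp add: col_removable[OF p j, of rho] mult.assoc)
    also have "col rho (flip p j ! j) * (\<Prod>i\<in>{..<N} - {j}. col rho (flip p j ! i)) =
        (\<Prod>i<N. col rho (flip p j ! i))"
      using True by (intro prod.remove[symmetric]) auto
    finally show ?thesis
      using q[of N] True unfolding nrm_def tile_mult[OF p c] by simp
  next
    case False
    then have "j = N" using jN by simp
    then have "(\<Prod>i<N. col rho (p ! i)) = (\<Prod>i<N. col rho (flip p j ! i))"
      using q by simp
    then show ?thesis
      using col_removable[OF p j, of kk] \<open>j = N\<close> unfolding nrm_def tile_mult[OF p c] by simp
  qed
qed

end

section \<open>Projection of the basis vectors by the idempotents\<close>

context tb_algebra
begin

text \<open>No tile covers point 1, so e_0 commutes with every tile factor down to E_N, on which it
  has the eigenvalue s1.\<close>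

lemma e_0_bp:
  assumes "p \<in> paths N" "p ! 1 = - 1"
  shows "e 0 \<otimes> bp p = sc s1 (bp p)"
  using assms
proof (induction "height_sum p" arbitrary: p rule: less_induct)
  case less
  show ?case
  proof (cases "p = fund_path N")
    case True
    then show ?thesis using N_pos by (simp add: bp_fund e_0_Es)
  next
    case False
    then obtain j where j: "removable N p j" using ex_removable[OF less(2)] by blast
    have c: "corner N p j" by (rule removable_corner[OF j])
    have jN: "1 \<le> j" "j \<le> N" using cornerD[OF c] by auto
    have "j \<noteq> 1" using removable_height(2)[OF j] less(3) by auto
    then have j2: "2 \<le> j" using jN by simp
    have "flip p j ! 1 = - 1"
      using flip_nth[OF less(2) jN(2), of 1] \<open>j \<noteq> 1\<close> less(3) by simp
    then have IH: "e 0 \<otimes> bp (flip p j) = sc s1 (bp (flip p j))"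
      by (rule less(1)[OF height_sum_flip[OF less(2) j] flip_in_paths[OF less(2) c]])
    have "e 0 \<otimes> bp p = Xt j (tile (flip p j) j) (e 0 \<otimes> bp (flip p j))"
      unfolding bp_removable[OF less(2) j] by (rule e_Xt_comm) (use j2 jN in auto)
    also have "\<dots> = sc s1 (bp p)"
      unfolding IH bp_removable[OF less(2) j] Xt_def using jN
      by (simp add: sc_add mult.commute)
    finally show ?thesis .
  qed
qed

text \<open>If the next height deviates from p_0, the path slopes at \<open>i\<close> and e_i kills
  it. If not, e_i b_p is \<open>fw i\<close> times b_p plus the vector of a path that deviates at
  \<open>i\<close>, which the outer E_i removes.\<close>

lemma Es_bp:
  assumes p: "p \<in> paths N"
  shows "i \<le> N \<Longrightarrow>
    Es i \<otimes> bp p = (if \<forall>j\<le>i. p ! j = fund_path N ! j then bp p else \<zero>)"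
  using p
proof (induction i arbitrary: p)
  case 0
  then show ?case using paths_0[OF 0(2)] by (simp add: fund_path_nth)
next
  case (Suc i)
  have iN: "i < N" using Suc.prems by simp
  let ?agr = "\<lambda>p i. \<forall>j\<le>i. p ! j = fund_path N ! j"
  have cl: "e i \<in> carrier A" "Es i \<in> carrier A" using iN by auto
  have IH: "Es i \<otimes> bp q = (if ?agr q i then bp q else \<zero>)" if "q \<in> paths N" for q
    using Suc.IH[OF less_imp_le[OF iN] that] .
  have E: "Es (Suc i) \<otimes> bp p = sc (1 / fw i) (Es i \<otimes> (e i \<otimes> (Es i \<otimes> bp p)))"
    using cl by (simp add: Es.simps m_assoc)
  have agrS: "?agr p (Suc i) \<longleftrightarrow> ?agr p i \<and> p ! Suc i = fund_path N ! Suc i"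
    by (auto simp: le_Suc_eq)
  show ?case
  proof (cases "?agr p i")
    case False
    then have Ez: "Es i \<otimes> bp p = \<zero>" using IH[OF Suc.prems(2)] by (simp only: if_False)
    have "\<not> ?agr p (Suc i)" using False agrS by blast
    then show ?thesis unfolding E Ez if_not_P[OF \<open>\<not> ?agr p (Suc i)\<close>] using cl by simp
  next
    case agr: True
    have Ep: "Es i \<otimes> bp p = bp p" using IH[OF Suc.prems(2)] agr by simp
    have pi: "p ! i = (if even i then 0 else - 1)" using agr fund_path_nth[of i N] iN by auto
    have fS: "fund_path N ! Suc i = (if even i then - 1 else 0)"
      using fund_path_nth[of "Suc i" N] iN by simp
    show ?thesis
    proof (cases "p ! Suc i = fund_path N ! Suc i")
      case False
      then have "slope N p i"
      proof -
        have st: "p ! Suc i = p ! i + 1 \<or> p ! Suc i = p ! i - 1"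
          by (rule paths_Suc[OF Suc.prems(2) iN])
        show ?thesis
        proof (cases "i = 0")
          case True
          then show ?thesis using st False pi fS iN by (simp add: slope_def)
        next
          case i0: False
          have "p ! (i - 1) = fund_path N ! (i - 1)" using agr by simp
          also have "\<dots> = fund_path N ! Suc i"
            using fund_path_nth[of "i - 1" N] fS iN i0 by simp
          finally show ?thesis using False i0 iN by (simp add: slope_def)
        qed
      qed
      then have "e i \<otimes> bp p = \<zero>" by (rule e_bp_slope[OF Suc.prems(2)])
      then show ?thesis unfolding E Ep agrS using False cl by simp
    next
      case True
      have "sc (1 / fw i) (Es i \<otimes> (e i \<otimes> bp p)) = bp p"
      proof (cases "i = 0")
        case i0: True
        have "p ! 1 = - 1" using True fS i0 by simp
        then show ?thesis using e_0_bp[OF Suc.prems(2)] i0 s1_nz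
          by (simp add: fw_def)
      next
        case False
        have pr: "p ! (i - 1) = fund_path N ! (i - 1)" "p ! i = fund_path N ! i" using agr by auto
        have c: "p ! (i - 1) = p ! Suc i"
          unfolding pr True using fund_path_nth[of "i - 1" N] fS iN False by simp
        have ad: "addable N p i"
          using fund_path_corner[of i N] pr c iN False
          unfolding addable_def corner_def pr(1)[symmetric] pr(2)[symmetric] by simp
        have "flip p i ! i \<noteq> fund_path N ! i"
          unfolding pr(2)[symmetric] using flip_values(1)[OF Suc.prems(2) addable_corner[OF ad]]
            addableD(4)[OF ad] by presburger
        then have "\<not> ?agr (flip p i) i" by blast
        then have z: "Es i \<otimes> bp (flip p i) = \<zero>"
          using IH[OF flip_in_paths[OF Suc.prems(2) addable_corner[OF ad]]] by (simp only: if_False)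
        have t: "tile p i = fw i"
          using cf_fund[of i] iN False unfolding tile_def pr by simp
        show ?thesis
          unfolding e_bp_addable[OF Suc.prems(2) ad] using cl z Ep fw_nz[of i] t
          by (simp add: r_distr)
      qed
      then show ?thesis unfolding E Ep agrS using True agr by simp
    qed
  qed
qed

lemma Es_N_bp:
  assumes "p \<in> paths N"
  shows "Es N \<otimes> bp p = (if p = fund_path N then Es N else \<zero>)"
proof -
  have "(\<forall>j\<le>N. p ! j = fund_path N ! j) \<longleftrightarrow> p = fund_path N"
    using paths_eqI[OF assms fund_path_in_paths] by auto
  then show ?thesis using Es_bp[OF assms order_refl] by (simp add: bp_fund)
qed

end

section \<open>Transposition and orthogonality\<close>

locale tb_algebra_transpose = tb_algebra N \<psi> \<kappa> \<delta> s1 s2 b A sc e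
  for N \<psi> \<kappa> \<delta> s1 s2 b and A :: "('a, 'm) ring_scheme" (structure) and sc e +
  fixes tr :: "'a \<Rightarrow> 'a"
  assumes tr_closed [simp, intro]: "x \<in> carrier A \<Longrightarrow> tr x \<in> carrier A"
    and tr_one [simp]: "tr \<one> = \<one>"
    and tr_add [simp]: "x \<in> carrier A \<Longrightarrow> y \<in> carrier A \<Longrightarrow> tr (x \<oplus> y) = tr x \<oplus> tr y"
    and tr_mult [simp]: "x \<in> carrier A \<Longrightarrow> y \<in> carrier A \<Longrightarrow> tr (x \<otimes> y) = tr y \<otimes> tr x"
    and tr_sc [simp]: "x \<in> carrier A \<Longrightarrow> tr (sc c x) = sc c (tr x)"
    and tr_e [simp]: "i \<le> N \<Longrightarrow> tr (e i) = e i"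
begin

lemma tr_Es: "i \<le> N \<Longrightarrow> tr (Es i) = Es i"
  by (induction i) (simp_all add: Es.simps m_assoc)

lemma tr_Xt_mult:
  "j \<le> N \<Longrightarrow> x \<in> carrier A \<Longrightarrow> y \<in> carrier A \<Longrightarrow> tr (Xt j c x) \<otimes> y = tr x \<otimes> Xt j c y"
  by (simp add: Xt_def l_distr r_distr m_assoc)

text \<open>Tile factors are self-adjoint, so the last one of b_p moves over to b_q. There e_j gives
  zero or a combination of b_q and its flip: the multiples of b_q cancel if the tile is addable, and
  the flip supplies the new norm factor if it is removable.\<close>

lemma bp_orthogonal:
  assumes "p \<in> paths N" "q \<in> paths N"
  shows "tr (bp p) \<otimes> bp q = (if p = q then sc (nrm p) (Es N) else \<zero>)"
  using assms
proof (induction "height_sum p" arbitrary: p q rule: less_induct)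
  case less
  show ?case
  proof (cases "p = fund_path N")
    case True
    then show ?thesis
      using Es_N_bp[OF less(3)] by (auto simp: bp_fund tr_Es nrm_fund)
  next
    case False
    then obtain j where j: "removable N p j" using ex_removable[OF less(2)] by blast
    have cp: "corner N p j" by (rule removable_corner[OF j])
    have jN: "1 \<le> j" "j \<le> N" using cornerD[OF cp] by auto
    define p' where "p' = flip p j"
    have p': "p' \<in> paths N" unfolding p'_def by (rule flip_in_paths[OF less(2) cp])
    have ap': "addable N p' j" unfolding p'_def by (rule addable_flip[OF less(2) j])
    have fp': "flip p' j = p" unfolding p'_def by (rule flip_flip[OF less(2) cp])
    have IH: "tr (bp p') \<otimes> bp u = (if p' = u then sc (nrm p') (Es N) else \<zero>)"
      if "u \<in> paths N" for u
      by (rule less(1)[OF _ p' that]) (use height_sum_flip[OF less(2) j] p'_def in simp)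
    have cl: "e j \<in> carrier A" "tr (bp p') \<in> carrier A" "Es N \<in> carrier A" using jN by auto
    have main: "tr (bp p) \<otimes> bp q =
        tr (bp p') \<otimes> (e j \<otimes> bp q) \<oplus> sc (- tile p' j) (tr (bp p') \<otimes> bp q)"
      using tr_Xt_mult[OF jN(2) bp_closed bp_closed, of "tile p' j" p' q] cl
      unfolding bp_removable[OF less(2) j] p'_def[symmetric] Xt_def by (simp add: r_distr)
    show ?thesis
    proof (cases "corner N q j")
      case False
      then have "j < N" "slope N q j" using jN by (auto simp: corner_def slope_def)
      then have "e j \<otimes> bp q = \<zero>" using e_bp_slope[OF less(3)] by blast
      moreover have "p' \<noteq> q" "p \<noteq> q" using False cp addable_corner[OF ap'] by auto
      ultimately show ?thesis unfolding main IH[OF less(3)] using cl by simp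
    next
      case cq: True
      have fq: "flip q j \<in> paths N" by (rule flip_in_paths[OF less(3) cq])
      from addable_or_removable[OF less(3) cq] show ?thesis
      proof
        assume a: "addable N q j"
        have ne: "p \<noteq> q" "p' \<noteq> flip q j"
          using addable_not_removable a j ap' removable_flip[OF less(3) a] by blast+
        have "tr (bp p') \<otimes> (e j \<otimes> bp q) = sc (tile q j) (tr (bp p') \<otimes> bp q)"
          unfolding e_bp_addable[OF less(3) a] using cl IH[OF fq] ne(2) by (simp add: r_distr)
        then show ?thesis
          unfolding main IH[OF less(3)] using ne(1) cl
          using sc_minus_self[of "sc (nrm p') (Es N)" "tile q j"] by auto
      next
        assume r: "removable N q j"
        have ne: "p' \<noteq> q" using addable_not_removable r ap' by blast
        have eq: "p' = flip q j \<longleftrightarrow> p = q"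
        proof
          assume "p' = flip q j"
          then have "flip p' j = flip (flip q j) j" by simp
          then show "p = q" unfolding fp' flip_flip[OF less(3) cq] .
        qed (simp add: p'_def)
        have "tr (bp p') \<otimes> (e j \<otimes> bp q) =
            sc (tile q j * tile (flip q j) j) (tr (bp p') \<otimes> bp (flip q j))"
          unfolding e_bp_removable[OF less(3) r] using cl IH[OF less(3)] ne by (simp add: r_distr)
        then show ?thesis
          unfolding main IH[OF less(3)] IH[OF fq] eq using ne cl
          using nrm_removable[OF less(2) j] p'_def by auto
      qed
    qed
  qed
qed

end

section \<open>The solid-on-solid representation\<close>

context sos_weights
begin

text \<open>The sole purpose of this representation is to show that \<open>E\<^sub>N\<close> does not vanish in the double
  quotient.\<close>

definition op :: "nat \<Rightarrow> (int list \<Rightarrow> complex) \<Rightarrow> int list \<Rightarrow> complex" where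
  "op i \<phi> p = (if i = 0 then (if p ! 1 = - 1 then s1 * \<phi> p else 0)
     else if corner N p i then tile p i * (\<phi> p + \<phi> (flip p i)) else 0)"

text \<open>Marks the rows in which e_i can be nonzero; \<open>wt\<close> is the entry of such a
  row. For \<open>i = 0\<close> the left boundary plays the role of a corner.\<close>

definition live :: "int list \<Rightarrow> nat \<Rightarrow> bool" where
  "live p i \<longleftrightarrow> (if i = 0 then p ! 1 = - 1 else corner N p i)"

definition wt :: "int list \<Rightarrow> nat \<Rightarrow> complex" where
  "wt p i = (if i = 0 then s1 else tile p i)"

lemma op_not_live: "\<not> live p i \<Longrightarrow> op i \<phi> p = 0"
  by (auto simp: op_def live_def)

text \<open>Path functions are formally defined on all integer lists, while the relations hold on
  paths only; this lets them be applied inside products.\<close>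

lemma op_cong:
  assumes "p \<in> paths N" "\<And>q. q \<in> paths N \<Longrightarrow> \<phi> q = \<phi>' q"
  shows "op i \<phi> p = op i \<phi>' p"
  using assms flip_in_paths[OF assms(1)] by (simp add: op_def)

lemma op_linear: "op i (\<lambda>q. \<Sum>x\<in>S. c x * f x q) p = (\<Sum>x\<in>S. c x * op i (f x) p)"
  by (simp add: op_def sum_distrib_left sum.distrib[symmetric] algebra_simps)

lemma op_sq:
  assumes "p \<in> paths N" "1 \<le> i" "i \<le> N"
  shows "op i (op i \<phi>) p = (if i < N then \<delta> else s2) * op i \<phi> p"
proof (cases "corner N p i")
  case True
  have "op i (op i \<phi>) p = tile p i * (tile p i * (\<phi> p + \<phi> (flip p i)) +
      tile (flip p i) i * (\<phi> (flip p i) + \<phi> p))"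
    using assms True by (simp add: op_def corner_flip_self flip_flip)
  also have "\<dots> = (tile p i + tile (flip p i) i) * (tile p i * (\<phi> p + \<phi> (flip p i)))"
    by (simp add: algebra_simps)
  finally show ?thesis using assms True by (simp add: tile_sum[OF assms(1) True] op_def)
qed (use assms in \<open>simp add: op_def\<close>)

lemma op_0_sq: "op 0 (op 0 \<phi>) p = s1 * op 0 \<phi> p"
  by (simp add: op_def)

lemma live_flip_far:
  assumes "p \<in> paths N" "corner N p i" "i + 2 \<le> j \<or> j + 2 \<le> i"
  shows "live (flip p i) j = live p j"
proof (cases "j = 0")
  case True
  then have "i \<noteq> 1" using assms(2,3) by (auto simp: corner_def)
  then show ?thesis
    using True flip_nth[OF assms(1), of i 1] cornerD[OF assms(2)] by (simp add: live_def)
qed (use corner_flip_far(1)[OF assms] in \<open>simp add: live_def\<close>)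

lemma op_comm:
  assumes "p \<in> paths N" "i \<le> N" "j \<le> N" "i + 2 \<le> j \<or> j + 2 \<le> i"
  shows "op i (op j \<phi>) p = op j (op i \<phi>) p"
proof -
  have far: "j + 2 \<le> i \<or> i + 2 \<le> j" using assms(4) by blast
  have zero: "op 0 (op k \<phi>) p = op k (op 0 \<phi>) p" if "2 \<le> k" "k \<le> N" for k
  proof (cases "corner N p k")
    case True
    have "flip p k ! 1 = p ! 1" using flip_nth[OF assms(1) that(2)] that(1) by simp
    then show ?thesis using that True by (simp add: op_def algebra_simps)
  qed (use that in \<open>simp add: op_def\<close>)
  consider "i = 0" | "j = 0" | "1 \<le> i" "1 \<le> j" by linarith
  then show ?thesis
  proof cases
    case 3
    show ?thesis
    proof (cases "corner N p i \<and> corner N p j")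
      case True
      then have c: "corner N p i" "corner N p j" by auto
      show ?thesis
        using 3 c flip_commute[OF assms] tile_flip_far[OF assms(1) c(1) far]
          tile_flip_far[OF assms(1) c(2) assms(4)]
          corner_flip_far(1)[OF assms(1) c(1) assms(4)] corner_flip_far(1)[OF assms(1) c(2) far]
        by (simp add: op_def algebra_simps)
    next
      case False
      then show ?thesis
        using 3 corner_flip_far(1)[OF assms(1) _ assms(4)] corner_flip_far(1)[OF assms(1) _ far]
        by (auto simp: op_def)
    qed
  qed (use zero[of j] zero[of i] assms in auto)
qed

text \<open>A flip at \<open>j\<close> destroys the corner at \<open>i\<close>, so between two
  copies of e_i only the diagonal part \<open>t\<close> of e_j is felt. In the bulk exactly one of
  \<open>p\<close> and its flip is live at \<open>j\<close>, with a weight inverse to the tile; for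
  \<open>j = N\<close> both are, and \<open>kappa_psi\<close> gives the sum 1.\<close>

lemma op_braid:
  assumes p: "p \<in> paths N" and i: "1 \<le> i" "i < N" and j: "j = i + 1 \<or> i = j + 1"
  shows "op i (op j (op i \<phi>)) p = op i \<phi> p"
proof (cases "corner N p i")
  case ci: True
  define t where "t u = (if live u j then wt u j else 0)" for u
  let ?q = "flip p i"
  have jN: "j \<le> N" using i j by auto
  have q: "?q \<in> paths N" by (rule flip_in_paths[OF p ci])
  have cq: "corner N ?q i" by (rule corner_flip_self[OF p ci])
  have opj: "op j (op i \<phi>) u = t u * op i \<phi> u" if u: "u \<in> paths N" "corner N u i" for u
  proof (cases "j \<noteq> 0 \<and> corner N u j")
    case True
    have e: "u ! (i - 1) = u ! (i + 1)" using u(2) i by (simp add: corner_def)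
    have st: "u ! j = u ! (j - 1) + 1 \<or> u ! j = u ! (j - 1) - 1"
      using paths_step[OF u(1)] True jN by simp
    have "\<not> corner N (flip u j) i"
    proof
      assume "corner N (flip u j) i"
      then have "flip u j ! (i - 1) = flip u j ! (i + 1)" using i by (simp add: corner_def)
      then have "(if i - 1 = j then 2 * u ! (j - 1) - u ! j else u ! (i - 1)) =
          (if i + 1 = j then 2 * u ! (j - 1) - u ! j else u ! (i + 1))"
        unfolding flip_nth[OF u(1) jN] .
      moreover have "i - 1 \<noteq> j \<and> i + 1 = j \<or> i - 1 = j \<and> i + 1 \<noteq> j" using j i by auto
      ultimately have "u ! j = 2 * u ! (j - 1) - u ! j" using e by auto
      then show False using st by linarith
    qed
    then have "op i \<phi> (flip u j) = 0" using i by (simp add: op_def)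
    then show ?thesis using True by (simp add: op_def[of j] t_def live_def wt_def)
  next
    case False
    then show ?thesis by (auto simp: op_def[of j] t_def live_def wt_def)
  qed
  have st: "p ! i = p ! (i - 1) + 1 \<or> p ! i = p ! (i - 1) - 1"
    by (rule paths_step[OF p]) (use i in auto)
  have e: "p ! (i - 1) = p ! (i + 1)" using ci i by (simp add: corner_def)
  have qn: "?q ! k = (if k = i then 2 * p ! (i - 1) - p ! i else p ! k)" for k
    using flip_nth[OF p] i by simp
  have inv: "t u * tile u i = 1"
    if u: "u \<in> paths N" "corner N u i" "live u j" and jN': "j < N" for u
  proof -
    have "\<bar>u ! i\<bar> \<le> int i" by (rule paths_bound[OF u(1)]) (use i in simp)
    moreover have "\<bar>u ! (i - 1)\<bar> \<le> int (i - 1)" by (rule paths_bound[OF u(1)]) (use i in simp)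
    ultimately have nz: "\<psi> (u ! i) \<noteq> 0" "\<psi> (u ! (i - 1)) \<noteq> 0" using psi_nz i by simp_all
    have eu: "u ! (i - 1) = u ! (i + 1)" using u(2) i by (simp add: corner_def)
    show ?thesis
      using j
    proof
      assume ji: "j = i + 1"
      then show ?thesis using u(3) nz eu i jN' by (simp add: t_def wt_def tile_def cf_def)
    next
      assume ij: "i = j + 1"
      show ?thesis
      proof (cases "j = 0")
        case True
        then have "t u = s1" using u(3) by (simp add: t_def wt_def)
        moreover have "tile u i = \<psi> (- 1) / \<psi> 0"
          using True u(3) paths_0[OF u(1)] i ij by (simp add: tile_def cf_def live_def)
        ultimately show ?thesis using psi_0_nz psi_m1_nz by (simp add: s1_eq)
      next
        case False
        then have "u ! (j - 1) = u ! i" using u(3) ij jN' by (simp add: live_def corner_def)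
        then show ?thesis using u(3) False nz i ij jN' by (simp add: t_def wt_def tile_def cf_def)
      qed
    qed
  qed
  have sum1: "t p * tile p i + t ?q * tile ?q i = 1"
  proof (cases "j < N")
    case True
    have ex: "live p j \<noteq> live ?q j"
    proof (cases "j = 0")
      case True
      then have i1: "i = 1" using j by simp
      have "?q ! 1 = 2 * p ! 0 - p ! 1" using qn[of 1] i1 by simp
      moreover have "p ! 1 = 1 \<or> p ! 1 = - 1" using st paths_0[OF p] i1 by auto
      ultimately show ?thesis using True paths_0[OF p] by (auto simp: live_def)
    next
      case j0: False
      show ?thesis
        using j
      proof
        assume ji: "j = i + 1"
        have "p ! (i + 2) = p ! (i + 1) + 1 \<or> p ! (i + 2) = p ! (i + 1) - 1"
          using paths_Suc[OF p, of "i + 1"] True ji by simp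
        then have "p ! i = p ! (i + 2) \<longleftrightarrow> 2 * p ! (i - 1) - p ! i \<noteq> p ! (i + 2)"
          using st e by linarith
        moreover have "live p j \<longleftrightarrow> p ! i = p ! (i + 2)"
          using True ji by (simp add: live_def corner_def)
        moreover have "live ?q j \<longleftrightarrow> 2 * p ! (i - 1) - p ! i = p ! (i + 2)"
          using True ji by (simp add: live_def corner_def qn)
        ultimately show ?thesis by blast
      next
        assume ij: "i = j + 1"
        have "p ! j = p ! (j - 1) + 1 \<or> p ! j = p ! (j - 1) - 1"
          using paths_step[OF p, of j] j0 jN by simp
        then have "p ! (j - 1) = p ! i \<longleftrightarrow> p ! (j - 1) \<noteq> 2 * p ! (i - 1) - p ! i"
          using st ij by simp linarith
        moreover have "live p j \<longleftrightarrow> p ! (j - 1) = p ! i"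
          using True ij j0 by (simp add: live_def corner_def)
        moreover have "live ?q j \<longleftrightarrow> p ! (j - 1) = 2 * p ! (i - 1) - p ! i"
        proof -
          have "?q ! (j - 1) = p ! (j - 1)" "?q ! (j + 1) = 2 * p ! (i - 1) - p ! i"
            using qn[of "j - 1"] qn[of "j + 1"] ij j0 by auto
          then show ?thesis using True j0 by (simp add: live_def corner_def)
        qed
        ultimately show ?thesis by blast
      qed
    qed
    show ?thesis
    proof (cases "live p j")
      case True
      then show ?thesis using inv[OF p ci True \<open>j < N\<close>] ex by (simp add: t_def)
    next
      case False
      then have "live ?q j" using ex by simp
      then show ?thesis using inv[OF q cq _ \<open>j < N\<close>] False by (simp add: t_def)
    qed
  next
    case False
    then have jN: "j = N" "N = i + 1" using i j by auto
    have lv: "live p j" "live ?q j"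
      unfolding jN(1) live_def corner_def using N_pos by simp_all
    have "\<bar>p ! (i - 1)\<bar> \<le> int (i - 1)" by (rule paths_bound[OF p]) (use i in simp)
    then have "\<bar>p ! (i - 1)\<bar> + 1 < int N" using i by linarith
    note kp = kappa_psi_step[OF this st]
    have n: "N \<noteq> 0" "N - 1 = i" "i - 1 \<noteq> i" "N \<noteq> i" using jN i by auto
    have pN: "p ! N = p ! (i - 1)" using e jN by simp
    have q: "?q ! i = 2 * p ! (i - 1) - p ! i" "?q ! (i - 1) = p ! (i - 1)" "?q ! N = p ! (i - 1)"
      unfolding qn using n pN by simp_all
    have t: "t p = \<kappa> (p ! i) (p ! (i - 1))"
      "t ?q = \<kappa> (2 * p ! (i - 1) - p ! i) (p ! (i - 1))"
      using lv n q pN unfolding jN(1) t_def wt_def tile_def cf_def by simp_all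
    have ti: "tile p i = \<psi> (p ! i) / \<psi> (p ! (i - 1))"
      "tile ?q i = \<psi> (2 * p ! (i - 1) - p ! i) / \<psi> (p ! (i - 1))"
      unfolding tile_def cf_def q using i by simp_all
    show ?thesis unfolding t ti using kp by (simp only: mult.commute add.commute)
  qed
  have "op i (op j (op i \<phi>)) p = tile p i * (t p * op i \<phi> p + t ?q * op i \<phi> ?q)"
    using ci i opj[OF p ci] opj[OF q cq] by (simp add: op_def[of i])
  also have "\<dots> = tile p i * ((t p * tile p i + t ?q * tile ?q i) * (\<phi> p + \<phi> ?q))"
    using ci cq i flip_flip[OF p ci] by (simp add: op_def algebra_simps)
  also have "\<dots> = op i \<phi> p" using ci i unfolding sum1 by (simp add: op_def)
  finally show ?thesis .
qed (use i in \<open>simp add: op_def\<close>)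

section \<open>Products of pairwise distant generators\<close>

abbreviation "ops js \<phi> \<equiv> foldr op js \<phi>"

lemma ops_cong:
  assumes "p \<in> paths N" "\<And>q. q \<in> paths N \<Longrightarrow> \<phi> q = \<phi>' q"
  shows "ops js \<phi> p = ops js \<phi>' p"
  using assms(1)
proof (induction js arbitrary: p)
  case (Cons j js)
  show ?case unfolding foldr_Cons o_def by (rule op_cong[OF Cons.prems Cons.IH])
qed (use assms(2) in simp)

lemma ops_linear: "ops js (\<lambda>q. \<Sum>x\<in>S. c x * f x q) p = (\<Sum>x\<in>S. c x * ops js (f x) p)"
proof (induction js arbitrary: p)
  case (Cons j js)
  have "ops js (\<lambda>q. \<Sum>x\<in>S. c x * f x q) = (\<lambda>p. \<Sum>x\<in>S. c x * ops js (f x) p)"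
    using Cons.IH by blast
  then show ?case by (simp add: op_linear)
qed simp

lemma ops_zero: "p \<in> paths N \<Longrightarrow> (\<And>q. q \<in> paths N \<Longrightarrow> \<phi> q = 0) \<Longrightarrow> ops js \<phi> p = 0"
  using ops_cong[of p \<phi> "\<lambda>q. \<Sum>x\<in>{}. 0 * 0" js] ops_linear[of js "\<lambda>_. 0" "\<lambda>_ _. 0" "{}" p]
  by simp

text \<open>On the paths with prescribed heights elsewhere, a product of pairwise distant generators has
  rank one; this is why \<open>I\<^sub>1 I\<^sub>2 I\<^sub>1\<close> is proportional to \<open>I\<^sub>1\<close>.\<close>

fun osum :: "nat list \<Rightarrow> (int list \<Rightarrow> complex) \<Rightarrow> int list \<Rightarrow> complex" where
  "osum [] \<phi> p = \<phi> p"
| "osum (j # js) \<phi> p = (if j = 0 then osum js \<phi> p else osum js \<phi> p + osum js \<phi> (flip p j))"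

definition apart :: "nat list \<Rightarrow> bool" where
  "apart js \<longleftrightarrow> sorted_wrt (\<lambda>i j. i + 2 \<le> j) js \<and> (\<forall>j\<in>set js. j \<le> N)"

lemma apart_Cons: "apart (j # js) \<longleftrightarrow> j \<le> N \<and> (\<forall>i\<in>set js. j + 2 \<le> i) \<and> apart js"
  by (auto simp: apart_def)

text \<open>The other letters flip the path only at distant points, so a row dead for one letter
  stays dead throughout the product.\<close>

lemma ops_not_live:
  assumes "apart js" "p \<in> paths N" "i \<in> set js" "\<not> live p i"
  shows "ops js \<phi> p = 0"
  using assms
proof (induction js arbitrary: p)
  case (Cons j js)
  show ?case
  proof (cases "live p j \<and> i \<noteq> j")
    case True
    then have i: "i \<in> set js" "j + 2 \<le> i" using Cons.prems by (auto simp: apart_Cons)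
    have "ops js \<phi> p = 0" using Cons i by (auto simp: apart_Cons)
    moreover have "ops js \<phi> (flip p j) = 0" if "j \<noteq> 0"
    proof -
      have c: "corner N p j" using True that by (simp add: live_def)
      show ?thesis
        using Cons i live_flip_far[OF Cons.prems(2) c, of i] flip_in_paths[OF Cons.prems(2) c]
        by (auto simp: apart_Cons)
    qed
    ultimately show ?thesis by (simp add: op_def[of j "ops js \<phi>" p])
  qed (use Cons.prems(4) op_not_live in auto)
qed simp

text \<open>No flip changes the weight of a distant letter, so all weights factor out of the sum
  over flips.\<close>

lemma ops_live:
  assumes "apart js" "p \<in> paths N" "\<forall>i\<in>set js. live p i"
  shows "ops js \<phi> p = (\<Prod>i\<leftarrow>js. wt p i) * osum js \<phi> p"
  using assms
proof (induction js arbitrary: p)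
  case (Cons j js)
  have IH: "ops js \<phi> p = (\<Prod>i\<leftarrow>js. wt p i) * osum js \<phi> p"
    using Cons by (auto simp: apart_Cons)
  show ?case
  proof (cases "j = 0")
    case True
    then show ?thesis using Cons.prems IH by (simp add: op_def[of _ "ops js \<phi>" p] live_def wt_def)
  next
    case False
    then have c: "corner N p j" using Cons.prems by (simp add: live_def)
    have far: "j + 2 \<le> i" if "i \<in> set js" for i using Cons.prems(1) that by (simp add: apart_Cons)
    have "ops js \<phi> (flip p j) = (\<Prod>i\<leftarrow>js. wt (flip p j) i) * osum js \<phi> (flip p j)"
      using Cons live_flip_far[OF Cons.prems(2) c] far flip_in_paths[OF Cons.prems(2) c]
      by (auto simp: apart_Cons)
    also have "map (wt (flip p j)) js = map (wt p) js"
      using tile_flip_far[OF Cons.prems(2) c] far by (auto simp: wt_def)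
    finally show ?thesis
      using False c IH by (simp add: op_def[of j "ops js \<phi>" p] wt_def[of p j] algebra_simps)
  qed
qed simp

text \<open>The sum contains both heights at each nonzero point of \<open>js\<close>; where the two
  paths differ, the two summands merely change places.\<close>

lemma osum_cong:
  assumes "apart js" "p \<in> paths N" "q \<in> paths N" "\<forall>i\<in>set js. live p i" "\<forall>i\<in>set js. live q i"
    and "\<And>k. k \<le> N \<Longrightarrow> k \<notin> set js \<Longrightarrow> p ! k = q ! k"
  shows "osum js \<phi> p = osum js \<phi> q"
  using assms
proof (induction js arbitrary: p q)
  case Nil
  then have "p = q" by (intro paths_eqI) auto
  then show ?case by simp
next
  case (Cons j js)
  have jN: "j \<le> N" and aj: "apart js" and far: "\<And>i. i \<in> set js \<Longrightarrow> j + 2 \<le> i"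
    using Cons.prems(1) by (auto simp: apart_Cons)
  have IH: "osum js \<phi> u = osum js \<phi> v"
    if "u \<in> paths N" "v \<in> paths N" "\<forall>i\<in>set js. live u i" "\<forall>i\<in>set js. live v i"
      "\<And>k. k \<le> N \<Longrightarrow> k \<notin> set js \<Longrightarrow> u ! k = v ! k" for u v
    using Cons.IH[OF aj that] .
  have off: "p ! k = q ! k" if "k \<le> N" "k \<notin> set js" "k \<noteq> j" for k
    using Cons.prems(6) that by simp
  show ?case
  proof (cases "j = 0")
    case True
    have "osum js \<phi> p = osum js \<phi> q"
    proof (rule IH)
      fix k assume k: "k \<le> N" "k \<notin> set js"
      show "p ! k = q ! k"
      proof (cases "k = 0")
        case True
        then show ?thesis using paths_0 Cons.prems(2,3) by auto
      qed (use off[OF k] True in simp)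
    qed (use Cons.prems in auto)
    then show ?thesis using True by simp
  next
    case False
    then have c: "corner N p j" "corner N q j" using Cons.prems(4,5) by (auto simp: live_def)
    have fp: "flip p j \<in> paths N" "flip q j \<in> paths N" using flip_in_paths Cons.prems(2,3) c by auto
    have lv: "\<forall>i\<in>set js. live p i" "\<forall>i\<in>set js. live q i"
      "\<forall>i\<in>set js. live (flip p j) i" "\<forall>i\<in>set js. live (flip q j) i"
      using Cons.prems(4,5) live_flip_far[OF Cons.prems(2) c(1)] live_flip_far[OF Cons.prems(3) c(2)] far
      by auto
    have jm: "p ! (j - 1) = q ! (j - 1)"
    proof (rule off)
      show "j - 1 \<notin> set js"
      proof
        assume "j - 1 \<in> set js"
        from far[OF this] show False by simp
      qed
    qed (use jN False in auto)
    have st: "p ! j = p ! (j - 1) + 1 \<or> p ! j = p ! (j - 1) - 1"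
      "q ! j = q ! (j - 1) + 1 \<or> q ! j = q ! (j - 1) - 1"
      using paths_step[OF Cons.prems(2)] paths_step[OF Cons.prems(3)] jN False by auto
    note pn = flip_nth[OF Cons.prems(2) jN] and qn = flip_nth[OF Cons.prems(3) jN]
    show ?thesis
    proof (cases "p ! j = q ! j")
      case True
      have "osum js \<phi> p = osum js \<phi> q"
        by (rule IH[OF Cons.prems(2,3) lv(1,2)]) (use off True in blast)
      moreover have "osum js \<phi> (flip p j) = osum js \<phi> (flip q j)"
        by (rule IH[OF fp lv(3,4)]) (use off True jm in \<open>auto simp: pn qn\<close>)
      ultimately show ?thesis using False by simp
    next
      case ne: False
      then have x: "2 * p ! (j - 1) - p ! j = q ! j" "p ! j = 2 * q ! (j - 1) - q ! j"
        using st jm by linarith+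
      have "osum js \<phi> p = osum js \<phi> (flip q j)"
      proof (rule IH[OF Cons.prems(2) fp(2) lv(1,4)])
        fix k assume "k \<le> N" "k \<notin> set js"
        then show "p ! k = flip q j ! k" using off[of k] x(2) by (cases "k = j") (simp_all add: qn)
      qed
      moreover have "osum js \<phi> (flip p j) = osum js \<phi> q"
      proof (rule IH[OF fp(1) Cons.prems(3) lv(3,2)])
        fix k assume "k \<le> N" "k \<notin> set js"
        then show "flip p j ! k = q ! k" using off[of k] x(1) by (cases "k = j") (simp_all add: pn)
      qed
      ultimately show ?thesis using False by simp
    qed
  qed
qed

text \<open>Each flip moves a height at a point of \<open>js\<close> away from that of
  \<open>p\<close>, and the later letters cannot restore it, so only the unflipped term
  survives.\<close>

lemma osum_collapse:
  assumes "apart js" "p \<in> paths N" "\<forall>i\<in>set js. live p i"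
    and "\<And>q j. q \<in> paths N \<Longrightarrow> j \<in> set js \<Longrightarrow> q ! j \<noteq> p ! j \<Longrightarrow> \<phi> q = 0"
  shows "osum js \<phi> p = \<phi> p"
proof -
  have zero: "osum ks \<phi> u = 0"
    if "apart ks" "u \<in> paths N" "\<forall>i\<in>set ks. live u i" "j \<in> set js" "j \<notin> set ks" "u ! j \<noteq> p ! j"
    for ks u j
    using that
  proof (induction ks arbitrary: u)
    case (Cons k ks)
    have a: "osum ks \<phi> u = 0" using Cons by (auto simp: apart_Cons)
    show ?case
    proof (cases "k = 0")
      case False
      then have c: "corner N u k" using Cons.prems by (simp add: live_def)
      have "flip u k ! j = u ! j"
        using flip_nth[OF Cons.prems(2), of k j] Cons.prems(1,5) by (auto simp: apart_Cons)
      then have "osum ks \<phi> (flip u k) = 0"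
        using Cons live_flip_far[OF Cons.prems(2) c] flip_in_paths[OF Cons.prems(2) c]
        by (auto simp: apart_Cons)
      then show ?thesis using a by simp
    qed (use a in simp)
  qed (use assms(4) in auto)
  have "osum ks \<phi> p = \<phi> p" if "apart ks" "set ks \<subseteq> set js" for ks
    using that
  proof (induction ks)
    case (Cons k ks)
    have kN: "k \<le> N" and ak: "apart ks" and far: "\<And>i. i \<in> set ks \<Longrightarrow> k + 2 \<le> i"
      using Cons.prems(1) by (auto simp: apart_Cons)
    show ?case
    proof (cases "k = 0")
      case False
      then have c: "corner N p k" using Cons.prems assms(3) by (auto simp: live_def)
      have "osum ks \<phi> (flip p k) = 0"
      proof (rule zero[OF ak])
        show "flip p k \<in> paths N" by (rule flip_in_paths[OF assms(2) c])
        show "\<forall>i\<in>set ks. live (flip p k) i"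
          using live_flip_far[OF assms(2) c] far assms(3) Cons.prems(2) by auto
        show "k \<in> set js" using Cons.prems by simp
        show "k \<notin> set ks" using far by force
        show "flip p k ! k \<noteq> p ! k"
          unfolding flip_values(1)[OF assms(2) c]
          using paths_step[OF assms(2), of k] kN False by auto
      qed
      then show ?thesis using False Cons.IH[OF ak] Cons.prems by simp
    qed (use Cons.IH[OF ak] Cons.prems in simp)
  qed simp
  then show ?thesis using assms(1) by blast
qed

definition odds :: "nat list" where "odds = filter odd [0..<N + 1]"
definition evens :: "nat list" where "evens = filter even [0..<N + 1]"

lemma set_odds: "set odds = {i. i \<le> N \<and> odd i}" and set_evens: "set evens = {i. i \<le> N \<and> even i}"
  by (auto simp: odds_def evens_def simp del: upt_Suc)

lemma apart_filter:
  assumes "\<And>i j. i < j \<Longrightarrow> P i \<Longrightarrow> P j \<Longrightarrow> i + 2 \<le> j"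
  shows "apart (filter P [0..<N + 1])"
proof -
  have "sorted_wrt (\<lambda>i j. i + 2 \<le> j) (filter P [0..<N + 1])"
    by (rule sorted_wrt_mono_rel[OF _ sorted_wrt_filter[OF sorted_wrt_upt]])
      (use assms in \<open>auto simp del: upt_Suc\<close>)
  then show ?thesis by (auto simp: apart_def)
qed

lemma apart_odds: "apart odds" and apart_evens: "apart evens"
proof -
  show "apart odds" unfolding odds_def by (rule apart_filter) presburger
  show "apart evens" unfolding evens_def by (rule apart_filter) presburger
qed

text \<open>Corners at all odd points carry the initial height 0 to every even point.\<close>

lemma live_odds:
  assumes p: "p \<in> paths N"
  shows "(\<forall>i\<in>set odds. live p i) \<longleftrightarrow> (\<forall>k\<in>set evens. p ! k = fund_path N ! k)"
proof
  assume L: "\<forall>i\<in>set odds. live p i"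
  have "k \<le> N \<Longrightarrow> even k \<Longrightarrow> p ! k = 0" for k
  proof (induction k rule: induct_nat_012)
    case (ge2 n)
    then have "live p (Suc n)" using L by (auto simp: set_odds)
    then have "p ! n = p ! Suc (Suc n)" using ge2.prems by (simp add: live_def corner_def)
    then show ?case using ge2 by simp
  qed (use paths_0[OF p] in auto)
  then show "\<forall>k\<in>set evens. p ! k = fund_path N ! k" by (auto simp: set_evens fund_path_nth)
next
  assume E: "\<forall>k\<in>set evens. p ! k = fund_path N ! k"
  have z: "p ! k = 0" if "k \<le> N" "even k" for k
    using E that by (auto simp: set_evens fund_path_nth)
  show "\<forall>i\<in>set odds. live p i"
    using z by (auto simp: set_odds live_def corner_def)
qed

text \<open>The condition at e_0 provides the height -1 at point 1, and the corners at the positive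
  even points carry it on.\<close>

lemma live_evens:
  assumes p: "p \<in> paths N"
  shows "(\<forall>i\<in>set evens. live p i) \<longleftrightarrow> (\<forall>k\<in>set odds. p ! k = fund_path N ! k)"
proof
  assume L: "\<forall>i\<in>set evens. live p i"
  have "k \<le> N \<Longrightarrow> odd k \<Longrightarrow> p ! k = - 1" for k
  proof (induction k rule: induct_nat_012)
    case 1
    have "live p 0" using L by (auto simp: set_evens)
    then show ?case by (simp add: live_def)
  next
    case (ge2 n)
    then have "live p (Suc n)" using L by (auto simp: set_evens)
    then have "p ! n = p ! Suc (Suc n)" using ge2.prems by (simp add: live_def corner_def)
    then show ?case using ge2 by simp
  qed simp
  then show "\<forall>k\<in>set odds. p ! k = fund_path N ! k" by (auto simp: set_odds fund_path_nth)
next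
  assume O: "\<forall>k\<in>set odds. p ! k = fund_path N ! k"
  have m: "p ! k = - 1" if "k \<le> N" "odd k" for k
    using O that by (auto simp: set_odds fund_path_nth)
  show "\<forall>i\<in>set evens. live p i"
    using m N_pos by (auto simp: set_evens live_def corner_def)
qed

text \<open>A row is live for all of \<open>I\<close> exactly when its heights on \<open>J\<close>
  are those of p_0, and conversely. Hence both inner sums of the triple product collapse to the
  fundamental path, and the product of its weights comes out as the scalar.\<close>

lemma ops_rank_one:
  assumes aI: "apart I" and aJ: "apart J"
    and lI: "\<And>p. p \<in> paths N \<Longrightarrow> (\<forall>i\<in>set I. live p i) \<longleftrightarrow> (\<forall>k\<in>set J. p ! k = fund_path N ! k)"
    and lJ: "\<And>p. p \<in> paths N \<Longrightarrow> (\<forall>i\<in>set J. live p i) \<longleftrightarrow> (\<forall>k\<in>set I. p ! k = fund_path N ! k)"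
    and IJ: "set I \<union> set J = {0..N}"
    and p: "p \<in> paths N"
  shows "ops I (ops J (ops I \<phi>)) p =
    (\<Prod>i\<leftarrow>I. wt (fund_path N) i) * (\<Prod>i\<leftarrow>J. wt (fund_path N) i) * ops I \<phi> p"
proof (cases "\<forall>i\<in>set I. live p i")
  case True
  let ?f = "fund_path N"
  note f = fund_path_in_paths[of N]
  have lf: "\<forall>i\<in>set I. live ?f i" "\<forall>i\<in>set J. live ?f i" using lI[OF f] lJ[OF f] by blast+
  have agree: "p ! k = ?f ! k" if "k \<le> N" "k \<notin> set I" for k
  proof -
    have "k \<in> set I \<union> set J" using that(1) unfolding IJ by simp
    then have "k \<in> set J" using that(2) by blast
    then show ?thesis using lI[OF p] True by blast
  qed
  have S: "osum I \<chi> p = osum I \<chi> ?f" for \<chi>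
    by (rule osum_cong[OF aI p f True lf(1) agree])
  have c1: "osum J (ops I \<phi>) ?f = ops I \<phi> ?f"
  proof (rule osum_collapse[OF aJ f lf(2)])
    fix q j assume q: "q \<in> paths N" "j \<in> set J" "q ! j \<noteq> ?f ! j"
    then obtain i where "i \<in> set I" "\<not> live q i" using lI[OF q(1)] q(2,3) by blast
    then show "ops I \<phi> q = 0" using ops_not_live[OF aI q(1)] by blast
  qed
  have c2: "osum I (ops J (ops I \<phi>)) ?f = ops J (ops I \<phi>) ?f"
  proof (rule osum_collapse[OF aI f lf(1)])
    fix q j assume q: "q \<in> paths N" "j \<in> set I" "q ! j \<noteq> ?f ! j"
    then obtain i where "i \<in> set J" "\<not> live q i" using lJ[OF q(1)] q(2,3) by blast
    then show "ops J (ops I \<phi>) q = 0" using ops_not_live[OF aJ q(1)] by blast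
  qed
  have "ops I (ops J (ops I \<phi>)) p = (\<Prod>i\<leftarrow>I. wt p i) * ops J (ops I \<phi>) ?f"
    unfolding ops_live[OF aI p True] S c2 ..
  also have "ops J (ops I \<phi>) ?f = (\<Prod>i\<leftarrow>J. wt ?f i) * ops I \<phi> ?f"
    unfolding ops_live[OF aJ f lf(2)] c1 ..
  also have "ops I \<phi> ?f = (\<Prod>i\<leftarrow>I. wt ?f i) * osum I \<phi> p"
    unfolding ops_live[OF aI f lf(1)] S ..
  finally show ?thesis unfolding ops_live[OF aI p True, of \<phi>] by (simp only: mult_ac)
next
  case False
  then obtain i where "i \<in> set I" "\<not> live p i" by blast
  then show ?thesis unfolding ops_not_live[OF aI p \<open>i \<in> set I\<close> \<open>\<not> live p i\<close>] by simp
qed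

lemma prod_list_filter_not:
  fixes f :: "'b \<Rightarrow> 'c::comm_monoid_mult"
  shows "(\<Prod>x\<leftarrow>filter P xs. f x) * (\<Prod>x\<leftarrow>filter (\<lambda>x. \<not> P x) xs. f x) = (\<Prod>x\<leftarrow>xs. f x)"
  by (induction xs) (auto simp: mult_ac)

text \<open>All weights before the last alternate between s1 and 1/s1, and the last is
  \<open>b\<close> or \<open>b / s1\<close> according to parity; this is the reason for the form of
  \<open>b_eq\<close>.\<close>

lemma wt_fund_prod:
  "(\<Prod>i\<leftarrow>odds. wt (fund_path N) i) * (\<Prod>i\<leftarrow>evens. wt (fund_path N) i) = b"
proof -
  have fwp: "(\<Prod>i\<leftarrow>[0..<n]. fw i) = (if even n then 1 else s1)" for n
    by (induction n) (auto simp: fw_def s1_nz)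
  have "(\<Prod>i\<leftarrow>odds. wt (fund_path N) i) * (\<Prod>i\<leftarrow>evens. wt (fund_path N) i) =
    (\<Prod>i\<leftarrow>[0..<N + 1]. wt (fund_path N) i)"
    using prod_list_filter_not[of "wt (fund_path N)" odd "[0..<N + 1]"]
    by (simp add: odds_def evens_def)
  also have "\<dots> = (\<Prod>i\<leftarrow>[0..<N]. wt (fund_path N) i) * wt (fund_path N) N"
    by simp
  also have "map (wt (fund_path N)) [0..<N] = map fw [0..<N]"
    using tile_fund by (auto simp: wt_def fw_def)
  also have "(\<Prod>i\<leftarrow>[0..<N]. fw i) = (if even N then 1 else s1)" by (rule fwp)
  also have "wt (fund_path N) N = (if even N then b else b / s1)"
    using tile_fund[of N] N_pos by (simp add: wt_def)
  finally show ?thesis using s1_nz by simp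
qed

lemma ops_I_rel:
  assumes "p \<in> paths N"
  shows "ops odds (ops evens (ops odds \<phi>)) p = b * ops odds \<phi> p"
    and "ops evens (ops odds (ops evens \<phi>)) p = b * ops evens \<phi> p"
proof -
  have IJ: "set odds \<union> set evens = {0..N}" by (auto simp: set_odds set_evens)
  show "ops odds (ops evens (ops odds \<phi>)) p = b * ops odds \<phi> p"
    using ops_rank_one[OF apart_odds apart_evens live_odds live_evens IJ assms] wt_fund_prod by simp
  show "ops evens (ops odds (ops evens \<phi>)) p = b * ops evens \<phi> p"
    using ops_rank_one[OF apart_evens apart_odds live_evens live_odds _ assms] IJ wt_fund_prod
    by (simp add: mult.commute Un_commute)
qed

end

section \<open>The free algebra and its action on path functions\<close>

lemma qnum_minus: "qnum \<eta> (- x) = - qnum \<eta> x"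
  by (simp add: qnum_def minus_divide_left)

text \<open>Normalised so that [x][y] is the difference of its values at x + y and x - y, with no
  constant.\<close>

definition qcosh :: "complex \<Rightarrow> complex \<Rightarrow> complex" where
  "qcosh \<eta> x = (qpow \<eta> x + qpow \<eta> (- x)) / (qpow \<eta> 1 - qpow \<eta> (- 1)) ^ 2"

lemma qcosh_minus: "qcosh \<eta> (- x) = qcosh \<eta> x"
  by (simp add: qcosh_def add.commute)

lemma qpow_add: "qpow \<eta> (x + y) = qpow \<eta> x * qpow \<eta> y"
  by (simp add: qpow_def exp_add[symmetric] algebra_simps)

lemma qnum_mult: "qnum \<eta> x * qnum \<eta> y = qcosh \<eta> (x + y) - qcosh \<eta> (x - y)"
proof -
  let ?q = "qpow \<eta>"
  have "?q (- (x + y)) = ?q (- x) * ?q (- y)" "?q (x - y) = ?q x * ?q (- y)"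
    "?q (- (x - y)) = ?q (- x) * ?q y"
    using qpow_add[of \<eta> "- x" "- y"] qpow_add[of \<eta> x "- y"] qpow_add[of \<eta> "- x" y] by simp_all
  then show ?thesis
    by (simp add: qnum_def qcosh_def qpow_add power2_eq_square diff_divide_distrib[symmetric] algebra_simps)
qed

lemma qnum_rec:
  assumes "qpow \<eta> 1 \<noteq> qpow \<eta> (- 1)"
  shows "qnum \<eta> (x + 1) + qnum \<eta> (x - 1) = qnum \<eta> 2 * qnum \<eta> x"
proof -
  let ?q = "qpow \<eta>"
  have "?q 2 = ?q 1 * ?q 1" "?q (- 2) = ?q (- 1) * ?q (- 1)"
    using qpow_add[of \<eta> 1 1] qpow_add[of \<eta> "- 1" "- 1"] by simp_all
  then have "?q 2 - ?q (- 2) = (?q 1 + ?q (- 1)) * (?q 1 - ?q (- 1))"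
    by (simp add: algebra_simps)
  then have two: "qnum \<eta> 2 = ?q 1 + ?q (- 1)"
    using assms by (simp add: qnum_def)
  have "?q (- (x + 1)) = ?q (- x) * ?q (- 1)" "?q (x - 1) = ?q x * ?q (- 1)"
    "?q (- (x - 1)) = ?q (- x) * ?q 1"
    using qpow_add[of \<eta> "- x" "- 1"] qpow_add[of \<eta> x "- 1"] qpow_add[of \<eta> "- x" 1] by simp_all
  then show ?thesis
    unfolding two by (simp add: qnum_def qpow_add add_divide_distrib[symmetric] algebra_simps)
qed

section \<open>Constants, words and reversal in the free algebra\<close>

lemma fralg_decomp:
  fixes f :: fralg
  shows "f = (\<Sum>w\<in>Poly_Mapping.keys f. Poly_Mapping.single w (Poly_Mapping.lookup f w))"
proof (rule poly_mapping_eqI)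
  fix v
  have "(\<Sum>w\<in>Poly_Mapping.keys f. (Poly_Mapping.lookup f w when w = v)) =
    (if v \<in> Poly_Mapping.keys f then Poly_Mapping.lookup f v else 0)"
    by (simp add: when_def)
  then show "Poly_Mapping.lookup f v = Poly_Mapping.lookup
     (\<Sum>w\<in>Poly_Mapping.keys f. Poly_Mapping.single w (Poly_Mapping.lookup f w)) v"
    by (simp add: lookup_sum lookup_single in_keys_iff)
qed

lemma fralg_mult:
  fixes f g :: fralg
  shows "f * g = (\<Sum>v\<in>Poly_Mapping.keys f. \<Sum>w\<in>Poly_Mapping.keys g.
    Poly_Mapping.single (v + w) (Poly_Mapping.lookup f v * Poly_Mapping.lookup g w))"
  by (subst fralg_decomp[of f], subst fralg_decomp[of g])
    (simp add: sum_product mult_single)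

lemma fconst_mult: "fconst c * fconst d = fconst (c * d)"
  by (simp add: fconst_def mult_single)

lemma fconst_add: "fconst (c + d) = fconst c + fconst d"
  by (simp add: fconst_def single_add)

lemma fconst_1: "fconst 1 = 1"
  by (simp add: fconst_def)

lemma fconst_central: "fconst c * f = f * fconst c"
  unfolding fconst_def
  by (subst (1 2) fralg_decomp[of f]) (simp add: sum_distrib_left sum_distrib_right mult_single mult.commute)

lemma frev_add: "frev (f + g) = frev f + frev g"
  by (rule poly_mapping_eqI) (simp add: lookup_frev lookup_add)

lemma frev_sum: "frev (\<Sum>x\<in>S. f x) = (\<Sum>x\<in>S. frev (f x))"
  by (rule poly_mapping_eqI) (simp add: lookup_frev lookup_sum)

lemma word_rev_word_rev [simp]: "word_rev (word_rev w) = w"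
  by (simp add: word_rev_def)

lemma frev_single: "frev (Poly_Mapping.single w c) = Poly_Mapping.single (word_rev w) c"
  by (rule poly_mapping_eqI) (auto simp: lookup_frev lookup_single when_def)

lemma word_rev_plus: "word_rev (v + w) = word_rev w + word_rev v"
  by (simp add: word_rev_def plus_gword_def)

lemma frev_mult: "frev (f * g) = frev g * frev f"
proof -
  have f: "frev h = (\<Sum>w\<in>Poly_Mapping.keys h. Poly_Mapping.single (word_rev w) (Poly_Mapping.lookup h w))" for h
    by (subst fralg_decomp[of h]) (simp add: frev_sum frev_single)
  have "frev (f * g) = (\<Sum>v\<in>Poly_Mapping.keys f. \<Sum>w\<in>Poly_Mapping.keys g.
    Poly_Mapping.single (word_rev w + word_rev v) (Poly_Mapping.lookup g w * Poly_Mapping.lookup f v))"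
    by (simp add: fralg_mult frev_sum frev_single word_rev_plus mult.commute)
  also have "\<dots> = frev g * frev f"
    unfolding f by (subst sum.swap) (simp add: sum_product mult_single)
  finally show ?thesis .
qed

lemma frev_frev [simp]: "frev (frev f) = f"
  by (rule poly_mapping_eqI) (simp add: lookup_frev)

lemma frev_minus: "frev (- f) = - frev f"
  by (rule poly_mapping_eqI) (simp add: lookup_frev)

lemma frev_diff: "frev (f - g) = frev f - frev g"
  by (rule poly_mapping_eqI) (simp add: lookup_frev lookup_minus)

lemma frev_0: "frev 0 = 0"
  by (rule poly_mapping_eqI) (simp add: lookup_frev)

lemma frev_fconst: "frev (fconst c) = fconst c"
  by (simp add: fconst_def frev_single word_rev_def zero_gword_def)

lemma frev_fgen: "frev (fgen i) = fgen i"
  by (simp add: fgen_def frev_single word_rev_def)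

definition fword :: "nat list \<Rightarrow> fralg" where
  "fword js = prod_list (map fgen js)"

lemma fword_simps: "fword [] = 1" "fword (j # js) = fgen j * fword js"
  "fword (is @ js) = fword is * fword js"
  by (simp_all add: fword_def)

lemma frev_fword: "frev (fword js) = fword (rev js)"
  by (induction js) (simp_all add: fword_simps frev_mult frev_fgen frev_fconst[of 1, unfolded fconst_1])

context
  fixes N :: nat
begin

interpretation F: ring "free_alg N" by (rule ring_free_alg)

lemma free_alg_simps [simp]:
  "x \<otimes>\<^bsub>free_alg N\<^esub> y = x * y" "x \<oplus>\<^bsub>free_alg N\<^esub> y = x + y"
  "\<one>\<^bsub>free_alg N\<^esub> = 1" "\<zero>\<^bsub>free_alg N\<^esub> = 0"
  by (simp_all add: free_alg_def)

lemma carrier_closed: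
  "1 \<in> carrier (free_alg N)" "0 \<in> carrier (free_alg N)"
  "x \<in> carrier (free_alg N) \<Longrightarrow> y \<in> carrier (free_alg N) \<Longrightarrow> x + y \<in> carrier (free_alg N)"
  "x \<in> carrier (free_alg N) \<Longrightarrow> y \<in> carrier (free_alg N) \<Longrightarrow> x * y \<in> carrier (free_alg N)"
  using F.one_closed F.zero_closed F.a_closed F.m_closed by simp_all

lemma carrier_uminus: "x \<in> carrier (free_alg N) \<Longrightarrow> - x \<in> carrier (free_alg N)"
  by (simp add: free_alg_def)

lemma carrier_diff:
  "x \<in> carrier (free_alg N) \<Longrightarrow> y \<in> carrier (free_alg N) \<Longrightarrow> x - y \<in> carrier (free_alg N)"
  using carrier_closed(3) carrier_uminus by (metis diff_conv_add_uminus)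

lemma carrier_fgen: "i \<le> N \<Longrightarrow> fgen i \<in> carrier (free_alg N)"
  by (simp add: free_alg_def fgen_def)

lemma carrier_fconst: "fconst c \<in> carrier (free_alg N)"
  by (auto simp: free_alg_def fconst_def zero_gword_def split: if_splits)

lemma carrier_fword: "(\<forall>j\<in>set js. j \<le> N) \<Longrightarrow> fword js \<in> carrier (free_alg N)"
  by (induction js) (simp_all add: fword_simps carrier_closed carrier_fgen)

lemma carrier_frev: "f \<in> carrier (free_alg N) \<Longrightarrow> frev f \<in> carrier (free_alg N)"
proof -
  assume f: "f \<in> carrier (free_alg N)"
  have "set (letters w) \<subseteq> {0..N}" if "w \<in> Poly_Mapping.keys (frev f)" for w
  proof -
    have "word_rev w \<in> Poly_Mapping.keys f" using that by (simp add: in_keys_iff lookup_frev)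
    then have "set (letters (word_rev w)) \<subseteq> {0..N}" using f by (simp add: free_alg_def)
    then show ?thesis by (simp add: word_rev_def)
  qed
  then show ?thesis by (simp add: free_alg_def)
qed

lemma a_inv_free_alg: "x \<in> carrier (free_alg N) \<Longrightarrow> \<ominus>\<^bsub>free_alg N\<^esub> x = - x"
  by (rule F.minus_equality) (simp_all add: carrier_uminus)

lemma ideal_free_algI:
  assumes "K \<subseteq> carrier (free_alg N)" "0 \<in> K" "\<And>x y. x \<in> K \<Longrightarrow> y \<in> K \<Longrightarrow> x + y \<in> K"
    "\<And>x. x \<in> K \<Longrightarrow> - x \<in> K"
    "\<And>x y. x \<in> K \<Longrightarrow> y \<in> carrier (free_alg N) \<Longrightarrow> y * x \<in> K"
    "\<And>x y. x \<in> K \<Longrightarrow> y \<in> carrier (free_alg N) \<Longrightarrow> x * y \<in> K"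
  shows "ideal K (free_alg N)"
proof (rule idealI[OF ring_free_alg])
  show "subgroup K (add_monoid (free_alg N))"
  proof (rule F.add.subgroupI)
    show "\<ominus>\<^bsub>free_alg N\<^esub> a \<in> K" if "a \<in> K" for a
      using a_inv_free_alg[of a] assms(1,4) that by auto
  qed (use assms in auto)
qed (use assms in auto)

end

section \<open>Action of the free algebra on path functions\<close>

context sos_weights
begin

definition ract :: "fralg \<Rightarrow> (int list \<Rightarrow> complex) \<Rightarrow> int list \<Rightarrow> complex" where
  "ract f \<phi> p = (\<Sum>w\<in>Poly_Mapping.keys f. Poly_Mapping.lookup f w * ops (letters w) \<phi> p)"

lemma ract_superset:
  assumes "finite S" "Poly_Mapping.keys f \<subseteq> S"
  shows "ract f \<phi> p = (\<Sum>w\<in>S. Poly_Mapping.lookup f w * ops (letters w) \<phi> p)"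
  unfolding ract_def by (rule sum.mono_neutral_left) (use assms in \<open>auto simp: in_keys_iff\<close>)

lemma ract_add: "ract (f + g) \<phi> p = ract f \<phi> p + ract g \<phi> p"
proof -
  let ?S = "Poly_Mapping.keys f \<union> Poly_Mapping.keys g"
  have "Poly_Mapping.keys (f + g) \<subseteq> ?S" by (rule Poly_Mapping.keys_add)
  then show ?thesis
    using ract_superset[of ?S "f + g"] ract_superset[of ?S f] ract_superset[of ?S g]
    by (simp add: lookup_add algebra_simps sum.distrib)
qed

lemma ract_single: "ract (Poly_Mapping.single w c) \<phi> p = c * ops (letters w) \<phi> p"
  using ract_superset[of "{w}" "Poly_Mapping.single w c"] by simp

lemma ract_0: "ract 0 \<phi> p = 0"
  by (simp add: ract_def)

lemma ract_sum: "ract (\<Sum>x\<in>S. f x) \<phi> p = (\<Sum>x\<in>S. ract (f x) \<phi> p)"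
  by (induction S rule: infinite_finite_induct) (simp_all add: ract_0 ract_add)

lemma ract_uminus: "ract (- f) \<phi> p = - ract f \<phi> p"
  using ract_add[of f "- f" \<phi> p] by (simp add: ract_0 add_eq_0_iff2)

lemma ract_diff: "ract (f - g) \<phi> p = ract f \<phi> p - ract g \<phi> p"
  using ract_add[of f "- g" \<phi> p] by (simp add: ract_uminus)

lemma ract_mult: "ract (f * g) \<phi> p = ract f (ract g \<phi>) p"
proof -
  have "ract (f * g) \<phi> p = (\<Sum>v\<in>Poly_Mapping.keys f. \<Sum>w\<in>Poly_Mapping.keys g.
     Poly_Mapping.lookup f v * Poly_Mapping.lookup g w * ops (letters v) (ops (letters w) \<phi>) p)"
    by (simp add: fralg_mult ract_sum ract_single plus_gword_def)
  also have "\<dots> = (\<Sum>v\<in>Poly_Mapping.keys f. Poly_Mapping.lookup f v * ops (letters v) (ract g \<phi>) p)"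
  proof (rule sum.cong[OF refl])
    fix v
    have "ops (letters v) (ract g \<phi>) p =
      (\<Sum>w\<in>Poly_Mapping.keys g. Poly_Mapping.lookup g w * ops (letters v) (ops (letters w) \<phi>) p)"
      unfolding ract_def[abs_def] by (rule ops_linear)
    then show "(\<Sum>w\<in>Poly_Mapping.keys g.
        Poly_Mapping.lookup f v * Poly_Mapping.lookup g w * ops (letters v) (ops (letters w) \<phi>) p) =
      Poly_Mapping.lookup f v * ops (letters v) (ract g \<phi>) p"
      by (simp add: sum_distrib_left mult.assoc)
  qed
  finally show ?thesis by (simp add: ract_def)
qed

lemma ract_mult': "ract (f * g) \<phi> = ract f (ract g \<phi>)"
  by (rule ext) (rule ract_mult)

lemma ract_fgen: "ract (fgen i) \<phi> p = op i \<phi> p"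
  by (simp add: fgen_def ract_single)

lemma ract_fconst: "ract (fconst c) \<phi> p = c * \<phi> p"
  by (simp add: fconst_def ract_single zero_gword_def)

lemma ract_fgen': "ract (fgen i) \<phi> = op i \<phi>"
  by (rule ext) (rule ract_fgen)

lemma ract_fword: "ract (fword js) \<phi> = ops js \<phi>"
proof (induction js)
  case Nil
  show ?case by (rule ext) (simp add: fword_simps ract_fconst[of 1, unfolded fconst_1])
next
  case (Cons j js)
  show ?case by (rule ext) (simp add: fword_simps ract_mult ract_fgen Cons)
qed

lemma ract_zero:
  "p \<in> paths N \<Longrightarrow> (\<And>q. q \<in> paths N \<Longrightarrow> \<phi> q = 0) \<Longrightarrow> ract f \<phi> p = 0"
  by (simp add: ract_def ops_zero)

text \<open>The device by which the representation descends to the quotient: as soon as the relators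
  lie in this ideal, so does \<open>relideal\<close>.\<close>

lemma ideal_annihilator:
  "ideal {f \<in> carrier (free_alg N). \<forall>\<phi>. \<forall>p\<in>paths N. ract f \<phi> p = 0} (free_alg N)"
  by (rule ideal_free_algI)
    (auto simp: carrier_closed carrier_uminus ract_0 ract_add ract_uminus ract_mult intro: ract_zero)

text \<open>Representatives of the E_i in the free algebra, where the action is defined.\<close>

primrec fE :: "nat \<Rightarrow> fralg" where
  "fE 0 = 1"
| "fE (Suc i) = fconst (1 / fw i) * (fE i * (fgen i * fE i))"

lemma carrier_fE: "i \<le> N \<Longrightarrow> fE i \<in> carrier (free_alg N)"
  by (induction i) (simp_all add: carrier_closed carrier_fconst carrier_fgen)

text \<open>The factor e_i gives zero at a path with a wrong next height. At the others its diagonal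
  entry is \<open>fw i\<close>, and the off-diagonal term is cut off because the flipped path
  deviates at \<open>i\<close>.\<close>

lemma ract_fE:
  "i \<le> N \<Longrightarrow> p \<in> paths N \<Longrightarrow>
    ract (fE i) \<phi> p = (if \<forall>j\<le>i. p ! j = fund_path N ! j then \<phi> p else 0)"
proof (induction i arbitrary: p \<phi>)
  case 0
  then show ?case using paths_0[of p] by (simp add: ract_fconst[of 1, unfolded fconst_1] fund_path_nth)
next
  case (Suc i)
  let ?agr = "\<lambda>p i. \<forall>j\<le>i. p ! j = fund_path N ! j"
  have iN: "i < N" using Suc.prems by simp
  have IH: "ract (fE i) \<chi> q = (if ?agr q i then \<chi> q else 0)" if "q \<in> paths N" for \<chi> q
    using Suc.IH iN that by simp
  have agrS: "?agr p (Suc i) \<longleftrightarrow> ?agr p i \<and> p ! Suc i = fund_path N ! Suc i"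
    by (auto simp: le_Suc_eq)
  have E: "ract (fE (Suc i)) \<phi> p = 1 / fw i * ract (fE i) (op i (ract (fE i) \<phi>)) p"
    by (simp add: ract_mult' ract_fconst ract_fgen')
  show ?case
  proof (cases "?agr p i")
    case False
    then have "\<not> ?agr p (Suc i)" using agrS by blast
    then show ?thesis unfolding E IH[OF Suc.prems(2)] if_not_P[OF False] if_not_P[OF \<open>\<not> ?agr p (Suc i)\<close>] by simp
  next
    case agr: True
    have Ep: "ract (fE i) \<phi> p = \<phi> p" unfolding IH[OF Suc.prems(2)] if_P[OF agr] ..
    have E': "ract (fE (Suc i)) \<phi> p = 1 / fw i * op i (ract (fE i) \<phi>) p"
      unfolding E IH[OF Suc.prems(2)] if_P[OF agr] ..
    have fS: "fund_path N ! Suc i = (if even i then - 1 else 0)"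
      using fund_path_nth[of "Suc i" N] iN by simp
    have agrS': "?agr p (Suc i) \<longleftrightarrow> live p i"
    proof (cases "i = 0")
      case True
      then show ?thesis using agrS agr fS by (simp add: live_def)
    next
      case False
      have "p ! (i - 1) = fund_path N ! (i - 1)" using agr by simp
      also have "\<dots> = fund_path N ! Suc i"
        using fund_path_nth[of "i - 1" N] fS iN False by simp
      finally have d: "p ! (i - 1) = fund_path N ! Suc i" .
      have "live p i \<longleftrightarrow> p ! (i - 1) = p ! Suc i"
        using False iN by (simp add: live_def corner_def)
      then show ?thesis unfolding d agrS using agr by metis
    qed
    show ?thesis
    proof (cases "live p i")
      case False
      then have n: "\<not> ?agr p (Suc i)" using agrS' by blast
      show ?thesis unfolding E' op_not_live[OF False] if_not_P[OF n] by simp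
    next
      case True
      have "op i (ract (fE i) \<phi>) p = fw i * \<phi> p"
      proof (cases "i = 0")
        case i0: True
        then show ?thesis using True Ep by (simp add: op_def live_def fw_def)
      next
        case False
        then have c: "corner N p i" using True by (simp add: live_def)
        have "flip p i ! i \<noteq> p ! i"
          unfolding flip_values(1)[OF Suc.prems(2) c]
          using paths_step[OF Suc.prems(2), of i] iN False by auto
        then have "\<not> ?agr (flip p i) i" using agr by auto
        then have z: "ract (fE i) \<phi> (flip p i) = 0"
          unfolding IH[OF flip_in_paths[OF Suc.prems(2) c]] by (rule if_not_P)
        have pr: "p ! (i - 1) = fund_path N ! (i - 1)" "p ! i = fund_path N ! i" using agr by auto
        have "tile p i = fw i"
          using cf_fund[of i] iN False unfolding tile_def pr by simp
        then show ?thesis using False c z Ep by (simp add: op_def)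
      qed
      then show ?thesis using E' agrS' True fw_nz by simp
    qed
  qed
qed

end

section \<open>The double quotient\<close>

text \<open>The height before a tile has absolute value below N, which gives
  \<open>psi_generic\<close>. The value at height -1 is assumed separately since for N = 1 it is not
  in this range.\<close>

locale generic_two_boundary_TL = two_boundary_TL N \<eta> \<omega>1 \<omega>2 \<theta>
  for N :: nat and \<eta> \<omega>1 \<omega>2 \<theta> :: complex +
  assumes N_ge_1: "1 \<le> N"
    and q_generic: "qpow \<eta> 1 \<noteq> qpow \<eta> (- 1)"
    and w1_generic: "qnum \<eta> (\<omega>1 + 1) \<noteq> 0"
    and w2_generic: "qnum \<eta> (\<omega>2 + 1) \<noteq> 0"
    and psi_generic: "\<bar>h\<bar> < int N \<Longrightarrow> qnum \<eta> (\<omega>1 - of_int h) \<noteq> 0"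
begin

definition psi :: "int \<Rightarrow> complex" where
  "psi a = qnum \<eta> (\<omega>1 - of_int a)"

text \<open>The factor \<open>a - x\<close> is the sign of the parameter: \<open>x = a - 1\<close>
  gives K_N(\<omega>1 - a) and \<open>x = a + 1\<close> gives K_N(-\<omega>1 + a).\<close>

definition kap :: "int \<Rightarrow> int \<Rightarrow> complex" where
  "kap a x = k (of_int (a - x) * (\<omega>1 - of_int a))"

text \<open>The product-to-sum formula isolates \<theta> in a summand independent of u, which
  cancels in the sums that follow.\<close>

lemma k_eq: "k u = (qcosh \<eta> \<theta> - qcosh \<eta> (u - \<omega>2)) / (qnum \<eta> u * qnum \<eta> (\<omega>2 + 1))"
proof -
  have "qnum \<eta> ((u - \<omega>2 + \<theta>) / 2) * qnum \<eta> ((u - \<omega>2 - \<theta>) / 2) = qcosh \<eta> (u - \<omega>2) - qcosh \<eta> \<theta>"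
    unfolding qnum_mult by (rule arg_cong2[of _ _ _ _ "\<lambda>x y. qcosh \<eta> x - qcosh \<eta> y"]) (simp_all add: field_simps)
  then show ?thesis by (simp add: k_def minus_divide_left)
qed

lemma k_minus_eq: "k (- u) = (qcosh \<eta> (u + \<omega>2) - qcosh \<eta> \<theta>) / (qnum \<eta> u * qnum \<eta> (\<omega>2 + 1))"
proof -
  have "qcosh \<eta> (- u - \<omega>2) = qcosh \<eta> (u + \<omega>2)"
    using qcosh_minus[of \<eta> "u + \<omega>2"] by simp
  then show ?thesis by (simp add: k_eq qnum_minus minus_divide_left)
qed

lemma k_sum:
  assumes "qnum \<eta> u \<noteq> 0"
  shows "k u + k (- u) = s2"
proof -
  have "k u + k (- u) = (qcosh \<eta> (u + \<omega>2) - qcosh \<eta> (u - \<omega>2)) / (qnum \<eta> u * qnum \<eta> (\<omega>2 + 1))"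
    unfolding k_eq[of u] k_minus_eq by (simp add: add_divide_distrib[symmetric])
  then show ?thesis
    using assms unfolding qnum_mult[symmetric] by (simp add: s2_def)
qed

text \<open>The quotients of q-numbers give both terms the denominator [u][\<omega>2 + 1]; once
  \<theta> cancels, the numerator is the product formula for this very denominator.\<close>

lemma k_reflection:
  assumes "qnum \<eta> u \<noteq> 0" "qnum \<eta> (u - 1) \<noteq> 0" "qnum \<eta> (u + 1) \<noteq> 0"
  shows "qnum \<eta> (u - 1) / qnum \<eta> u * k (u - 1) + qnum \<eta> (u + 1) / qnum \<eta> u * k (- (u + 1)) = 1"
proof -
  have "qnum \<eta> (u - 1) / qnum \<eta> u * k (u - 1) + qnum \<eta> (u + 1) / qnum \<eta> u * k (- (u + 1)) =
    (qcosh \<eta> \<theta> - qcosh \<eta> (u - 1 - \<omega>2)) / (qnum \<eta> u * qnum \<eta> (\<omega>2 + 1)) +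
    (qcosh \<eta> (u + 1 + \<omega>2) - qcosh \<eta> \<theta>) / (qnum \<eta> u * qnum \<eta> (\<omega>2 + 1))"
    unfolding k_eq[of "u - 1"] k_minus_eq using assms by simp
  also have "\<dots> = (qcosh \<eta> (u + (\<omega>2 + 1)) - qcosh \<eta> (u - (\<omega>2 + 1))) / (qnum \<eta> u * qnum \<eta> (\<omega>2 + 1))"
    by (simp add: add_divide_distrib[symmetric] algebra_simps)
  also have "\<dots> = 1" using assms w2_generic unfolding qnum_mult[symmetric] by simp
  finally show ?thesis .
qed

lemma b_even_eq:
  assumes "even N" shows "b = k (- (\<omega>1 + 1))"
proof -
  have "(- (\<omega>1 + 1) - \<omega>2 + \<theta>) / 2 = - ((\<omega>1 + \<omega>2 + 1 - \<theta>) / 2)"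
    "(- (\<omega>1 + 1) - \<omega>2 - \<theta>) / 2 = - ((\<omega>1 + \<omega>2 + 1 + \<theta>) / 2)"
    by (simp_all add: field_simps)
  then show ?thesis using assms
    unfolding b_def k_def by (simp only: qnum_minus if_True) simp
qed

sublocale sos: sos_weights N psi kap loop s1 s2 b
proof
  show "1 \<le> N" by (rule N_ge_1)
  show pz: "psi a \<noteq> 0" if "\<bar>a\<bar> < int N" for a
    using psi_generic that by (simp add: psi_def)
  show pm: "psi (- 1) \<noteq> 0" using w1_generic by (simp add: psi_def)
  show "psi (a + 1) + psi (a - 1) = loop * psi a" for a
    using qnum_rec[OF q_generic, of "\<omega>1 - of_int a"]
    by (simp add: psi_def loop_def algebra_simps)
  show "s1 = psi 0 / psi (- 1)" by (simp add: psi_def s1_def)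
  show "kap a (a + 1) + kap a (a - 1) = s2" if "\<bar>a\<bar> < int N" for a
    using k_sum[of "\<omega>1 - of_int a"] pz[OF that] by (simp add: kap_def psi_def add.commute)
  show "psi (a + 1) / psi a * kap (a + 1) a + psi (a - 1) / psi a * kap (a - 1) a = 1"
    if "\<bar>a\<bar> + 1 < int N" for a
  proof -
    let ?u = "\<omega>1 - of_int a"
    have e: "psi (a + 1) = qnum \<eta> (?u - 1)" "psi (a - 1) = qnum \<eta> (?u + 1)" "psi a = qnum \<eta> ?u"
      "kap (a + 1) a = k (?u - 1)" "kap (a - 1) a = k (- (?u + 1))"
      by (simp_all add: psi_def kap_def algebra_simps)
    have "\<bar>a + 1\<bar> < int N" "\<bar>a - 1\<bar> < int N" "\<bar>a\<bar> < int N" using that by linarith+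
    then have "qnum \<eta> (?u - 1) \<noteq> 0" "qnum \<eta> (?u + 1) \<noteq> 0" "qnum \<eta> ?u \<noteq> 0"
      unfolding e[symmetric] using pz by blast+
    then show ?thesis unfolding e by (rule_tac k_reflection)
  qed
  show "b = (if even N then kap (- 1) 0 else s1 * kap 0 (- 1))"
  proof (cases "even N")
    case True
    then show ?thesis using b_even_eq by (simp add: kap_def)
  next
    case False
    have "qnum \<eta> \<omega>1 \<noteq> 0" using psi_generic[of 0] N_ge_1 by simp
    then show ?thesis using False by (simp add: b_def kap_def k_def s1_def)
  qed
qed

section \<open>The quotient ring, its scalars and its transposition\<close>

abbreviation "FA \<equiv> free_alg N"

lemma fword_in_carrier: "fword sos.odds \<in> carrier FA" "fword sos.evens \<in> carrier FA"
  by (rule carrier_fword; auto simp: sos.set_odds sos.set_evens)+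

lemma I1_eq: "I1 = fword sos.odds" and I2_eq: "I2 = fword sos.evens"
  by (simp_all add: I1_def I2_def fword_def sos.odds_def sos.evens_def)

lemma relators_carrier: "relators \<subseteq> carrier FA"
  unfolding relators_def relators_2BTL_def I1_eq I2_eq
  by (auto intro!: carrier_diff carrier_closed carrier_fgen carrier_fconst fword_in_carrier)

lemma relideal_ideal: "ideal relideal FA"
  unfolding relideal_def by (rule ring.genideal_ideal[OF ring_free_alg relators_carrier])

lemma relators_in: "x \<in> relators \<Longrightarrow> x \<in> relideal"
  unfolding relideal_def using ring.genideal_self[OF ring_free_alg relators_carrier] by blast

lemma relideal_least: "ideal L FA \<Longrightarrow> relators \<subseteq> L \<Longrightarrow> relideal \<subseteq> L"
  unfolding relideal_def by (rule ring.genideal_minimal[OF ring_free_alg])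

sublocale Ab: ring Ab
  unfolding Ab_def by (rule ideal.quotient_is_ring[OF relideal_ideal])

abbreviation Ab_mult (infixl \<open>\<odot>\<close> 70) where "x \<odot> y \<equiv> x \<otimes>\<^bsub>Ab\<^esub> y"

lemma cls_hom: "cls \<in> Ring.ring_hom FA Ab"
  unfolding cls_def[abs_def] Ab_def by (rule ideal.rcos_ring_hom[OF relideal_ideal])

lemma cls_closed [simp, intro]: "x \<in> carrier FA \<Longrightarrow> cls x \<in> carrier Ab"
  using ring_hom_closed[OF cls_hom] .

lemma cls_mult: "x \<in> carrier FA \<Longrightarrow> y \<in> carrier FA \<Longrightarrow> cls (x * y) = cls x \<odot> cls y"
  using ring_hom_mult[OF cls_hom, of x y] by simp

lemma cls_add: "x \<in> carrier FA \<Longrightarrow> y \<in> carrier FA \<Longrightarrow> cls (x + y) = cls x \<oplus>\<^bsub>Ab\<^esub> cls y"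
  using ring_hom_add[OF cls_hom, of x y] by simp

lemma cls_one: "cls 1 = \<one>\<^bsub>Ab\<^esub>"
  using ring_hom_one[OF cls_hom] by simp

lemma cls_surj: "y \<in> carrier Ab \<Longrightarrow> \<exists>x\<in>carrier FA. y = cls x"
  unfolding Ab_def FactRing_def A_RCOSETS_def' cls_def by auto

lemma cls_zero: "x \<in> relideal \<Longrightarrow> cls x = \<zero>\<^bsub>Ab\<^esub>"
proof -
  assume x: "x \<in> relideal"
  interpret I: ideal relideal FA by (rule relideal_ideal)
  show ?thesis using I.a_rcos_const[OF x] by (simp add: cls_def Ab_def FactRing_def)
qed

lemma cls_zeroD: "x \<in> carrier FA \<Longrightarrow> cls x = \<zero>\<^bsub>Ab\<^esub> \<Longrightarrow> x \<in> relideal"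
proof -
  assume x: "x \<in> carrier FA" "cls x = \<zero>\<^bsub>Ab\<^esub>"
  interpret I: ideal relideal FA by (rule relideal_ideal)
  show ?thesis using x I.rcos_const_imp_mem[of x] by (simp add: cls_def Ab_def FactRing_def)
qed

lemma cls_eq:
  assumes "x \<in> carrier FA" "y \<in> carrier FA" "x - y \<in> relideal"
  shows "cls x = cls y"
proof -
  have d: "x - y \<in> carrier FA" by (rule carrier_diff[OF assms(1,2)])
  have "cls x = cls ((x - y) + y)" by simp
  also have "\<dots> = cls y"
    unfolding cls_add[OF d assms(2)] cls_zero[OF assms(3)] using assms(2) by simp
  finally show ?thesis .
qed

lemma cls_eqD:
  assumes "x \<in> carrier FA" "y \<in> carrier FA" "cls x = cls y"
  shows "x - y \<in> relideal"
proof (rule cls_zeroD[OF carrier_diff[OF assms(1,2)]])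
  have d: "x - y \<in> carrier FA" by (rule carrier_diff[OF assms(1,2)])
  have "cls y = cls (x - y) \<oplus>\<^bsub>Ab\<^esub> cls y"
    using cls_add[OF d assms(2)] assms(3) by simp
  then show "cls (x - y) = \<zero>\<^bsub>Ab\<^esub>"
    using d assms(2) by (metis Ab.add.r_cancel_one cls_closed)
qed

sublocale Abc: cx_algebra Ab smul
proof
  fix x y c d assume x: "x \<in> carrier Ab"
  obtain f where f: "f \<in> carrier FA" "x = cls f" using cls_surj[OF x] by blast
  have fc: "cls (fconst c) \<in> carrier Ab" "cls (fconst d) \<in> carrier Ab"
    using carrier_fconst by auto
  show "smul c x \<in> carrier Ab" using x fc by (simp add: smul_def)
  show "smul 1 x = x" using x by (simp add: smul_def fconst_1 cls_one)
  show "smul c (smul d x) = smul (c * d) x"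
    using x fc by (simp add: smul_def fconst_mult[symmetric] cls_mult carrier_fconst Ab.m_assoc)
  show "smul (c + d) x = smul c x \<oplus>\<^bsub>Ab\<^esub> smul d x"
    using x fc by (simp add: smul_def fconst_add cls_add carrier_fconst Ab.l_distr)
  assume y: "y \<in> carrier Ab"
  show "smul c (x \<oplus>\<^bsub>Ab\<^esub> y) = smul c x \<oplus>\<^bsub>Ab\<^esub> smul c y"
    using x y fc by (simp add: smul_def Ab.r_distr)
  show "smul c x \<odot> y = smul c (x \<odot> y)"
    using x y fc by (simp add: smul_def Ab.m_assoc)
  have "cls (fconst c) \<odot> x = x \<odot> cls (fconst c)"
    using f carrier_fconst by (simp add: cls_mult[symmetric] fconst_central)
  then show "x \<odot> smul c y = smul c (x \<odot> y)"
    using x y fc by (simp add: smul_def Ab.m_assoc[symmetric])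
qed

lemma smul_cls: "x \<in> carrier FA \<Longrightarrow> smul c (cls x) = cls (fconst c * x)"
  by (simp add: smul_def cls_mult carrier_fconst)

sublocale gens: tl_generators Ab smul e ..

lemma e_carrier: "i \<le> N \<Longrightarrow> e i \<in> carrier Ab"
  by (simp add: e_def carrier_fgen)

lemma cls_fword_Cons:
  "j \<le> N \<Longrightarrow> fword js \<in> carrier FA \<Longrightarrow> cls (fword (j # js)) = e j \<odot> cls (fword js)"
  by (simp add: fword_simps cls_mult carrier_fgen e_def)

lemma e_commute:
  assumes "i \<le> N" "j \<le> N" "i + 2 \<le> j \<or> j + 2 \<le> i"
  shows "e i \<odot> e j = e j \<odot> e i"
proof -
  have "\<bar>int i - int j\<bar> > 1" using assms(3) by linarith
  then have "fgen i * fgen j - fgen j * fgen i \<in> relators"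
    using assms(1,2) unfolding relators_def relators_2BTL_def by blast
  then show ?thesis
    using cls_eq[OF _ _ relators_in] assms by (simp add: e_def cls_mult[symmetric] carrier_closed carrier_fgen)
qed

text \<open>The letters commute pairwise. This is what makes the reversed relators of the double
  quotient hold again, since I_1 and I_2 come back with their letters in the opposite order.\<close>

lemma cls_fword_rev:
  assumes "sos.apart js"
  shows "cls (fword (rev js)) = cls (fword js)"
  using assms
proof (induction js)
  case (Cons j js)
  have jN: "j \<le> N" and far: "\<And>i. i \<in> set js \<Longrightarrow> j + 2 \<le> i" and aj: "sos.apart js"
    and le: "\<And>i. i \<in> set js \<Longrightarrow> i \<le> N"
    using Cons.prems by (auto simp: sos.apart_Cons) (auto simp: sos.apart_def)
  have "set ks \<subseteq> set js \<Longrightarrow> e j \<odot> cls (fword ks) = cls (fword ks) \<odot> e j" for ks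
  proof (induction ks)
    case Nil
    then show ?case using jN by (simp add: fword_simps cls_one e_carrier)
  next
    case (Cons i ks)
    have i: "i \<le> N" "j + 2 \<le> i" using Cons.prems le far by auto
    have c: "fword ks \<in> carrier FA" by (rule carrier_fword) (use Cons.prems le in auto)
    have ec: "e i \<in> carrier Ab" "e j \<in> carrier Ab" "cls (fword ks) \<in> carrier Ab"
      using i jN c e_carrier by auto
    have ij: "e j \<odot> e i = e i \<odot> e j" using e_commute[OF jN i(1)] i(2) by simp
    have IH: "e j \<odot> cls (fword ks) = cls (fword ks) \<odot> e j" using Cons by simp
    have "e j \<odot> (e i \<odot> cls (fword ks)) = e i \<odot> (e j \<odot> cls (fword ks))"
      using ec ij by (simp add: Ab.m_assoc[symmetric])
    then show ?case using ec i c IH by (simp add: cls_fword_Cons Ab.m_assoc)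
  qed
  note comm = this[OF order_refl]
  have c: "fword js \<in> carrier FA" "fword (rev js) \<in> carrier FA"
    by (rule carrier_fword; use le in auto)+
  have "cls (fword (rev (j # js))) = cls (fword (rev js)) \<odot> e j"
    using c jN by (simp add: fword_simps cls_mult carrier_fgen e_def)
  then show ?case using Cons.IH[OF aj] comm c jN by (simp add: cls_fword_Cons)
qed simp

text \<open>The elements whose reversal lies in \<open>relideal\<close> form an ideal, so only the
  relators matter. Those of the 2BTL algebra are fixed up to sign; the two of the double quotient
  return with reversed words.\<close>

lemma frev_relideal: "f \<in> relideal \<Longrightarrow> frev f \<in> relideal"
proof -
  interpret I: ideal relideal FA by (rule relideal_ideal)
  let ?K = "{f \<in> carrier FA. frev f \<in> relideal}"
  have neg: "- x \<in> relideal" if "x \<in> relideal" for x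
    using I.I_l_closed[OF that carrier_uminus[OF carrier_closed(1)]] by simp
  have "ideal ?K FA"
  proof (rule ideal_free_algI)
    show "0 \<in> ?K" using additive_subgroup.zero_closed[OF I.is_additive_subgroup] by (simp add: frev_0 carrier_closed)
    show "x + y \<in> ?K" if "x \<in> ?K" "y \<in> ?K" for x y
      using that additive_subgroup.a_closed[OF I.is_additive_subgroup, of "frev x" "frev y"] by (simp add: carrier_closed frev_add)
    show "- x \<in> ?K" if "x \<in> ?K" for x
      using that neg by (simp add: carrier_uminus frev_minus)
    show "y * x \<in> ?K" if "x \<in> ?K" "y \<in> carrier FA" for x y
      using that I.I_r_closed[of "frev x" "frev y"] carrier_frev
      by (simp add: carrier_closed frev_mult)
    show "x * y \<in> ?K" if "x \<in> ?K" "y \<in> carrier FA" for x y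
      using that I.I_l_closed[of "frev x" "frev y"] carrier_frev
      by (simp add: carrier_closed frev_mult)
  qed auto
  moreover have "relators \<subseteq> ?K"
  proof
    fix x assume x: "x \<in> relators"
    have xc: "x \<in> carrier FA" using x relators_carrier by blast
    have III: "frev (fword is * fword js * fword is - fconst b * fword is) \<in> relideal"
      if a: "sos.apart is" "sos.apart js" and
        rel: "fword is * fword js * fword is - fconst b * fword is \<in> relators" for "is" js
    proof -
      have "fword is \<in> carrier FA" "fword js \<in> carrier FA" "fword (rev is) \<in> carrier FA"
        "fword (rev js) \<in> carrier FA"
        by (rule carrier_fword; use a in \<open>auto simp: sos.apart_def\<close>)+
      note c = this
      have "cls (fword is * fword js * fword is) = cls (fconst b * fword is)"
        by (rule cls_eq[OF _ _ relators_in[OF rel]]) (use c in \<open>simp_all add: carrier_closed carrier_fconst\<close>)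
      then have "cls (fword (rev is) * (fword (rev js) * fword (rev is))) = cls (fword (rev is) * fconst b)"
        using c by (simp add: cls_mult carrier_closed carrier_fconst cls_fword_rev[OF a(1)]
            cls_fword_rev[OF a(2)] Ab.m_assoc fconst_central[symmetric])
      then have "fword (rev is) * (fword (rev js) * fword (rev is)) - fword (rev is) * fconst b \<in> relideal"
        by (rule cls_eqD[rotated 2]) (use c in \<open>simp_all add: carrier_closed carrier_fconst\<close>)
      then show ?thesis by (simp add: frev_diff frev_mult frev_fword frev_fconst)
    qed
    have "frev x \<in> relideal"
    proof -
      consider i where "x = fgen i * fgen i - fconst loop * fgen i" "1 \<le> i" "i < N"
        | i j where "x = fgen i * fgen j * fgen i - fgen i" 
        | "x = fgen 0 * fgen 0 - fconst s1 * fgen 0" | "x = fgen N * fgen N - fconst s2 * fgen N"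
        | i j where "x = fgen i * fgen j - fgen j * fgen i"
        | "x = I1 * I2 * I1 - fconst b * I1" | "x = I2 * I1 * I2 - fconst b * I2"
        using x unfolding relators_def relators_2BTL_def by blast
      then show ?thesis
      proof cases
        case 5
        then have "frev x = - x" by (simp add: frev_diff frev_mult frev_fgen)
        then show ?thesis using neg relators_in[OF x] by simp
      next
        case 6
        then show ?thesis using III[OF sos.apart_odds sos.apart_evens] x
          unfolding I1_eq I2_eq by blast
      next
        case 7
        then show ?thesis using III[OF sos.apart_evens sos.apart_odds] x
          unfolding I1_eq I2_eq by blast
      qed (use relators_in[OF x] in
          \<open>simp_all add: frev_diff frev_mult frev_fgen frev_fconst fconst_central mult.assoc\<close>)
    qed
    then show "x \<in> ?K" using xc by simp
  qed
  ultimately have "relideal \<subseteq> ?K" by (rule relideal_least)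
  then show "f \<in> relideal \<Longrightarrow> frev f \<in> relideal" by blast
qed

lemma transp_cls:
  assumes "f \<in> carrier FA"
  shows "transp (cls f) = cls (frev f)"
proof -
  have c: "cls g = (\<lambda>h. h + g) ` relideal" for g
    unfolding cls_def by (simp add: a_r_coset_def' UNION_singleton_eq_range)
  have r: "frev ` relideal = relideal"
  proof
    show "frev ` relideal \<subseteq> relideal" using frev_relideal by blast
    show "relideal \<subseteq> frev ` relideal"
    proof
      fix h assume "h \<in> relideal"
      then have "frev h \<in> relideal" by (rule frev_relideal)
      then have "frev (frev h) \<in> frev ` relideal" by (rule imageI)
      then show "h \<in> frev ` relideal" by simp
    qed
  qed
  have "transp (cls f) = (\<lambda>h. h + frev f) ` (frev ` relideal)"
    unfolding transp_def c image_image frev_add ..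
  then show ?thesis unfolding c r .
qed

lemma Im_eq: "m \<le> Suc N \<Longrightarrow> gens.Im m = cls (fword (filter (\<lambda>i. even i \<noteq> even m) [0..<m]))"
proof (induction m rule: gens.Im.induct)
  case (3 m)
  have f: "filter (\<lambda>i. even i \<noteq> even (Suc (Suc m))) [0..<Suc (Suc m)] =
    filter (\<lambda>i. even i \<noteq> even m) [0..<m] @ [Suc m]" by simp
  have c: "fword (filter (\<lambda>i. even i \<noteq> even m) [0..<m]) \<in> carrier FA"
    by (rule carrier_fword) (use 3 in auto)
  show ?case unfolding f fword_simps using 3 c
    by (simp add: cls_mult carrier_closed carrier_fgen e_def[symmetric])
qed (simp_all add: fword_simps cls_one e_def)

lemma Im_N: "gens.Im N = (if even N then cls I1 else cls I2)"
  "gens.Im (Suc N) = (if even N then cls I2 else cls I1)"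
proof -
  have "filter (\<lambda>i. even i \<noteq> even N) [0..<N] = filter (\<lambda>i. even i \<noteq> even N) [0..<N + 1]" by simp
  then show "gens.Im N = (if even N then cls I1 else cls I2)"
    using Im_eq[of N] by (simp add: I1_def I2_def fword_def del: upt_Suc)
  show "gens.Im (Suc N) = (if even N then cls I2 else cls I1)"
    using Im_eq[of "Suc N"] by (simp add: I1_def I2_def fword_def del: upt_Suc)
qed

sublocale tb: tb_algebra N psi kap loop s1 s2 b Ab smul e
proof
  show "i \<le> N \<Longrightarrow> e i \<in> carrier Ab" for i by (rule e_carrier)
  have eq: "cls x = cls y" if "x - y \<in> relators" "x \<in> carrier FA" "y \<in> carrier FA" for x y
    by (rule cls_eq[OF that(2,3) relators_in[OF that(1)]])
  show "e i \<odot> e i = smul loop (e i)" if "1 \<le> i" "i < N" for i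
  proof -
    have "cls (fgen i * fgen i) = cls (fconst loop * fgen i)"
      by (rule eq) (use that in \<open>auto simp: relators_def relators_2BTL_def carrier_closed carrier_fgen carrier_fconst\<close>)
    then show ?thesis using that by (simp add: e_def smul_cls cls_mult carrier_fgen)
  qed
  show "e 0 \<odot> e 0 = smul s1 (e 0)"
  proof -
    have "cls (fgen 0 * fgen 0) = cls (fconst s1 * fgen 0)"
      by (rule eq) (auto simp: relators_def relators_2BTL_def carrier_closed carrier_fgen carrier_fconst)
    then show ?thesis by (simp add: e_def smul_cls cls_mult carrier_fgen)
  qed
  show "e N \<odot> e N = smul s2 (e N)"
  proof -
    have "cls (fgen N * fgen N) = cls (fconst s2 * fgen N)"
      by (rule eq) (auto simp: relators_def relators_2BTL_def carrier_closed carrier_fgen carrier_fconst)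
    then show ?thesis by (simp add: e_def smul_cls cls_mult carrier_fgen)
  qed
  show "e i \<odot> (e j \<odot> e i) = e i" if "1 \<le> i" "i < N" "j = i + 1 \<or> i = j + 1" for i j
  proof -
    have "j \<le> N" using that by auto
    then have "cls (fgen i * fgen j * fgen i) = cls (fgen i)"
      by (intro eq) (use that in \<open>auto simp: relators_def relators_2BTL_def carrier_closed carrier_fgen\<close>)
    then show ?thesis using that \<open>j \<le> N\<close>
      by (simp add: e_def cls_mult carrier_fgen carrier_closed mult.assoc)
  qed
  show "e i \<odot> e j = e j \<odot> e i" if "i \<le> N" "j \<le> N" "i + 2 \<le> j \<or> j + 2 \<le> i" for i j
    by (rule e_commute[OF that])
  show "gens.Im N \<odot> (gens.Im (Suc N) \<odot> gens.Im N) = smul b (gens.Im N)"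
  proof -
    have c: "I1 \<in> carrier FA" "I2 \<in> carrier FA" unfolding I1_eq I2_eq by (rule fword_in_carrier)+
    have "cls (I1 * I2 * I1) = cls (fconst b * I1)" "cls (I2 * I1 * I2) = cls (fconst b * I2)"
      by (intro eq; use c in \<open>simp add: relators_def carrier_closed carrier_fconst\<close>)+
    then show ?thesis using c unfolding Im_N
      by (simp add: smul_cls cls_mult carrier_closed mult.assoc)
  qed
qed

sublocale tbt: tb_algebra_transpose N psi kap loop s1 s2 b Ab smul e transp
proof
  fix x y c assume "x \<in> carrier Ab"
  then obtain f where f: "f \<in> carrier FA" "x = cls f" using cls_surj by blast
  show "transp x \<in> carrier Ab" using f by (simp add: transp_cls carrier_frev)
  show "transp (smul c x) = smul c (transp x)"
    using f by (simp add: smul_cls transp_cls carrier_closed carrier_fconst carrier_frev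
        frev_mult frev_fconst fconst_central)
  assume "y \<in> carrier Ab"
  then obtain g where g: "g \<in> carrier FA" "y = cls g" using cls_surj by blast
  show "transp (x \<oplus>\<^bsub>Ab\<^esub> y) = transp x \<oplus>\<^bsub>Ab\<^esub> transp y"
    using f g by (simp add: cls_add[symmetric] transp_cls carrier_closed carrier_frev frev_add)
  show "transp (x \<odot> y) = transp y \<odot> transp x"
    using f g by (simp add: cls_mult[symmetric] transp_cls carrier_closed carrier_frev frev_mult)
next
  show "transp \<one>\<^bsub>Ab\<^esub> = \<one>\<^bsub>Ab\<^esub>"
    unfolding cls_one[symmetric] by (simp add: transp_cls carrier_closed frev_fconst[of 1, unfolded fconst_1])
  show "transp (e i) = e i" if "i \<le> N" for i
    using that by (simp add: e_def transp_cls carrier_fgen frev_fgen)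
qed

lemma E_eq: "i \<le> N \<Longrightarrow> E i = tb.Es i"
proof (induction i)
  case (Suc i)
  have "s1 powi ((- 1) ^ Suc i) = 1 / sos.fw i"
    by (simp add: sos.fw_def power_int_minus_divide)
  then show ?case using Suc by (simp add: tb.Es.simps Ab.m_assoc)
qed simp

lemma Es_eq_cls: "i \<le> N \<Longrightarrow> tb.Es i = cls (sos.fE i)"
proof (induction i)
  case (Suc i)
  then have c: "sos.fE i \<in> carrier FA" "fgen i \<in> carrier FA"
    using sos.carrier_fE carrier_fgen by auto
  then show ?case using Suc
    by (simp add: tb.Es.simps smul_cls[symmetric] cls_mult carrier_closed e_def[symmetric])
qed (simp add: cls_one)

text \<open>If E_N vanished, its representative would annihilate all path functions; but at the
  fundamental path it acts as the identity.\<close>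

lemma Es_nonzero: "tb.Es N \<noteq> \<zero>\<^bsub>Ab\<^esub>"
proof
  assume "tb.Es N = \<zero>\<^bsub>Ab\<^esub>"
  then have "sos.fE N \<in> relideal"
    using cls_zeroD[OF sos.carrier_fE[OF order_refl]] Es_eq_cls by simp
  moreover have "relideal \<subseteq> {f \<in> carrier FA. \<forall>\<phi>. \<forall>p\<in>paths N. sos.ract f \<phi> p = 0}"
  proof (rule relideal_least[OF sos.ideal_annihilator])
    have "sos.ract x \<phi> p = 0" if x: "x \<in> relators" and p: "p \<in> paths N" for x \<phi> p
    proof -
      note r = sos.ract_diff sos.ract_mult' sos.ract_fgen' sos.ract_fconst sos.ract_fword
      consider i where "x = fgen i * fgen i - fconst loop * fgen i" "1 \<le> i" "i < N"
        | i j where "x = fgen i * fgen j * fgen i - fgen i" "1 \<le> i" "i < N" "j = i + 1 \<or> i = j + 1"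
        | "x = fgen 0 * fgen 0 - fconst s1 * fgen 0" | "x = fgen N * fgen N - fconst s2 * fgen N"
        | i j where "x = fgen i * fgen j - fgen j * fgen i" "i \<le> N" "j \<le> N" "\<bar>int i - int j\<bar> > 1"
        | "x = I1 * I2 * I1 - fconst b * I1" | "x = I2 * I1 * I2 - fconst b * I2"
        using x unfolding relators_def relators_2BTL_def by blast
      then show ?thesis
      proof cases
        case 1
        then show ?thesis using sos.op_sq[OF p, of i] by (simp add: r)
      next
        case 2
        then show ?thesis using sos.op_braid[OF p, of i j] by (simp add: r)
      next
        case 3
        then show ?thesis using sos.op_0_sq by (simp add: r)
      next
        case 4
        then show ?thesis using sos.op_sq[OF p, of N] N_ge_1 by (simp add: r)
      next
        case 5
        then have "i + 2 \<le> j \<or> j + 2 \<le> i" by linarith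
        then show ?thesis using 5 sos.op_comm[OF p, of i j] by (simp add: r)
      next
        case 6
        then show ?thesis unfolding I1_eq I2_eq using sos.ops_I_rel(1)[OF p] by (simp add: r)
      next
        case 7
        then show ?thesis unfolding I1_eq I2_eq using sos.ops_I_rel(2)[OF p] by (simp add: r)
      qed
    qed
    then show "relators \<subseteq> {f \<in> carrier FA. \<forall>\<phi>. \<forall>p\<in>paths N. sos.ract f \<phi> p = 0}"
      using relators_carrier by blast
  qed
  ultimately have "sos.ract (sos.fE N) (\<lambda>_. 1) (fund_path N) = 0"
    using fund_path_in_paths by blast
  then show False
    using sos.ract_fE[OF order_refl fund_path_in_paths, of "\<lambda>_. 1"] by simp
qed

section \<open>Identification of the basis vectors and of the form\<close>

lemma X_mult:
  assumes "i \<le> N" "v \<in> carrier Ab"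
  shows "X i u \<odot> v = tb.Xt i (if i < N then r u else k u) v"
proof -
  have 1: "\<ominus>\<^bsub>Ab\<^esub> smul c \<one>\<^bsub>Ab\<^esub> = smul (- c) \<one>\<^bsub>Ab\<^esub>" for c
    by (rule Ab.minus_equality) (use tb.sc_minus_self[of "\<one>\<^bsub>Ab\<^esub>" "- c"] in simp_all)
  have "X i u = e i \<oplus>\<^bsub>Ab\<^esub> smul (- (if i < N then r u else k u)) \<one>\<^bsub>Ab\<^esub>"
    using assms(1) by (auto simp: X_def R_def K_def a_minus_def 1)
  then show ?thesis using assms e_carrier by (simp add: tb.Xt_def Ab.l_distr)
qed

text \<open>For a tile from below, numerator and denominator of r(u) both change sign, so again a
  quotient of two values of \<open>psi\<close> results.\<close>

lemma tile_param:
  assumes p: "p \<in> paths N" and a: "addable N p i"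
    and u: "u = (if p ! (i - 1) \<ge> 0 then \<omega>1 - of_int (p ! (i - 1)) else - \<omega>1 + of_int (p ! (i - 1)))"
  shows "(if i < N then r u else k u) = sos.tile p i"
proof -
  let ?a = "p ! (i - 1)"
  have v: "p ! i = (if ?a \<ge> 0 then ?a - 1 else ?a + 1)" by (rule addableD(4)[OF a])
  show ?thesis
  proof (cases "?a \<ge> 0")
    case True
    have m: "u + 1 = \<omega>1 - of_int (?a - 1)" "u = of_int (?a - (?a - 1)) * (\<omega>1 - of_int ?a)"
      using True u by simp_all
    have "r u = qnum \<eta> (\<omega>1 - of_int (?a - 1)) / qnum \<eta> (\<omega>1 - of_int ?a)"
      unfolding r_def m(1) using u True by simp
    moreover have "k u = kap ?a (?a - 1)" unfolding kap_def m(2)[symmetric] ..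
    ultimately show ?thesis
      using True v unfolding sos.tile_def sos.cf_def psi_def by simp
  next
    case False
    have m: "u + 1 = - (\<omega>1 - of_int (?a + 1))" "u = - (\<omega>1 - of_int ?a)"
      "u = of_int (?a - (?a + 1)) * (\<omega>1 - of_int ?a)"
      using False u by simp_all
    have "r u = qnum \<eta> (\<omega>1 - of_int (?a + 1)) / qnum \<eta> (\<omega>1 - of_int ?a)"
      unfolding r_def m(1) unfolding m(2) qnum_minus by simp
    moreover have "k u = kap ?a (?a + 1)" unfolding kap_def m(3)[symmetric] ..
    ultimately show ?thesis
      using False v unfolding sos.tile_def sos.cf_def psi_def by simp
  qed
qed

text \<open>\<open>bp\<close> obeys the rule for every addition and not only for the leftmost tile,
  so each sequence of additions ends in it: this is the independence of the order.\<close>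

lemma basis_rel_bp: "basis_rel p x \<Longrightarrow> p \<in> paths N \<and> x = tb.bp p"
proof (induction rule: basis_rel.induct)
  case fund
  then show ?case by (simp add: fund_path_in_paths E_eq tb.bp_fund)
next
  case (above p x i p')
  then have a: "p \<in> paths N" "addable N p i" "0 \<le> p ! (i - 1)" "p' = flip p i" "x = tb.bp p"
    by (auto simp: adds_above_iff)
  have iN: "i \<le> N" using cornerD[OF addable_corner[OF a(2)]] by simp
  have t: "(if i < N then r (\<omega>1 - of_int (p ! (i - 1))) else k (\<omega>1 - of_int (p ! (i - 1)))) = sos.tile p i"
    by (rule tile_param[OF a(1,2)]) (use a(3) in simp)
  show ?case
    unfolding a(4,5) X_mult[OF iN tb.bp_closed] t
    using flip_in_paths[OF a(1) addable_corner[OF a(2)]] tb.bp_addable[OF a(1,2)] by simp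
next
  case (below p x i p')
  then have a: "p \<in> paths N" "addable N p i" "p ! (i - 1) < 0" "p' = flip p i" "x = tb.bp p"
    by (auto simp: adds_below_iff)
  have iN: "i \<le> N" using cornerD[OF addable_corner[OF a(2)]] by simp
  have t: "(if i < N then r (- \<omega>1 + of_int (p ! (i - 1))) else k (- \<omega>1 + of_int (p ! (i - 1)))) = sos.tile p i"
    by (rule tile_param[OF a(1,2)]) (use a(3) in simp)
  show ?case
    unfolding a(4,5) X_mult[OF iN tb.bp_closed] t
    using flip_in_paths[OF a(1) addable_corner[OF a(2)]] tb.bp_addable[OF a(1,2)] by simp
qed

lemma basis_rel_ex: "p \<in> paths N \<Longrightarrow> \<exists>x. basis_rel p x"
proof (induction "height_sum p" arbitrary: p rule: less_induct)
  case less
  show ?case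
  proof (cases "p = fund_path N")
    case True
    then show ?thesis using basis_rel.fund by blast
  next
    case False
    then obtain j where j: "removable N p j" using ex_removable[OF less(2)] by blast
    note c = removable_corner[OF j]
    have q: "flip p j \<in> paths N" by (rule flip_in_paths[OF less(2) c])
    obtain x where x: "basis_rel (flip p j) x"
      using less(1)[OF height_sum_flip[OF less(2) j] q] by blast
    have ad: "addable N (flip p j) j" by (rule addable_flip[OF less(2) j])
    have fp: "p = flip (flip p j) j" using flip_flip[OF less(2) c] by simp
    show ?thesis
    proof (cases "flip p j ! (j - 1) \<ge> 0")
      case True
      then have "adds_above N j (flip p j) p" unfolding adds_above_iff using q ad fp by blast
      then show ?thesis using basis_rel.above[OF x] by blast
    next
      case False
      then have "adds_below N j (flip p j) p" unfolding adds_below_iff using q ad fp by auto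
      then show ?thesis using basis_rel.below[OF x] by blast
    qed
  qed
qed

lemma bvec_eq: "p \<in> paths N \<Longrightarrow> bvec p = tb.bp p"
  unfolding bvec_def using basis_rel_ex[of p] basis_rel_bp by (metis the_equality)

text \<open>Orthogonality, placed between vectors of \<open>W\<close>, is the defining equation of
  the form. The scalar is unique because the equation can be tested at x1 = x4 = E_N, where the
  right side is a multiple of E_N \<noteq> 0.\<close>

lemma form_bvec:
  assumes p: "p \<in> paths N" and q: "q \<in> paths N"
  shows "form (bvec p) (bvec q) = (if p = q then sos.nrm p else 0)"
proof -
  let ?g = "if p = q then sos.nrm p else 0" and ?E = "tb.Es N"
  have Ec: "?E \<in> carrier Ab" by simp
  have orth: "transp (tb.bp p) \<odot> tb.bp q = smul ?g ?E"
    using tbt.bp_orthogonal[OF p q] by simp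
  have W: "x \<in> carrier Ab \<and> x \<odot> ?E = x" if "x \<in> W" for x
    using that Ec by (auto simp: W_def E_eq Ab.m_assoc tb.Es_idem)
  have EW: "?E \<in> W" unfolding W_def E_eq[OF order_refl]
    by (rule CollectI, rule exI[of _ "\<one>\<^bsub>Ab\<^esub>"]) simp
  have key: "ketbra x1 (tb.bp p) \<odot> ketbra (tb.bp q) x4 = smul ?g (ketbra x1 x4)"
    if "x1 \<in> W" "x4 \<in> W" for x1 x4
  proof -
    have c: "x1 \<in> carrier Ab" "x4 \<in> carrier Ab" "transp x4 \<in> carrier Ab" "transp (tb.bp p) \<in> carrier Ab"
      using W that by auto
    have "ketbra x1 (tb.bp p) \<odot> ketbra (tb.bp q) x4 =
      x1 \<odot> ((transp (tb.bp p) \<odot> tb.bp q) \<odot> transp x4)"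
      using c by (simp add: ketbra_def Ab.m_assoc)
    also have "\<dots> = smul ?g ((x1 \<odot> ?E) \<odot> transp x4)"
      unfolding orth using c Ec by (simp add: Ab.m_assoc del: if_split)
    finally show ?thesis using W[OF that(1)] by (simp add: ketbra_def)
  qed
  have EE: "ketbra ?E ?E = ?E"
    by (simp add: ketbra_def tbt.tr_Es tb.Es_idem)
  have uniq: "c = ?g"
    if "\<forall>x1\<in>W. \<forall>x4\<in>W. ketbra x1 (tb.bp p) \<odot> ketbra (tb.bp q) x4 = smul c (ketbra x1 x4)" for c
  proof -
    have "smul c ?E = smul ?g ?E" using that EW key[OF EW EW] EE by metis
    then have "smul (c - ?g) ?E = \<zero>\<^bsub>Ab\<^esub>"
      using Abc.sc_add_left[OF Ec, of c "- ?g"] tb.sc_minus_self[OF Ec, of ?g]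
      by (simp only: diff_conv_add_uminus)
    then have "c - ?g = 0"
      using Es_nonzero Abc.sc_cancel[of "c - ?g" ?E "\<zero>\<^bsub>Ab\<^esub>"] Ec by (metis Ab.zero_closed Abc.sc_zero)
    then show ?thesis by simp
  qed
  show ?thesis
    unfolding form_def bvec_eq[OF p] bvec_eq[OF q]
    by (rule the_equality) (use key uniq in blast)+
qed

lemma det_gram:
  assumes "distinct ps" "set ps = paths N"
  shows "det (gram ps) = (\<Prod>p\<in>paths N. sos.nrm p)"
proof -
  let ?n = "length ps"
  have G: "gram ps = mat ?n ?n (\<lambda>(i, j). if i = j then sos.nrm (ps ! i) else 0)"
    unfolding gram_def
  proof (rule cong_mat[OF refl refl])
    fix i j assume "i < ?n" "j < ?n"
    then have "ps ! i \<in> paths N" "ps ! j \<in> paths N" "ps ! i = ps ! j \<longleftrightarrow> i = j"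
      using assms nth_mem nth_eq_iff_index_eq by blast+
    then show "(case (i, j) of (i, j) \<Rightarrow> form (bvec (ps ! i)) (bvec (ps ! j))) =
      (case (i, j) of (i, j) \<Rightarrow> if i = j then sos.nrm (ps ! i) else 0)"
      by (simp add: form_bvec)
  qed
  have "det (gram ps) = prod_list (diag_mat (gram ps))"
    by (rule det_upper_triangular[of _ ?n]) (auto simp: G upper_triangular_def)
  also have "diag_mat (gram ps) = map sos.nrm ps"
    by (rule nth_equalityI) (auto simp: G diag_mat_def)
  also have "prod_list (map sos.nrm ps) = (\<Prod>p\<in>set ps. sos.nrm p)"
    using prod.distinct_set_conv_list[OF assms(1), of sos.nrm] by simp
  finally show ?thesis by (simp add: assms(2))
qed

end

section \<open>The product of the norms\<close>

definition binom_sum :: "nat \<Rightarrow> nat \<Rightarrow> nat" where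
  "binom_sum m t = (\<Sum>j<t. m choose j)"

text \<open>Read backwards, the defining sum of M_m(n) is an initial segment of a row of Pascal's
  triangle.\<close>

lemma Mnum_eq: "Mnum m n = binom_sum m (nat ((int m + 1 - \<bar>n\<bar>) div 2))"
proof -
  define T where "T = (int m + 1 - \<bar>n\<bar>) div 2"
  have "Bnum m (\<bar>n\<bar> + 2 * i - 1) = m choose nat (T - i)" for i
  proof -
    have "(int m - (\<bar>n\<bar> + 2 * i - 1)) div 2 = T - i" unfolding T_def by linarith
    then show ?thesis by (simp add: Bnum_def)
  qed
  then have "Mnum m n = (\<Sum>i=1..T. m choose nat (T - i))"
    by (simp add: Mnum_def T_def)
  also have "\<dots> = (\<Sum>j<nat T. m choose j)"
    by (rule sum.reindex_bij_witness[of _ "\<lambda>j. T - int j" "\<lambda>i. nat (T - i)"]) auto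
  finally show ?thesis by (simp add: binom_sum_def T_def)
qed

lemma binom_sum_Suc: "binom_sum (Suc m) (Suc t) = binom_sum m (Suc t) + binom_sum m t"
  by (induction t) (simp_all add: binom_sum_def)

text \<open>Pascal's rule on either side of height 0. At 0 itself the absolute value folds both
  neighbours onto the same partial sum, and a central binomial coefficient is left over.\<close>

lemma Mnum_Suc:
  assumes "m \<le> n"
  shows "Mnum (Suc n) (int n - 2 * int m) =
    Mnum n (int n - 2 * int m - 1) + Mnum n (int n - 2 * int m + 1) +
    (if n = 2 * m then n choose m else 0)"
proof -
  consider "n = 2 * m" | "2 * m < n" | "n < 2 * m" by linarith
  then show ?thesis
  proof cases
    case 1
    have "nat ((int (Suc n) + 1 - \<bar>int n - 2 * int m\<bar>) div 2) = Suc m"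
      "nat ((int n + 1 - \<bar>int n - 2 * int m - 1\<bar>) div 2) = m"
      "nat ((int n + 1 - \<bar>int n - 2 * int m + 1\<bar>) div 2) = m"
      using 1 by simp_all
    then show ?thesis unfolding Mnum_eq using 1 binom_sum_Suc[of n m] by (simp add: binom_sum_def)
  next
    case 2
    have "nat ((int (Suc n) + 1 - \<bar>int n - 2 * int m\<bar>) div 2) = Suc m"
      "nat ((int n + 1 - \<bar>int n - 2 * int m - 1\<bar>) div 2) = Suc m"
      "nat ((int n + 1 - \<bar>int n - 2 * int m + 1\<bar>) div 2) = m"
      using 2 by linarith+
    then show ?thesis unfolding Mnum_eq using 2 binom_sum_Suc[of n m] by simp
  next
    case 3
    have "nat ((int (Suc n) + 1 - \<bar>int n - 2 * int m\<bar>) div 2) = Suc (n - m)"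
      "nat ((int n + 1 - \<bar>int n - 2 * int m - 1\<bar>) div 2) = n - m"
      "nat ((int n + 1 - \<bar>int n - 2 * int m + 1\<bar>) div 2) = Suc (n - m)"
      using 3 assms by linarith+
    then show ?thesis unfolding Mnum_eq using 3 binom_sum_Suc[of n "n - m"] by simp
  qed
qed

lemma Mnum_outside: "Mnum n (- int n - 1) = 0" "Mnum n (int n + 1) = 0"
  by (simp_all add: Mnum_eq binom_sum_def)

lemma paths_0_eq: "paths 0 = {[0]}"
  by (auto simp: paths_def length_Suc_conv)

lemma paths_Suc_eq:
  "paths (Suc N) = (\<lambda>(p, s). p @ [p ! N + s]) ` (paths N \<times> {1, - 1})"
proof (rule Set.set_eqI)
  fix q
  show "q \<in> paths (Suc N) \<longleftrightarrow> q \<in> (\<lambda>(p, s). p @ [p ! N + s]) ` (paths N \<times> {1, - 1})"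
  proof
    assume q: "q \<in> paths (Suc N)"
    have l: "length q = Suc (Suc N)" using paths_length[OF q] by simp
    have qe: "q = butlast q @ [q ! Suc N]"
      using l append_butlast_last_id[of q] last_conv_nth[of q] by fastforce
    have nb: "butlast q ! i = q ! i" if "i \<le> N" for i
      using nth_butlast[of i q] l that by simp
    have "butlast q \<in> paths N"
      by (rule pathsI) (use l nb paths_0[OF q] paths_Suc[OF q] in auto)
    moreover have "q ! Suc N = butlast q ! N + 1 \<or> q ! Suc N = butlast q ! N + (- 1)"
      using paths_Suc[OF q, of N] nb[of N] by simp
    ultimately show "q \<in> (\<lambda>(p, s). p @ [p ! N + s]) ` (paths N \<times> {1, - 1})"
      using qe by (auto simp: image_iff intro!: bexI[of _ "butlast q"])
  next
    assume "q \<in> (\<lambda>(p, s). p @ [p ! N + s]) ` (paths N \<times> {1, - 1})"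
    then obtain p s where p: "p \<in> paths N" "s = 1 \<or> s = - 1" "q = p @ [p ! N + s]" by auto
    have l: "length p = Suc N" using paths_length[OF p(1)] by simp
    show "q \<in> paths (Suc N)"
    proof (rule pathsI)
      fix i assume "i < Suc N"
      then show "q ! Suc i = q ! i + 1 \<or> q ! Suc i = q ! i - 1"
        using p(2) paths_Suc[OF p(1), of i] l unfolding p(3) by (cases "i = N") (auto simp: nth_append)
    qed (use l paths_0[OF p(1)] p(3) in \<open>auto simp: nth_append\<close>)
  qed
qed

lemma prod_paths_Suc:
  fixes F :: "int list \<Rightarrow> 'b::comm_monoid_mult"
  shows "(\<Prod>p\<in>paths (Suc N). F p) =
    (\<Prod>p\<in>paths N. F (p @ [p ! N + 1]) * F (p @ [p ! N - 1]))"
proof -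
  have "inj_on (\<lambda>(p, s). p @ [p ! N + s]) (paths N \<times> {1, - 1})"
    by (auto simp: inj_on_def)
  then have "(\<Prod>p\<in>paths (Suc N). F p) = (\<Prod>(p, s)\<in>paths N \<times> {1, - 1}. F (p @ [p ! N + s]))"
    unfolding paths_Suc_eq by (subst prod.reindex) (auto simp: case_prod_beta)
  also have "\<dots> = (\<Prod>p\<in>paths N. \<Prod>s\<in>{1, - 1}. F (p @ [p ! N + s]))"
    by (rule prod.cartesian_product[symmetric])
  finally show ?thesis by simp
qed

lemma prod_paths_end:
  fixes g :: "int \<Rightarrow> 'b::comm_monoid_mult"
  shows "(\<Prod>p\<in>paths N. g (p ! N)) = (\<Prod>j\<le>N. g (int N - 2 * int j) ^ (N choose j))"
proof (induction N arbitrary: g)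
  case 0
  then show ?case by (simp add: paths_0_eq)
next
  case (Suc N)
  have nth: "(p @ [x]) ! Suc N = x" if "p \<in> paths N" for p x
    using paths_length[OF that] by (simp add: nth_append)
  have "(\<Prod>p\<in>paths (Suc N). g (p ! Suc N)) = (\<Prod>p\<in>paths N. g (p ! N + 1) * g (p ! N - 1))"
    unfolding prod_paths_Suc by (rule prod.cong) (simp_all add: nth)
  also have "\<dots> = (\<Prod>j\<le>N. (g (int N - 2 * int j + 1) * g (int N - 2 * int j - 1)) ^ (N choose j))"
    by (rule Suc)
  also have "\<dots> = (\<Prod>j\<le>N. g (int (Suc N) - 2 * int j) ^ (N choose j)) *
      (\<Prod>j\<le>N. g (int (Suc N) - 2 * int (Suc j)) ^ (N choose j))"
    by (simp add: power_mult_distrib prod.distrib algebra_simps)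
  also have "(\<Prod>j\<le>N. g (int (Suc N) - 2 * int j) ^ (N choose j)) =
      g (int (Suc N)) * (\<Prod>j\<le>N. g (int (Suc N) - 2 * int (Suc j)) ^ (N choose Suc j))"
    using prod.atMost_Suc[of "\<lambda>j. g (int (Suc N) - 2 * int j) ^ (N choose j)" N]
      prod.atMost_Suc_shift[of "\<lambda>j. g (int (Suc N) - 2 * int j) ^ (N choose j)" N]
    by (simp add: binomial_eq_0)
  finally show ?case
    by (subst prod.atMost_Suc_shift) (simp add: power_add prod.distrib mult_ac)
qed

text \<open>The height with index \<open>m\<close> lies between the endpoints with indices
  \<open>m\<close> and \<open>m + 1\<close>. So a column from above contains it if
  \<open>j \<le> m\<close>, and a column from below if \<open>m < j\<close>.\<close>

lemma tile_heights_image: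
  assumes "j \<le> N"
  shows "tile_heights (int N - 2 * int j) = (\<lambda>m. int N - 1 - 2 * int m) `
    {m \<in> {..<N}. if 2 * m < N then j \<le> m else m < j}"
proof (rule Set.set_eqI)
  fix a
  let ?S = "{m \<in> {..<N}. if 2 * m < N then j \<le> m else m < j}"
  show "a \<in> tile_heights (int N - 2 * int j) \<longleftrightarrow> a \<in> (\<lambda>m. int N - 1 - 2 * int m) ` ?S"
  proof
    assume a: "a \<in> tile_heights (int N - 2 * int j)"
    then have "odd (int N - 2 * int j - a)" by (simp add: tile_heights_def)
    then have "even (int N - 1 - a)" by presburger
    then obtain c where c: "int N - 1 - a = 2 * c" by blast
    have r: "if int N - 2 * int j \<ge> 0 then 0 \<le> a \<and> a < int N - 2 * int j
      else int N - 2 * int j < a \<and> a < 0"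
      using a by (simp add: tile_heights_def)
    then have "c \<ge> 0" using c by (auto split: if_splits)
    then obtain m where m: "c = int m" using nonneg_int_cases by blast
    have a_eq: "a = int N - 1 - 2 * int m" using c m by simp
    have "m \<in> ?S" using r assms unfolding a_eq by (auto split: if_splits)
    then show "a \<in> (\<lambda>m. int N - 1 - 2 * int m) ` ?S" using a_eq by blast
  next
    assume "a \<in> (\<lambda>m. int N - 1 - 2 * int m) ` ?S"
    then obtain m where m: "m \<in> ?S" "a = int N - 1 - 2 * int m" by blast
    then show "a \<in> tile_heights (int N - 2 * int j)"
      unfolding tile_heights_def using assms by (auto split: if_splits)
  qed
qed

text \<open>After exchanging the products, the exponent of a height counts the paths that end beyond
  it, which is a partial sum of binomial coefficients from the nearer end of the row.\<close>

lemma prod_paths_col: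
  fixes f :: "int \<Rightarrow> 'b::comm_semiring_1"
  shows "(\<Prod>p\<in>paths N. col f (p ! N)) =
    (\<Prod>m<N. f (int N - 1 - 2 * int m) ^ Mnum N (int N - 1 - 2 * int m))"
proof -
  let ?a = "\<lambda>m. int N - 1 - 2 * int m"
  let ?T = "\<lambda>m j. if 2 * m < N then j \<le> m else m < j"
  have col: "col f (int N - 2 * int j) = (\<Prod>m<N. if ?T m j then f (?a m) else 1)" if "j \<le> N" for j
  proof -
    have "col f (int N - 2 * int j) = (\<Prod>m\<in>{m \<in> {..<N}. ?T m j}. f (?a m))"
      unfolding col_def tile_heights_image[OF that] by (subst prod.reindex) (auto simp: inj_on_def)
    also have "\<dots> = (\<Prod>m<N. if ?T m j then f (?a m) else 1)"
      by (rule prod.inter_filter) simp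
    finally show ?thesis .
  qed
  have "(\<Prod>p\<in>paths N. col f (p ! N)) = (\<Prod>j\<le>N. \<Prod>m<N. (if ?T m j then f (?a m) else 1) ^ (N choose j))"
    unfolding prod_paths_end by (rule prod.cong[OF refl]) (simp add: col prod_power_distrib)
  also have "\<dots> = (\<Prod>m<N. \<Prod>j\<le>N. f (?a m) ^ (if ?T m j then N choose j else 0))"
    by (subst prod.swap) (intro prod.cong refl, simp)
  also have "\<dots> = (\<Prod>m<N. f (?a m) ^ (\<Sum>j\<le>N. if ?T m j then N choose j else 0))"
    by (simp add: power_sum)
  also have "\<dots> = (\<Prod>m<N. f (?a m) ^ Mnum N (?a m))"
  proof (rule prod.cong[OF refl])
    fix m assume "m \<in> {..<N}"
    then have mN: "m < N" by simp
    have "(\<Sum>j\<le>N. if ?T m j then N choose j else 0) = Mnum N (?a m)"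
    proof (cases "2 * m < N")
      case True
      have "nat ((int N + 1 - \<bar>?a m\<bar>) div 2) = Suc m" using True by linarith
      moreover have "(\<Sum>j\<le>N. if j \<le> m then N choose j else 0) = (\<Sum>j\<in>{j \<in> {..N}. j \<le> m}. N choose j)"
        by (rule sum.inter_filter[symmetric]) simp
      moreover have "{j \<in> {..N}. j \<le> m} = {..<Suc m}" using mN by auto
      ultimately show ?thesis using True by (simp add: Mnum_eq binom_sum_def)
    next
      case False
      have "nat ((int N + 1 - \<bar>?a m\<bar>) div 2) = N - m" using False mN by linarith
      moreover have "(\<Sum>j\<le>N. if m < j then N choose j else 0) = (\<Sum>j\<in>{j \<in> {..N}. m < j}. N choose j)"
        by (rule sum.inter_filter[symmetric]) simp
      moreover have "\<dots> = (\<Sum>j<N - m. N choose j)"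
        by (rule sum.reindex_bij_witness[of _ "\<lambda>j. N - j" "\<lambda>j. N - j"])
          (auto simp: binomial_symmetric[symmetric])
      ultimately show ?thesis using False by (simp add: Mnum_eq binom_sum_def)
    qed
    then show "f (?a m) ^ (\<Sum>j\<le>N. if ?T m j then N choose j else 0) = f (?a m) ^ Mnum N (?a m)"
      by simp
  qed
  finally show ?thesis .
qed

text \<open>The number of half-tiles in all paths together; -2 times it is the exponent in
  \<open>alpha\<close>.\<close>

definition Msum :: "nat \<Rightarrow> nat" where
  "Msum n = (\<Sum>m<n. Mnum n (int n - 1 - 2 * int m))"

text \<open>\<open>Mnum_Suc\<close> in multiplicative form: summation by parts, with boundary terms
  trivial by \<open>Mnum_outside\<close>.\<close>

lemma prod_power_Mnum_Suc:
  fixes f :: "int \<Rightarrow> 'b::comm_monoid_mult"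
  shows "(\<Prod>m<Suc n. f (int n - 2 * int m) ^ Mnum (Suc n) (int n - 2 * int m)) =
    (\<Prod>m<n. (f (int n - 1 - 2 * int m + 1) * f (int n - 1 - 2 * int m - 1)) ^ Mnum n (int n - 1 - 2 * int m)) *
    f 0 ^ (if even n then n choose (n div 2) else 0)"
proof -
  let ?c = "\<lambda>m. int n - 2 * int m"
  have "(\<Prod>m<Suc n. f (?c m) ^ Mnum (Suc n) (?c m)) =
    (\<Prod>m<Suc n. f (?c m) ^ Mnum n (?c m - 1)) * (\<Prod>m<Suc n. f (?c m) ^ Mnum n (?c m + 1)) *
    (\<Prod>m<Suc n. f (?c m) ^ (if n = 2 * m then n choose m else 0))"
    by (simp add: Mnum_Suc power_add prod.distrib[symmetric] del: prod.lessThan_Suc)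
  also have "(\<Prod>m<Suc n. f (?c m) ^ Mnum n (?c m - 1)) =
      (\<Prod>m<n. f (int n - 1 - 2 * int m + 1) ^ Mnum n (int n - 1 - 2 * int m))"
  proof -
    have "?c n - 1 = - int n - 1" by simp
    then have z: "Mnum n (?c n - 1) = 0" by (simp only: Mnum_outside)
    show ?thesis
      unfolding prod.lessThan_Suc z power_0 mult_1_right by (rule prod.cong) (simp_all add: algebra_simps)
  qed
  also have "(\<Prod>m<Suc n. f (?c m) ^ Mnum n (?c m + 1)) =
      (\<Prod>m<n. f (int n - 1 - 2 * int m - 1) ^ Mnum n (int n - 1 - 2 * int m))"
  proof -
    have z: "Mnum n (?c 0 + 1) = 0" using Mnum_outside(2)[of n] by simp
    show ?thesis
      unfolding prod.lessThan_Suc_shift z power_0 mult_1_left by (rule prod.cong) (simp_all add: algebra_simps)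
  qed
  also have "(\<Prod>m<Suc n. f (?c m) ^ (if n = 2 * m then n choose m else 0)) =
      f 0 ^ (if even n then n choose (n div 2) else 0)"
  proof (cases "even n")
    case True
    then obtain h where h: "n = 2 * h" by blast
    have "(\<Prod>m<Suc n. f (?c m) ^ (if n = 2 * m then n choose m else 0)) =
      (\<Prod>m<Suc n. if m = h then f 0 ^ (n choose h) else 1)"
      by (rule prod.cong) (auto simp: h)
    then show ?thesis using h by simp
  next
    case False
    then have "n \<noteq> 2 * m" for m by auto
    then show ?thesis using False by simp
  qed
  finally show ?thesis by (simp add: power_mult_distrib prod.distrib)
qed

text \<open>Read off from \<open>prod_power_Mnum_Suc\<close> for the constant function 2 by
  comparing exponents.\<close>

lemma Msum_Suc: "Msum (Suc n) = 2 * Msum n + (if even n then n choose (n div 2) else 0)"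
proof -
  have L: "(\<Prod>m<Suc n. 2 ^ Mnum (Suc n) (int n - 2 * int m)) = (2 :: nat) ^ Msum (Suc n)"
    by (simp add: Msum_def power_sum del: sum.lessThan_Suc prod.lessThan_Suc)
  have R: "(\<Prod>m<n. (2 * 2) ^ Mnum n (int n - 1 - 2 * int m)) = (2 :: nat) ^ (2 * Msum n)"
    unfolding power_mult power2_eq_square Msum_def power_sum ..
  have "(2 :: nat) ^ Msum (Suc n) = 2 ^ (2 * Msum n + (if even n then n choose (n div 2) else 0))"
    using prod_power_Mnum_Suc[of "\<lambda>_. 2::nat" n] unfolding L R power_add .
  then show ?thesis by simp
qed

text \<open>\<open>\<rho>\<close> is the multiplicative second difference of \<open>\<psi>\<close>,
  and the multiplicities satisfy the matching recurrence with a source at height 0 alone. Hence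
  everything telescopes except a power of \<open>\<psi> 0\<close>. Each path has two extensions by
  one step, which is the origin of the squares in the induction step.\<close>

lemma prod_rho:
  fixes \<psi> :: "int \<Rightarrow> complex"
  defines "\<rho> \<equiv> \<lambda>a. \<psi> (a + 1) * \<psi> (a - 1) / \<psi> a ^ 2"
  assumes "\<And>a. \<bar>a\<bar> < int n \<Longrightarrow> \<psi> a \<noteq> 0"
  shows "(\<Prod>p\<in>paths n. \<Prod>i<n. col \<rho> (p ! i)) * \<psi> 0 ^ (2 * Msum n) =
    (\<Prod>m<n. (\<psi> (int n - 1 - 2 * int m) ^ 2) ^ Mnum n (int n - 1 - 2 * int m))"
  using assms(2)
proof (induction n)
  case 0
  then show ?case by (simp add: Msum_def)
next
  case (Suc n)
  let ?a = "\<lambda>m. int n - 1 - 2 * int m"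
  let ?Q = "\<Prod>p\<in>paths n. \<Prod>i<n. col \<rho> (p ! i)"
  let ?d = "if even n then n choose (n div 2) else 0"
  have IH: "?Q * \<psi> 0 ^ (2 * Msum n) = (\<Prod>m<n. (\<psi> (?a m) ^ 2) ^ Mnum n (?a m))"
    by (rule Suc.IH) (use Suc.prems in simp)
  have "(\<Prod>p\<in>paths (Suc n). \<Prod>i<Suc n. col \<rho> (p ! i)) =
    (\<Prod>p\<in>paths n. ((\<Prod>i<n. col \<rho> (p ! i)) * col \<rho> (p ! n)) ^ 2)"
    unfolding prod_paths_Suc
  proof (rule prod.cong[OF refl])
    fix p assume "p \<in> paths n"
    then have "(\<Prod>i<Suc n. col \<rho> ((p @ [x]) ! i)) = (\<Prod>i<n. col \<rho> (p ! i)) * col \<rho> (p ! n)" for x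
      using paths_length[of p n] by (simp add: nth_append)
    then show "(\<Prod>i<Suc n. col \<rho> ((p @ [p ! n + 1]) ! i)) * (\<Prod>i<Suc n. col \<rho> ((p @ [p ! n - 1]) ! i)) =
       ((\<Prod>i<n. col \<rho> (p ! i)) * col \<rho> (p ! n)) ^ 2"
      by (simp only: power2_eq_square)
  qed
  also have "\<dots> = (?Q * (\<Prod>m<n. \<rho> (?a m) ^ Mnum n (?a m))) ^ 2"
    by (simp add: prod_power_distrib[symmetric] prod.distrib prod_paths_col)
  finally have Q: "(\<Prod>p\<in>paths (Suc n). \<Prod>i<Suc n. col \<rho> (p ! i)) * \<psi> 0 ^ (2 * Msum (Suc n)) =
    (?Q * \<psi> 0 ^ (2 * Msum n) * (\<Prod>m<n. \<rho> (?a m) ^ Mnum n (?a m))) ^ 2 * \<psi> 0 ^ (2 * ?d)"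
    unfolding Msum_Suc by (simp only: power_mult_distrib power_add power_mult mult_ac distrib_left)
  also have "\<dots> = (\<Prod>m<n. ((\<psi> (?a m) ^ 2 * \<rho> (?a m)) ^ Mnum n (?a m)) ^ 2) * (\<psi> 0 ^ 2) ^ ?d"
    unfolding IH by (simp only: prod_power_distrib[symmetric] power_mult_distrib prod.distrib power_mult)
  also have "(\<Prod>m<n. ((\<psi> (?a m) ^ 2 * \<rho> (?a m)) ^ Mnum n (?a m)) ^ 2) =
     (\<Prod>m<n. (\<psi> (?a m + 1) ^ 2 * \<psi> (?a m - 1) ^ 2) ^ Mnum n (?a m))"
  proof (rule prod.cong[OF refl])
    fix m assume "m \<in> {..<n}"
    then have "\<psi> (?a m) \<noteq> 0" by (intro Suc.prems) auto
    then have "\<psi> (?a m) ^ 2 * \<rho> (?a m) = \<psi> (?a m + 1) * \<psi> (?a m - 1)" by (simp add: \<rho>_def)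
    then show "((\<psi> (?a m) ^ 2 * \<rho> (?a m)) ^ Mnum n (?a m)) ^ 2 =
        (\<psi> (?a m + 1) ^ 2 * \<psi> (?a m - 1) ^ 2) ^ Mnum n (?a m)"
      by (simp only: power_mult_distrib power_commutes power_mult[symmetric] mult.commute)
  qed
  also have "\<dots> * (\<psi> 0 ^ 2) ^ ?d =
      (\<Prod>m<Suc n. (\<psi> (int n - 2 * int m) ^ 2) ^ Mnum (Suc n) (int n - 2 * int m))"
    by (rule prod_power_Mnum_Suc[symmetric, of "\<lambda>a. \<psi> a ^ 2"])
  finally show ?case by simp
qed

text \<open>Half of an odd row of Pascal's triangle, by its symmetry.\<close>

lemma Mnum_0_odd: "Mnum (2 * K + 1) 0 = 2 ^ (2 * K)"
proof -
  let ?N = "2 * K + 1"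
  have "nat ((int ?N + 1 - \<bar>0\<bar>) div 2) = K + 1" by simp
  then have M: "Mnum ?N 0 = (\<Sum>j<K + 1. ?N choose j)"
    by (simp only: Mnum_eq binom_sum_def)
  have split: "{..?N} = {..<K + 1} \<union> {K + 1..?N}" by auto
  have "2 ^ ?N = (\<Sum>j\<le>?N. ?N choose j)" by (rule choose_row_sum[symmetric])
  also have "\<dots> = (\<Sum>j<K + 1. ?N choose j) + (\<Sum>j=K + 1..?N. ?N choose j)"
    unfolding split by (rule sum.union_disjoint) auto
  also have "(\<Sum>j=K + 1..?N. ?N choose j) = (\<Sum>j<K + 1. ?N choose j)"
    by (rule sum.reindex_bij_witness[of _ "\<lambda>j. ?N - j" "\<lambda>j. ?N - j"])
      (auto simp: binomial_symmetric[symmetric])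
  finally show ?thesis using M by simp
qed

section \<open>Pairing of opposite heights\<close>

lemma prod_lessThan_plus:
  fixes g :: "nat \<Rightarrow> 'b::comm_monoid_mult"
  shows "(\<Prod>m<K + L. g m) = (\<Prod>m<K. g m) * (\<Prod>m<L. g (K + m))"
  by (induction L) (simp_all add: mult.assoc)

lemma prod_symmetric_even:
  fixes G :: "int \<Rightarrow> 'b::comm_monoid_mult"
  shows "(\<Prod>m<2 * K. G (int (2 * K) - 1 - 2 * int m)) =
    (\<Prod>n<K. G (2 * int n + 1) * G (- (2 * int n + 1)))"
proof -
  have "(\<Prod>m<K. G (int (2 * K) - 1 - 2 * int m)) = (\<Prod>n<K. G (2 * int n + 1))"
    by (rule prod.reindex_bij_witness[of _ "\<lambda>n. K - 1 - n" "\<lambda>m. K - 1 - m"])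
      (auto simp: of_nat_diff intro!: arg_cong[of _ _ G])
  moreover have "(\<Prod>m<K. G (int (2 * K) - 1 - 2 * int (K + m))) = (\<Prod>n<K. G (- (2 * int n + 1)))"
    by (rule prod.cong) (auto intro!: arg_cong[of _ _ G])
  ultimately show ?thesis
    using prod_lessThan_plus[of "\<lambda>m. G (int (2 * K) - 1 - 2 * int m)" K K]
    by (simp only: mult_2[symmetric] prod.distrib)
qed

lemma prod_symmetric_odd:
  fixes G :: "int \<Rightarrow> 'b::comm_monoid_mult"
  shows "(\<Prod>m<2 * K + 1. G (int (2 * K + 1) - 1 - 2 * int m)) =
    G 0 * (\<Prod>n=1..K. G (2 * int n) * G (- (2 * int n)))"
proof -
  have "(\<Prod>m<K. G (int (2 * K + 1) - 1 - 2 * int m)) = (\<Prod>n=1..K. G (2 * int n))"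
    by (rule prod.reindex_bij_witness[of _ "\<lambda>n. K - n" "\<lambda>m. K - m"])
      (auto simp: of_nat_diff intro!: arg_cong[of _ _ G])
  moreover have "(\<Prod>m<K + 1. G (int (2 * K + 1) - 1 - 2 * int (K + m))) =
      G 0 * (\<Prod>n=1..K. G (- (2 * int n)))"
  proof -
    have "(\<Prod>m<K + 1. G (int (2 * K + 1) - 1 - 2 * int (K + m))) = (\<Prod>m<Suc K. G (- (2 * int m)))"
      by (rule prod.cong) (auto intro!: arg_cong[of _ _ G])
    also have "\<dots> = G 0 * (\<Prod>m<K. G (- (2 * int (Suc m))))"
      by (subst prod.lessThan_Suc_shift) simp
    also have "(\<Prod>m<K. G (- (2 * int (Suc m)))) = (\<Prod>n=1..K. G (- (2 * int n)))"
      by (rule prod.reindex_bij_witness[of _ "\<lambda>n. n - 1" Suc]) auto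
    finally show ?thesis .
  qed
  moreover have "(\<Prod>m<2 * K + 1. g m) = (\<Prod>m<K. g m) * (\<Prod>m<K + 1. g (K + m))" for g :: "nat \<Rightarrow> 'b"
    using prod_lessThan_plus[of g K "K + 1"] by (simp only: add.assoc[symmetric] mult_2)
  ultimately show ?thesis by (simp only: prod.distrib mult_ac)
qed

context generic_two_boundary_TL
begin

text \<open>The four factors with fixed \<epsilon>1; the height and the term in \<omega>1 are
  absorbed in u.\<close>

definition quad :: "complex \<Rightarrow> complex" where
  "quad u = (\<Prod>\<epsilon>2\<in>{1, - 1}. \<Prod>\<epsilon>3\<in>{1, - 1}. qnum \<eta> ((u + \<epsilon>2 * \<omega>2 + \<epsilon>3 * \<theta>) / 2))"

lemma quad_expand: "quad u = qnum \<eta> ((u + \<omega>2 + \<theta>) / 2) * qnum \<eta> ((u + \<omega>2 - \<theta>) / 2) *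
  (qnum \<eta> ((u - \<omega>2 + \<theta>) / 2) * qnum \<eta> ((u - \<omega>2 - \<theta>) / 2))"
  by (simp add: quad_def)

lemma quad_minus: "quad (- u) = quad u"
proof -
  have "(- u + \<omega>2 + \<theta>) / 2 = - ((u - \<omega>2 - \<theta>) / 2)" "(- u + \<omega>2 - \<theta>) / 2 = - ((u - \<omega>2 + \<theta>) / 2)"
    "(- u - \<omega>2 + \<theta>) / 2 = - ((u + \<omega>2 - \<theta>) / 2)" "(- u - \<omega>2 - \<theta>) / 2 = - ((u + \<omega>2 + \<theta>) / 2)"
    by (simp_all add: field_simps)
  note e = this
  show ?thesis unfolding quad_expand e qnum_minus by simp
qed

text \<open>Passing from u to -u changes the sign of both numerator factors and of one denominator
  factor, so k(-u) loses the minus sign of k(u), and one minus sign remains in the product.\<close>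

lemma kk_eq: "sos.kk a = - quad (\<omega>1 - of_int a) / (psi a * qnum \<eta> (\<omega>2 + 1)) ^ 2"
proof -
  let ?u = "\<omega>1 - of_int a" and ?w = "qnum \<eta> (\<omega>2 + 1)"
  have "(- ?u - \<omega>2 + \<theta>) / 2 = - ((?u + \<omega>2 - \<theta>) / 2)" "(- ?u - \<omega>2 - \<theta>) / 2 = - ((?u + \<omega>2 + \<theta>) / 2)"
    by (simp_all add: field_simps)
  note e = this
  have km: "k (- ?u) = qnum \<eta> ((?u + \<omega>2 - \<theta>) / 2) * qnum \<eta> ((?u + \<omega>2 + \<theta>) / 2) / (psi a * ?w)"
    unfolding k_def e qnum_minus psi_def by simp
  have kp: "k ?u = - (qnum \<eta> ((?u - \<omega>2 + \<theta>) / 2) * qnum \<eta> ((?u - \<omega>2 - \<theta>) / 2) / (psi a * ?w))"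
    unfolding k_def psi_def ..
  have "sos.kk a = k (- ?u) * k ?u"
    by (simp add: sos.kk_def kap_def)
  then show ?thesis unfolding km kp quad_expand power2_eq_square by (simp add: mult_ac)
qed

text \<open>The tile product ?Q is known only after multiplication by a power of
  \<open>psi 0\<close>. The resulting ?P is exactly the \<open>psi\<close> part of the denominators
  of the half-tiles, so of all q-numbers [\<omega>1 - a] only [\<omega>1] survives, in
  \<open>alpha\<close>.\<close>

lemma det_gram_quad:
  assumes "distinct ps" "set ps = paths N"
  shows "det (gram ps) = alpha *
    (\<Prod>m<N. (- quad (\<omega>1 - of_int (int N - 1 - 2 * int m))) ^ Mnum N (int N - 1 - 2 * int m))"
proof -
  let ?a = "\<lambda>m. int N - 1 - 2 * int m" and ?w = "qnum \<eta> (\<omega>2 + 1)"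
  let ?M = "\<lambda>m. Mnum N (?a m)"
  let ?Q = "\<Prod>p\<in>paths N. \<Prod>i<N. col sos.rho (p ! i)"
  let ?P = "\<Prod>m<N. (psi (?a m) ^ 2) ^ ?M m"
  let ?F = "\<Prod>m<N. (- quad (\<omega>1 - of_int (?a m))) ^ ?M m"
  have Q: "?Q * psi 0 ^ (2 * Msum N) = ?P"
    using prod_rho[of N psi] sos.psi_nz unfolding sos.rho_def[abs_def] by simp
  have P: "?P \<noteq> 0"
    using sos.psi_nz by (auto simp: prod_zero_iff)
  have "det (gram ps) = ?Q * (\<Prod>m<N. sos.kk (?a m) ^ ?M m)"
    unfolding det_gram[OF assms] sos.nrm_def prod.distrib prod_paths_col ..
  also have "(\<Prod>m<N. sos.kk (?a m) ^ ?M m) = ?F / (?P * (?w ^ 2) ^ Msum N)"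
    unfolding kk_eq power_divide power_mult_distrib prod_dividef prod.distrib Msum_def power_sum ..
  finally have fin: "det (gram ps) = ?Q * (?F / (?P * (?w ^ 2) ^ Msum N))" .
  have "det (gram ps) * (psi 0 * ?w) ^ (2 * Msum N) = ?F"
  proof -
    have e: "(psi 0 * ?w) ^ (2 * Msum N) = psi 0 ^ (2 * Msum N) * (?w ^ 2) ^ Msum N"
      by (simp only: power_mult_distrib power_mult)
    have "det (gram ps) * (psi 0 * ?w) ^ (2 * Msum N) =
        (?Q * psi 0 ^ (2 * Msum N)) * (?F / (?P * (?w ^ 2) ^ Msum N)) * (?w ^ 2) ^ Msum N"
      unfolding fin e by (simp only: mult_ac)
    also have "\<dots> = ?F" unfolding Q
    proof -
      have cancel: "x * (y / (x * z)) * z = y" if "x \<noteq> 0" "z \<noteq> 0" for x y z :: complex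
        using that by simp
      show "?P * (?F / (?P * (?w ^ 2) ^ Msum N)) * (?w ^ 2) ^ Msum N = ?F"
        by (rule cancel[OF P]) (use w2_generic in simp)
    qed
    finally show ?thesis .
  qed
  moreover have "alpha = 1 / (psi 0 * ?w) ^ (2 * Msum N)"
  proof -
    have "{0..N - 1} = {..<N}" using N_ge_1 by auto
    then have "alpha = (psi 0 * ?w) powi (- int (2 * Msum N))"
      by (simp add: alpha_def Msum_def psi_def)
    then show ?thesis by (simp only: power_int_minus power_int_of_nat inverse_eq_divide)
  qed
  moreover have "(psi 0 * ?w) ^ (2 * Msum N) \<noteq> 0" using sos.psi_0_nz w2_generic by simp
  ultimately show ?thesis
    using eq_divide_imp[of "(psi 0 * ?w) ^ (2 * Msum N)" "det (gram ps)" ?F]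
    by (simp only: times_divide_eq_left mult_1_left simp_thms)
qed

text \<open>The exponents at n and -n agree, so the two minus signs cancel; evenness of
  \<open>quad\<close> turns \<omega>1 - n into n - \<omega>1, which is the choice \<epsilon>1 =
  -1.\<close>

lemma quad_pair:
  assumes "n \<ge> 0"
  shows "(- quad (\<omega>1 - of_int n)) ^ Mnum N n * (- quad (\<omega>1 - of_int (- n))) ^ Mnum N (- n) =
    (\<Prod>\<epsilon>1\<in>{1, - 1}. \<Prod>\<epsilon>2\<in>{1, - 1}. \<Prod>\<epsilon>3\<in>{1, - 1}.
      qnum \<eta> ((of_int n + \<epsilon>1 * \<omega>1 + \<epsilon>2 * \<omega>2 + \<epsilon>3 * \<theta>) / 2)) ^ Mnum N n"
proof -
  have "Mnum N (- n) = Mnum N n" by (simp add: Mnum_eq)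
  moreover have "quad (\<omega>1 - of_int n) = quad (of_int n - \<omega>1)" using quad_minus[of "of_int n - \<omega>1"] by simp
  moreover have "(\<Prod>\<epsilon>1\<in>{1, - 1}. \<Prod>\<epsilon>2\<in>{1, - 1}. \<Prod>\<epsilon>3\<in>{1, - 1}.
      qnum \<eta> ((of_int n + \<epsilon>1 * \<omega>1 + \<epsilon>2 * \<omega>2 + \<epsilon>3 * \<theta>) / 2)) = quad (of_int n + \<omega>1) * quad (of_int n - \<omega>1)"
    unfolding quad_def by simp
  ultimately show ?thesis by (simp add: power_mult_distrib[symmetric] add.commute mult.commute)
qed

end

text \<open>\<open>ps\<close> lists the paths in an arbitrary order, on which the determinant does
  not depend. For N = 1 the determinant is k(\<omega>1) k(-\<omega>1), the negative of
  \<open>alpha\<close> times the four q-numbers, so the odd formula is stated with an explicit sign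
  in this case.\<close>

theorem theorem5p17:
  fixes N :: nat and \<eta> \<omega>1 \<omega>2 \<theta> :: complex and ps :: "int list list"
  assumes "N \<ge> 1"
    and "qpow \<eta> 1 \<noteq> qpow \<eta> (- 1)"
    and "qnum \<eta> (\<omega>1 + 1) \<noteq> 0"
    and "qnum \<eta> (\<omega>2 + 1) \<noteq> 0"
    and "\<forall>h::int. \<bar>h\<bar> < int N \<longrightarrow> qnum \<eta> (\<omega>1 - of_int h) \<noteq> 0"
    and "distinct ps"
    and "set ps = paths N"
  shows "(even N \<longrightarrow>
      det (two_boundary_TL.gram N \<eta> \<omega>1 \<omega>2 \<theta> ps) =
        two_boundary_TL.alpha N \<eta> \<omega>1 \<omega>2 *
        (\<Prod>n = 0..(N - 2) div 2.
          (\<Prod>\<epsilon>1\<in>{1, -1}. \<Prod>\<epsilon>2\<in>{1, -1}. \<Prod>\<epsilon>3\<in>{1, -1}.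
             qnum \<eta> ((1 + 2 * of_nat n + \<epsilon>1 * \<omega>1 + \<epsilon>2 * \<omega>2 + \<epsilon>3 * \<theta>) / 2))
          ^ Mnum N (2 * int n + 1)))
    \<and> (odd N \<longrightarrow>
      det (two_boundary_TL.gram N \<eta> \<omega>1 \<omega>2 \<theta> ps) =
        (if N = 1 then - 1 else 1) *
        (two_boundary_TL.alpha N \<eta> \<omega>1 \<omega>2 *
        (\<Prod>\<epsilon>2\<in>{1, -1}. \<Prod>\<epsilon>3\<in>{1, -1}. qnum \<eta> ((\<omega>1 + \<epsilon>2 * \<omega>2 + \<epsilon>3 * \<theta>) / 2)) ^ (2 ^ (N - 1)) *
        (\<Prod>n = 1..(N - 1) div 2.
          (\<Prod>\<epsilon>1\<in>{1, -1}. \<Prod>\<epsilon>2\<in>{1, -1}. \<Prod>\<epsilon>3\<in>{1, -1}.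
             qnum \<eta> ((2 * of_nat n + \<epsilon>1 * \<omega>1 + \<epsilon>2 * \<omega>2 + \<epsilon>3 * \<theta>) / 2))
          ^ Mnum N (2 * int n))))"
proof -
  interpret generic_two_boundary_TL N \<eta> \<omega>1 \<omega>2 \<theta>
    by standard (use assms in auto)
  let ?G = "\<lambda>a. (- quad (\<omega>1 - of_int a)) ^ Mnum N a"
  let ?O = "\<lambda>x. \<Prod>\<epsilon>1\<in>{1, -1}. \<Prod>\<epsilon>2\<in>{1, -1}. \<Prod>\<epsilon>3\<in>{1, -1}.
      qnum \<eta> ((x + \<epsilon>1 * \<omega>1 + \<epsilon>2 * \<omega>2 + \<epsilon>3 * \<theta>) / 2)"
  have D: "det (gram ps) = alpha * (\<Prod>m<N. ?G (int N - 1 - 2 * int m))"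
    by (rule det_gram_quad[OF assms(6,7)])
  have pair: "?G n * ?G (- n) = ?O (of_int n) ^ Mnum N n" if "n \<ge> 0" for n
    by (rule quad_pair[OF that])
  have "det (gram ps) = alpha * (\<Prod>n = 0..(N - 2) div 2. ?O (1 + 2 * of_nat n) ^ Mnum N (2 * int n + 1))"
    if ev: "even N"
  proof -
    obtain K where K: "N = 2 * K" using ev by blast
    have range: "{0..(N - 2) div 2} = {..<K}" using K assms(1) by auto
    have GG: "?G (2 * int n + 1) * ?G (- (2 * int n + 1)) = ?O (1 + 2 * of_nat n) ^ Mnum N (2 * int n + 1)" for n
    proof -
      have e: "of_int (2 * int n + 1) = (1 + 2 * of_nat n :: complex)" by simp
      have "0 \<le> 2 * int n + 1" by simp
      from pair[OF this] show ?thesis unfolding e .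
    qed
    have "(\<Prod>m<N. ?G (int N - 1 - 2 * int m)) = (\<Prod>n<K. ?G (2 * int n + 1) * ?G (- (2 * int n + 1)))"
      using prod_symmetric_even[of ?G K] unfolding K[symmetric] .
    then show ?thesis unfolding D range GG by (rule arg_cong)
  qed
  moreover have "det (gram ps) = (if N = 1 then - 1 else 1) * (alpha * quad \<omega>1 ^ (2 ^ (N - 1)) *
      (\<Prod>n = 1..(N - 1) div 2. ?O (2 * of_nat n) ^ Mnum N (2 * int n)))"
    if od: "odd N"
  proof -
    obtain K where K: "N = 2 * K + 1" using od oddE by blast
    have range: "(N - 1) div 2 = K" using K by simp
    have GG: "?G (2 * int n) * ?G (- (2 * int n)) = ?O (2 * of_nat n) ^ Mnum N (2 * int n)" for n
    proof -
      have e: "of_int (2 * int n) = (2 * of_nat n :: complex)" by simp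
      have "0 \<le> 2 * int n" by simp
      from pair[OF this] show ?thesis unfolding e .
    qed
    \<comment> \<open>Height 0 has no partner to cancel its minus sign; its exponent
      \<open>2 ^ (N - 1)\<close> is odd for N = 1 only.\<close>
    have G0: "?G 0 = (if N = 1 then - 1 else 1) * quad \<omega>1 ^ (2 ^ (N - 1))"
    proof -
      have "Mnum N 0 = 2 ^ (N - 1)" using Mnum_0_odd[of K] K by simp
      moreover have "(- 1 :: complex) ^ (2 ^ (N - 1)) = (if N = 1 then - 1 else 1)"
        using K by (auto simp: minus_one_power_iff)
      ultimately show ?thesis using power_mult_distrib[of "- 1" "quad \<omega>1" "2 ^ (N - 1)"] by simp
    qed
    have "(\<Prod>m<N. ?G (int N - 1 - 2 * int m)) = ?G 0 * (\<Prod>n=1..K. ?G (2 * int n) * ?G (- (2 * int n)))"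
      using prod_symmetric_odd[of ?G K] unfolding K[symmetric] .
    then show ?thesis unfolding D range GG G0 by (simp only: mult_ac)
  qed
  ultimately show ?thesis unfolding quad_def by blast
qed

end
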